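(* Let $H\in C^2(\mathbb{R}^d)$ be convex and coercive (i.e. $H(p)\to+\infty$ as $|p|\to\infty$), let $g:\mathbb{T}^d\to\mathbb{R}$ be Lipschitz continuous and semiconcave, and let $F\in C^2(\mathbb{R}^{d}\times\mathbb{R}^d)$ be convex with $F(-p,p)=H(p)$ for every $p\in\mathbb{R}^d$. Let $R>0$ be a constant, and let $\varepsilon=(h,\Delta t)$ be chosen so that the monotonicity condition with constant $R$ holds. Let $u$ be the viscosity solution of $$\partial_t u+H(Du)=0 \ \text{ in } \mathbb{T}^d\times(0,T),\qquad u(\cdot,0)=g \ \text{ on }\mathbb{T}^d ,$$ and let $\{u^\varepsilon_n\}_{n=0}^N$ be the solution of the semi-discrete finite difference scheme. Then there exists $C>0$, independent of $\varepsilon$, such that $$\sup_{n=0,\dots,N}\big\|u_n^\varepsilon(\cdot)-u(\cdot,n\Delta t)\big\|_{L^1(\mathbb{T}^d)}\le C\,|\varepsilon| = C\,(h+\Delta t).$$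
   Context: $\mathbb{T}^d$ is the $d$-dimensional flat torus, identified with $[0,1]^d$ with periodic boundary conditions; $T>0$ is fixed and $e_1,\dots,e_d$ is the standard basis. A function $u:\mathbb{T}^d\to\mathbb{R}$ is semiconcave with constant $C_{conc}>0$ if for all $x_1,x_2\in\mathbb{T}^d$ and $\lambda\in(0,1)$: $u(\lambda x_1+(1-\lambda)x_2)\ge\lambda u(x_1)+(1-\lambda)u(x_2)-\lambda(1-\lambda)C_{conc}|x_1-x_2|^2$. Discretization parameters: a uniform space step $h>0$ and a time step $\Delta t>0$ with $N\Delta t=T$, $N$ a positive integer; $\varepsilon=(h,\Delta t)$ and $|\varepsilon|=h+\Delta t$. Difference operators: $\delta_h^{(i)}v(x)=\frac{v(x+he_i)-v(x)}{h}$, $\delta_{-h}^{(i)}v(x)=\frac{v(x)-v(x-he_i)}{h}$, $\delta_{\pm h}v=(\delta_{\pm h}^{(1)}v,\dots,\delta_{\pm h}^{(d)}v)$. Monotonicity condition with constant $R>0$: $\varepsilon=(h,\Delta t)$ is such that the update operator $$G\big(v(x),\{v(x\pm he_i)\}_{i=1}^d\big):=v(x)-\Delta t\,F\big(-\delta_hv(x),\delta_{-h}v(x)\big)$$ is a nondecreasing function of each of the grid values involved (the central value $v(x)$ and the neighboring values $v(x\pm he_i)$), provided that the absolute value of the discrete slopes $-\delta_hv(x)$ and $\delta_{-h}v(x)$ is bounded by $R$. Semi-discrete finite difference scheme: $u^\varepsilon_0(x)=g(x)$ and $u^\varepsilon_{n+1}(x)-u^\varepsilon_n(x)+\Delta t\,F(-\delta_hu^\varepsilon_n(x),\delta_{-h}u^\varepsilon_n(x))=0$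 for $x\in\mathbb{T}^d$, $n=0,\dots,N-1$.
   Formalization: The formal theorem also assumes that all discrete slopes of g with step h are bounded by R (automatic if R ≥ Lip(g)); with R unrelated to g the claim is false, e.g. d=1, R=1, F(a,b)=max(a-1,0)³+max(b-1,0)³, g=-3|x| near 0, N=2, h→0. *)

theory Defs
  imports "HOL-Analysis.Analysis"
begin

text \<open>
  The torus of dimension d = CARD('n) is represented by \<^typ>\<open>real ^ 'n\<close>: a function on the torus
  is a function on the whole space that is 1-periodic in every coordinate, and Lipschitz
  continuity, semiconcavity and viscosity inequalities are those of the periodic lift.
\<close>

definition torus_periodic :: "(real ^ 'n \<Rightarrow> 'b) \<Rightarrow> bool" where
  "torus_periodic v \<longleftrightarrow> (\<forall>x i. v (x + axis i 1) = v x)"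

definition torus_L1_norm :: "(real ^ 'n \<Rightarrow> real) \<Rightarrow> real" where
  "torus_L1_norm v = (LINT x:cbox 0 1|lborel. \<bar>v x\<bar>)"

definition semiconcave :: "real \<Rightarrow> (real ^ 'n \<Rightarrow> real) \<Rightarrow> bool" where
  "semiconcave C v \<longleftrightarrow> C > 0 \<and>
     (\<forall>x y. \<forall>l\<in>{0<..<1}.
        v (l *\<^sub>R x + (1 - l) *\<^sub>R y)
          \<ge> l * v x + (1 - l) * v y - l * (1 - l) * C * (norm (x - y))\<^sup>2)"

definition C2 :: "('a::euclidean_space \<Rightarrow> real) \<Rightarrow> bool" where
  "C2 f \<longleftrightarrow> (\<exists>(f' :: 'a \<Rightarrow> 'a \<Rightarrow>\<^sub>L real) (f'' :: 'a \<Rightarrow> 'a \<Rightarrow>\<^sub>L ('a \<Rightarrow>\<^sub>L real)).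
     (\<forall>x. (f has_derivative blinfun_apply (f' x)) (at x)) \<and>
     (\<forall>x. (f' has_derivative blinfun_apply (f'' x)) (at x)) \<and>
     continuous_on UNIV f'')"

text \<open>
  Viscosity solutions of \<open>u\<^sub>t + H(Du) = 0\<close>, with continuously differentiable test functions.
  A pair \<open>(x, t)\<close> is a point of space-time, and \<open>D (x, t)\<close> is the space-time gradient of the
  test function, so its first component is the spatial gradient and its second the time
  derivative.  Being touched from above or below is a local property, so the test functions
  need not be periodic.
\<close>

definition test_function ::
    "real \<Rightarrow> ((real ^ 'n) \<times> real \<Rightarrow> real) \<Rightarrow> ((real ^ 'n) \<times> real \<Rightarrow> (real ^ 'n) \<times> real) \<Rightarrow> bool" where
  "test_function T \<phi> D \<longleftrightarrow>
     (\<forall>z \<in> UNIV \<times> {0<..<T}. GDERIV \<phi> z :> D z) \<and> continuous_on (UNIV \<times> {0<..<T}) D"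

definition viscosity_subsolution ::
    "(real ^ 'n \<Rightarrow> real) \<Rightarrow> real \<Rightarrow> ((real ^ 'n) \<times> real \<Rightarrow> real) \<Rightarrow> bool" where
  "viscosity_subsolution H T u \<longleftrightarrow>
     (\<forall>\<phi> D. test_function T \<phi> D \<longrightarrow>
        (\<forall>z \<in> UNIV \<times> {0<..<T}.
           (\<forall>\<^sub>F w in nhds z. u w - \<phi> w \<le> u z - \<phi> z) \<longrightarrow> snd (D z) + H (fst (D z)) \<le> 0))"

definition viscosity_supersolution ::
    "(real ^ 'n \<Rightarrow> real) \<Rightarrow> real \<Rightarrow> ((real ^ 'n) \<times> real \<Rightarrow> real) \<Rightarrow> bool" where
  "viscosity_supersolution H T u \<longleftrightarrow>
     (\<forall>\<phi> D. test_function T \<phi> D \<longrightarrow>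
        (\<forall>z \<in> UNIV \<times> {0<..<T}.
           (\<forall>\<^sub>F w in nhds z. u w - \<phi> w \<ge> u z - \<phi> z) \<longrightarrow> snd (D z) + H (fst (D z)) \<ge> 0))"

text \<open>
  The solution is required to be continuous up to the terminal time, since the value at
  \<open>t = T\<close> is not determined by the equation on the open interval alone.
\<close>

definition viscosity_solution ::
    "(real ^ 'n \<Rightarrow> real) \<Rightarrow> (real ^ 'n \<Rightarrow> real) \<Rightarrow> real \<Rightarrow> ((real ^ 'n) \<times> real \<Rightarrow> real) \<Rightarrow> bool" where
  "viscosity_solution H g T u \<longleftrightarrow>
     continuous_on (UNIV \<times> {0..T}) u \<and>
     (\<forall>t\<in>{0..T}. torus_periodic (\<lambda>x. u (x, t))) \<and>
     (\<forall>x. u (x, 0) = g x) \<and>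
     viscosity_subsolution H T u \<and> viscosity_supersolution H T u"

text \<open>
  Discrete slopes in terms of the grid values: \<open>c\<close> is the central value \<open>v(x)\<close>, and
  \<open>a $ i\<close>, \<open>b $ i\<close> are the neighbouring values \<open>v(x + h e\<^sub>i)\<close>, \<open>v(x - h e\<^sub>i)\<close>.
\<close>

definition fwd_slope :: "real \<Rightarrow> real \<Rightarrow> real ^ 'n \<Rightarrow> real ^ 'n" where
  "fwd_slope h c a = (\<chi> i. (a $ i - c) / h)"

definition bwd_slope :: "real \<Rightarrow> real \<Rightarrow> real ^ 'n \<Rightarrow> real ^ 'n" where
  "bwd_slope h c b = (\<chi> i. (c - b $ i) / h)"

definition fwd_diff :: "real \<Rightarrow> (real ^ 'n \<Rightarrow> real) \<Rightarrow> real ^ 'n \<Rightarrow> real ^ 'n" where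
  "fwd_diff h v x = fwd_slope h (v x) (\<chi> i. v (x + h *\<^sub>R axis i 1))"

definition bwd_diff :: "real \<Rightarrow> (real ^ 'n \<Rightarrow> real) \<Rightarrow> real ^ 'n \<Rightarrow> real ^ 'n" where
  "bwd_diff h v x = bwd_slope h (v x) (\<chi> i. v (x - h *\<^sub>R axis i 1))"

definition update_op ::
    "((real ^ 'n) \<times> (real ^ 'n) \<Rightarrow> real) \<Rightarrow> real \<Rightarrow> real \<Rightarrow> real \<Rightarrow> real ^ 'n \<Rightarrow> real ^ 'n \<Rightarrow> real" where
  "update_op F h dt c a b = c - dt * F (- fwd_slope h c a, bwd_slope h c b)"

definition slopes_bounded :: "real \<Rightarrow> real \<Rightarrow> real \<Rightarrow> real ^ 'n \<Rightarrow> real ^ 'n \<Rightarrow> bool" where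
  "slopes_bounded R h c a b \<longleftrightarrow> (\<forall>i. \<bar>fwd_slope h c a $ i\<bar> \<le> R \<and> \<bar>bwd_slope h c b $ i\<bar> \<le> R)"

text \<open>
  The update operator is nondecreasing in each grid value separately, the others being fixed,
  on the set of values for which all \<open>2d\<close> scalar slopes are at most \<open>R\<close> in absolute value.
\<close>

definition monotonicity_condition ::
    "((real ^ 'n) \<times> (real ^ 'n) \<Rightarrow> real) \<Rightarrow> real \<Rightarrow> real \<Rightarrow> real \<Rightarrow> bool" where
  "monotonicity_condition F R h dt \<longleftrightarrow>
     (\<forall>a b. mono_on {s. slopes_bounded R h s a b} (\<lambda>s. update_op F h dt s a b)) \<and>
     (\<forall>c a b i. mono_on {s. slopes_bounded R h c (\<chi> j. if j = i then s else a $ j) b}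
                        (\<lambda>s. update_op F h dt c (\<chi> j. if j = i then s else a $ j) b)) \<and>
     (\<forall>c a b i. mono_on {s. slopes_bounded R h c a (\<chi> j. if j = i then s else b $ j)}
                        (\<lambda>s. update_op F h dt c a (\<chi> j. if j = i then s else b $ j)))"

text \<open>
  All discrete slopes of \<open>v\<close> with step \<open>h\<close> lie in the range on which the monotonicity condition
  with constant \<open>R\<close> gives information; every step \<open>h\<close> qualifies if \<open>R\<close> is a Lipschitz constant
  of \<open>v\<close>.
\<close>

definition discrete_slopes_bounded :: "real \<Rightarrow> real \<Rightarrow> (real ^ 'n \<Rightarrow> real) \<Rightarrow> bool" where
  "discrete_slopes_bounded R h v \<longleftrightarrow>
     (\<forall>x i. \<bar>fwd_diff h v x $ i\<bar> \<le> R \<and> \<bar>bwd_diff h v x $ i\<bar> \<le> R)"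

primrec scheme ::
    "((real ^ 'n) \<times> (real ^ 'n) \<Rightarrow> real) \<Rightarrow> (real ^ 'n \<Rightarrow> real) \<Rightarrow> real \<Rightarrow> real \<Rightarrow> nat \<Rightarrow> real ^ 'n \<Rightarrow> real" where
  "scheme F g h dt 0 = g"
| "scheme F g h dt (Suc n) =
     (\<lambda>x. scheme F g h dt n x
           - dt * F (- fwd_diff h (scheme F g h dt n) x, bwd_diff h (scheme F g h dt n) x))"

end

theory Submission
  imports Defs
begin

text \<open>
  Write \<open>v\<^sub>n\<close> for the scheme, \<open>u\<^sub>n\<close> for the viscosity solution at time \<open>n dt\<close>, and \<open>K\<close> for the
  semiconcavity constant of \<open>g\<close>.  The estimate combines a uniform bound on one side,
  \<open>v\<^sub>n - u\<^sub>n \<le> C h\<close>, with a bound on the mass of the other side,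
  \<open>\<integral> (u\<^sub>n - v\<^sub>n) \<le> C (h + dt)\<close>.  These control the \<open>L\<^sup>1\<close> norm, because
  \<open>\<bar>v\<^sub>n - u\<^sub>n\<bar> \<le> (u\<^sub>n - v\<^sub>n) + 2 C h\<close>.

  The solution enters only through a Hopf-Lax formula (\<open>viscosity_eq_hopf_lax\<close>): \<open>u (x, t)\<close> is the
  infimum of \<open>g (x - t q) + t l\<close> over a convex set of pairs \<open>(q, l)\<close> of a velocity and a running
  cost with \<open>p \<bullet> q \<le> H p + l\<close> for all \<open>p\<close>.  Both inequalities come from comparison with a
  continuously differentiable function.  From above, each pair gives an explicit classical
  supersolution, a smoothed cone that moves with velocity \<open>q\<close>.  From below, the infimum \<open>E\<close> satisfies
  the linear inequalities \<open>E (x, t + s) \<le> E (x - s q, t) + s l\<close>; convolution in space-time preserves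
  them, so the mollified \<open>E\<close> is a classical subsolution.  As pairs one takes those that arise
  from affine functions below the numerical Hamiltonian \<open>F\<close> with nonnegative coefficients of sum at
  most \<open>h / dt\<close> (\<open>controls\<close>).  Such an affine function also bounds one step of the scheme by an
  average over the stencil with mean \<open>x - dt q\<close>, plus \<open>dt l\<close>, and semiconcavity, in the form of Jensen's
  inequality, bounds that average by the value at the mean up to \<open>O(h dt)\<close>
  (\<open>scheme_step_le_control\<close>).  Summing over the steps gives \<open>v\<^sub>n - u\<^sub>n \<le> C h\<close>.

  The argument needs the semiconcavity of every \<open>v\<^sub>n\<close>.  The monotonicity condition says that the
  partial derivatives of \<open>F\<close> are nonnegative with sum at most \<open>h / dt\<close> on the admissible slopes.  So
  a step of the scheme is monotone, and it is concave and commutes with translations and with the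
  addition of constants; hence it preserves Lipschitz bounds and semiconcavity.

  For the mass, let \<open>V\<close> and \<open>U\<close> be mollifications of \<open>v\<^sub>n\<close> and \<open>u\<^sub>n\<close>, and choose at each \<open>x\<close> the pair
  \<open>(q, l)\<close> that is optimal for the slope \<open>DV x\<close>, so that \<open>q = DH (DV x)\<close>.  The Hopf-Lax inequality over one step
  gives \<open>\<integral> (u\<^sub>n\<^sub>+\<^sub>1 - v\<^sub>n\<^sub>+\<^sub>1) \<le> \<integral> (u\<^sub>n - v\<^sub>n) + dt \<integral> (U - V) div (DH (DV)) + O(dt (h + dt))\<close>
  (\<open>mass_increment\<close>).  Here \<open>div (DH (DV)) = tr (D\<^sup>2H D\<^sup>2V) \<le> 2 K tr (D\<^sup>2H)\<close>, as \<open>D\<^sup>2H\<close> is nonnegative and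
  \<open>D\<^sup>2V \<le> 2 K\<close>, and \<open>U - V\<close> is nonnegative up to \<open>O(h)\<close>; a discrete Gronwall inequality concludes.
  The mollification is essential: the discrete divergence of the linearised scheme itself has no
  such upper bound in dimension two or more, because its mixed second differences do
  not combine into a trace that semiconcavity bounds.  Replacing difference quotients by derivatives costs only \<open>O(h)\<close> in the mean: by
  semiconcavity the error is bounded on one side by \<open>K h\<close> pointwise, and its integral over the torus
  vanishes (\<open>numerical_flux_consistency\<close>).

  All this requires \<open>R\<close> to bound the slopes of \<open>g\<close> along the axes at every scale.  If it does not,
  then the slope bound for \<open>g\<close> at scale \<open>h\<close> forces \<open>h\<close> to stay away from \<open>0\<close>, and the crude bound
  \<open>\<bar>v\<^sub>n - u\<^sub>n\<bar> \<le> C\<close> is enough.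
\<close>

section \<open>Comparison with continuously differentiable functions\<close>

text \<open>
  If \<open>u > W\<close> somewhere, then \<open>(T - t) (u - W)\<close> has a positive maximum \<open>m\<close>, neither at \<open>t = 0\<close> nor at
  \<open>t = T\<close>.  Hence \<open>W + m / (T - t)\<close> touches \<open>u\<close> from above, and the second term makes it a strict
  supersolution.  The set \<open>B\<close> provides compactness, for periodic as well as for coercive \<open>W\<close>.
\<close>

lemma subsolution_le_C1_supersolution:
  fixes H :: "real ^ 'n \<Rightarrow> real"
  assumes sub: "viscosity_subsolution H T u"
    and u: "continuous_on (UNIV \<times> {0..T}) u" and W: "continuous_on (UNIV \<times> {0..T}) W"
    and tf: "test_function T W D"
    and super: "\<And>z. z \<in> UNIV \<times> {0<..<T} \<Longrightarrow> snd (D z) + H (fst (D z)) \<ge> 0"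
    and init: "\<And>x. u (x, 0) \<le> W (x, 0)"
    and B: "compact B" "\<And>x t. t \<in> {0..T} \<Longrightarrow> \<exists>y\<in>B. u (x, t) - W (x, t) \<le> u (y, t) - W (y, t)"
    and t: "t \<in> {0..T}"
  shows "u (x, t) \<le> W (x, t)"
proof -
  have before: "u (x, t) \<le> W (x, t)" if t: "t \<in> {0..<T}" for x t
  proof (rule ccontr)
    assume neg: "\<not> u (x, t) \<le> W (x, t)"
    define f where "f z = (T - snd z) * (u z - W z)" for z
    have contf: "continuous_on (UNIV \<times> {0..T}) f"
      unfolding f_def by (intro continuous_intros u W)
    obtain y0 where y0: "y0 \<in> B" "u (x, t) - W (x, t) \<le> u (y0, t) - W (y0, t)"
      using B(2)[of t x] t by auto
    have "compact (B \<times> {0..T})" using B(1) by (intro compact_Times) auto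
    moreover have "B \<times> {0..T} \<noteq> {}" using y0(1) t by auto
    moreover have "continuous_on (B \<times> {0..T}) f"
      using contf by (rule continuous_on_subset) auto
    ultimately obtain zm where zm: "zm \<in> B \<times> {0..T}" "\<And>z. z \<in> B \<times> {0..T} \<Longrightarrow> f z \<le> f zm"
      using continuous_attains_sup by metis
    define m where "m = f zm"
    have le_m: "f (y, s) \<le> m" if s: "s \<in> {0..T}" for y s
    proof -
      obtain y' where y': "y' \<in> B" "u (y, s) - W (y, s) \<le> u (y', s) - W (y', s)"
        using B(2)[OF s] by blast
      have "f (y, s) \<le> f (y', s)" unfolding f_def using s y'(2) by (auto intro!: mult_left_mono)
      also have "\<dots> \<le> m" unfolding m_def using y'(1) s by (intro zm(2)) auto
      finally show ?thesis .
    qed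
    have "0 < f (x, t)" unfolding f_def using neg t by auto
    then have m: "m > 0" using le_m[of t x] t by auto
    obtain xm tm where zm_eq: "zm = (xm, tm)" by (cases zm)
    have tm: "tm \<in> {0<..<T}"
    proof -
      have "tm \<noteq> 0" using m init[of xm] t unfolding m_def zm_eq f_def
        by (auto simp: zero_less_mult_iff)
      moreover have "tm \<noteq> T" using m unfolding m_def zm_eq f_def by auto
      ultimately show ?thesis using zm(1) zm_eq by auto
    qed
    define \<phi> where "\<phi> z = W z + m / (T - snd z)" for z
    define D' where "D' z = (fst (D z), snd (D z) + m / (T - snd z)^2)" for z
    have D': "GDERIV \<phi> z :> D' z" if z: "z \<in> UNIV \<times> {0<..<T}" for z
    proof -
      have 1: "(W has_derivative (\<lambda>k. k \<bullet> D z)) (at z)"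
        using tf z unfolding test_function_def gderiv_def by auto
      have 2: "T - snd z \<noteq> 0" using z by auto
      show ?thesis unfolding gderiv_def \<phi>_def
        by (rule derivative_eq_intros 1 2 refl)+
           (use 2 in \<open>auto simp: D'_def fun_eq_iff inner_prod_def field_simps power2_eq_square\<close>)
    qed
    have "continuous_on (UNIV \<times> {0<..<T}) D'"
    proof -
      have "continuous_on (UNIV \<times> {0<..<T}) D" using tf unfolding test_function_def by auto
      then show ?thesis unfolding D'_def by (intro continuous_intros) auto
    qed
    then have "test_function T \<phi> D'" unfolding test_function_def using D' by auto
    moreover have "\<forall>\<^sub>F w in nhds zm. u w - \<phi> w \<le> u zm - \<phi> zm"
    proof -
      have le: "u w - \<phi> w \<le> 0" if "w \<in> UNIV \<times> {0<..<T}" for w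
        using le_m[of "snd w" "fst w"] that
        unfolding \<phi>_def f_def by (auto simp: field_simps)
      have "u zm - \<phi> zm = 0"
        using tm unfolding \<phi>_def m_def f_def zm_eq by (auto simp: field_simps)
      moreover have "open (UNIV \<times> {0<..<T} :: ((real^'n) \<times> real) set)" by (intro open_Times) auto
      ultimately show ?thesis unfolding eventually_nhds using le tm zm_eq by auto
    qed
    ultimately have "snd (D' zm) + H (fst (D' zm)) \<le> 0"
      using sub tm zm_eq unfolding viscosity_subsolution_def by auto
    moreover have "snd (D zm) + H (fst (D zm)) \<ge> 0" using super tm zm_eq by auto
    moreover have "m / (T - tm)^2 > 0" using m tm by auto
    ultimately show False unfolding D'_def zm_eq by auto
  qed
  show ?thesis
  proof (cases "t < T")
    case True then show ?thesis using before t by auto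
  next
    case False
    then have tT: "t = T" using t by auto
    show ?thesis
    proof (cases "T = 0")
      case True then show ?thesis using init tT by auto
    next
      case False
      then have T: "T > 0" using t by auto
      have cont: "continuous_on {0..T} (\<lambda>s. u (x, s) - W (x, s))"
        by (intro continuous_intros continuous_on_compose2[OF u] continuous_on_compose2[OF W]) auto
      have cl: "closure {0..<T} = {0..T}" using T by auto
      have "u (x, s) - W (x, s) \<le> 0" if "s \<in> closure {0..<T}" for s
        by (rule continuous_le_on_closure[OF _ that]) (use cont cl before in auto)
      then show ?thesis using cl tT T by force
    qed
  qed
qed

text \<open>
  Reduces comparison from below to comparison from above.
\<close>

lemma supersolution_neg:
  assumes "viscosity_supersolution H T u"
  shows "viscosity_subsolution (\<lambda>p. - H (- p)) T (\<lambda>z. - u z)"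
  unfolding viscosity_subsolution_def
proof (intro allI impI ballI)
  fix \<phi> :: "(real^'a) \<times> real \<Rightarrow> real" and D z
  assume tf: "test_function T \<phi> D" and z: "z \<in> UNIV \<times> {0<..<T}"
    and max: "\<forall>\<^sub>F w in nhds z. - u w - \<phi> w \<le> - u z - \<phi> z"
  have "test_function T (\<lambda>z. - \<phi> z) (\<lambda>z. - D z)"
    using tf unfolding test_function_def gderiv_def
    by (auto intro!: derivative_eq_intros continuous_intros)
  moreover have "\<forall>\<^sub>F w in nhds z. u w - (- \<phi> w) \<ge> u z - (- \<phi> z)"
    using max by (auto elim!: eventually_mono)
  ultimately have "snd (- D z) + H (fst (- D z)) \<ge> 0"
    using assms z unfolding viscosity_supersolution_def by blast
  then show "snd (D z) + - H (- fst (D z)) \<le> 0" by simp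
qed

section \<open>Mollification\<close>

text \<open>
  The correlation of \<open>f\<close> with a kernel supported in the cube of half-width \<open>r\<close>.  Integration over a fixed
  compact cube makes Leibniz's rule applicable.
\<close>

definition correlation :: "real \<Rightarrow> ('a::euclidean_space \<Rightarrow> real) \<Rightarrow> ('a \<Rightarrow> real) \<Rightarrow> 'a \<Rightarrow> real" where
  "correlation r \<kappa> f x = integral (cbox (- r *\<^sub>R One) (r *\<^sub>R One)) (\<lambda>w. \<kappa> w * f (x + w))"

lemma continuous_correlation:
  assumes "continuous_on UNIV \<kappa>" "continuous_on UNIV f"
  shows "continuous_on UNIV (correlation r \<kappa> f)"
proof -
  have "continuous_on (UNIV \<times> cbox (- r *\<^sub>R One) (r *\<^sub>R One)) (\<lambda>(x, w). \<kappa> w * f (x + w))"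
    unfolding case_prod_unfold
    by (intro continuous_intros continuous_on_compose2[OF assms(1)] continuous_on_compose2[OF assms(2)]) auto
  then show ?thesis unfolding correlation_def[abs_def] by (rule integral_continuous_on_param)
qed

text \<open>
  Substituting \<open>y = x + w\<close> moves the variable \<open>x\<close> from \<open>f\<close> into the kernel; a larger cube serves all
  \<open>x\<close> near \<open>x0\<close> at once, because the kernel vanishes outside its own.
\<close>

lemma correlation_shifted_box:
  assumes supp: "\<And>w. w \<notin> cbox (- r *\<^sub>R One) (r *\<^sub>R One) \<Longrightarrow> \<kappa> w = 0"
    and x: "x \<in> ball x0 1"
  shows "correlation r \<kappa> f x = integral (cbox (x0 - (r + 1) *\<^sub>R One) (x0 + (r + 1) *\<^sub>R One)) (\<lambda>y. \<kappa> (y - x) * f y)"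
proof -
  have sub: "y \<in> cbox (x0 - (r + 1) *\<^sub>R One) (x0 + (r + 1) *\<^sub>R One)"
    if "y - x \<in> cbox (- r *\<^sub>R One) (r *\<^sub>R One)" for y
  proof -
    have "\<bar>(x - x0) \<bullet> i\<bar> \<le> 1" if "i \<in> Basis" for i
      using Basis_le_norm[OF that, of "x - x0"] x by (simp add: dist_norm norm_minus_commute)
    then show ?thesis using that by (force simp: mem_box inner_simps)
  qed
  have "correlation r \<kappa> f x
      = integral (cbox (- r *\<^sub>R One) (r *\<^sub>R One)) ((\<lambda>y. \<kappa> (y - x) * f y) \<circ> ((+) x))"
    unfolding correlation_def o_def by simp
  also have "\<dots> = integral (cbox (- r *\<^sub>R One + x) (r *\<^sub>R One + x)) (\<lambda>y. \<kappa> (y - x) * f y)"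
    by (rule integral_shift_cbox_plus)
  also have "\<dots> = integral (cbox (x0 - (r + 1) *\<^sub>R One) (x0 + (r + 1) *\<^sub>R One)) (\<lambda>y. \<kappa> (y - x) * f y)"
  proof (rule integral_spike_set)
    have "cbox (- r *\<^sub>R One + x) (r *\<^sub>R One + x) \<subseteq> cbox (x0 - (r + 1) *\<^sub>R One) (x0 + (r + 1) *\<^sub>R One)"
    proof
      fix y assume "y \<in> cbox (- r *\<^sub>R One + x) (r *\<^sub>R One + x)"
      then have "y - x \<in> cbox (- r *\<^sub>R One) (r *\<^sub>R One)"
        by (auto simp: mem_box inner_simps algebra_simps)
      then show "y \<in> cbox (x0 - (r + 1) *\<^sub>R One) (x0 + (r + 1) *\<^sub>R One)" by (rule sub)
    qed
    then have "{y \<in> cbox (- r *\<^sub>R One + x) (r *\<^sub>R One + x) - cbox (x0 - (r + 1) *\<^sub>R One) (x0 + (r + 1) *\<^sub>R One).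
         \<kappa> (y - x) * f y \<noteq> 0} = {}" by auto
    then show "negligible {y \<in> cbox (- r *\<^sub>R One + x) (r *\<^sub>R One + x) - cbox (x0 - (r + 1) *\<^sub>R One) (x0 + (r + 1) *\<^sub>R One).
         \<kappa> (y - x) * f y \<noteq> 0}" by (metis negligible_empty)
    have "{y \<in> cbox (x0 - (r + 1) *\<^sub>R One) (x0 + (r + 1) *\<^sub>R One) - cbox (- r *\<^sub>R One + x) (r *\<^sub>R One + x).
         \<kappa> (y - x) * f y \<noteq> 0} = {}"
    proof -
      have "\<kappa> (y - x) = 0" if "y \<notin> cbox (- r *\<^sub>R One + x) (r *\<^sub>R One + x)" for y
      proof (rule supp)
        show "y - x \<notin> cbox (- r *\<^sub>R One) (r *\<^sub>R One)"
          using that by (auto simp: mem_box inner_simps algebra_simps)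
      qed
      then show ?thesis by auto
    qed
    then show "negligible {y \<in> cbox (x0 - (r + 1) *\<^sub>R One) (x0 + (r + 1) *\<^sub>R One) - cbox (- r *\<^sub>R One + x) (r *\<^sub>R One + x).
         \<kappa> (y - x) * f y \<noteq> 0}" by (metis negligible_empty)
  qed
  finally show ?thesis .
qed

text \<open>
  After the substitution the derivative falls on the kernel, so it exists for every continuous \<open>f\<close>.
\<close>

lemma correlation_has_derivative:
  fixes \<kappa> f :: "'a::euclidean_space \<Rightarrow> real"
  assumes \<kappa>: "\<And>w. (\<kappa> has_derivative (\<lambda>k. k \<bullet> G w)) (at w)" and G: "continuous_on UNIV G"
    and supp: "\<And>w. w \<notin> cbox (- r *\<^sub>R One) (r *\<^sub>R One) \<Longrightarrow> \<kappa> w = 0"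
    and supp': "\<And>w. w \<notin> cbox (- r *\<^sub>R One) (r *\<^sub>R One) \<Longrightarrow> G w = 0"
    and f: "continuous_on UNIV f"
  shows "(correlation r \<kappa> f has_derivative (\<lambda>k. correlation r (\<lambda>w. - (k \<bullet> G w)) f x0)) (at x0)"
proof -
  define a where "a = x0 - (r + 1) *\<^sub>R One"
  define b where "b = x0 + (r + 1) *\<^sub>R One"
  define fx where "fx x y = (- f y) *\<^sub>R blinfun_inner_left (G (y - x))" for x y
  have cont\<kappa>: "continuous_on UNIV \<kappa>"
    by (rule has_derivative_continuous_on[OF has_derivative_at_withinI[OF \<kappa>]])
  have "((\<lambda>x. integral (cbox a b) (\<lambda>y. \<kappa> (y - x) * f y)) has_derivative integral (cbox a b) (fx x0)) (at x0 within ball x0 1)"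
  proof (rule leibniz_rule)
    show "((\<lambda>x. \<kappa> (y - x) * f y) has_derivative blinfun_apply (fx x y)) (at x within ball x0 1)" for x y
    proof -
      have "((\<lambda>x. \<kappa> (y - x)) has_derivative (\<lambda>k. (- k) \<bullet> G (y - x))) (at x within ball x0 1)"
        by (rule has_derivative_compose[of "\<lambda>x. y - x" "\<lambda>k. - k" _ _ \<kappa>, OF _ \<kappa>])
           (auto intro!: derivative_eq_intros)
      then have "((\<lambda>x. \<kappa> (y - x) * f y) has_derivative (\<lambda>k. (- k) \<bullet> G (y - x) * f y)) (at x within ball x0 1)"
        by (rule has_derivative_mult_left)
      moreover have "blinfun_apply (fx x y) = (\<lambda>k. (- k) \<bullet> G (y - x) * f y)"
        unfolding fx_def fun_eq_iff by (simp add: blinfun.scaleR_left blinfun.minus_left)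
      ultimately show ?thesis by (simp only:)
    qed
    show "(\<lambda>y. \<kappa> (y - x) * f y) integrable_on cbox a b" for x
      by (intro integrable_continuous continuous_intros continuous_on_compose2[OF cont\<kappa>] continuous_on_subset[OF f]) auto
    show "continuous_on (ball x0 1 \<times> cbox a b) (\<lambda>(x, y). fx x y)"
      unfolding fx_def case_prod_unfold
      by (intro continuous_intros continuous_on_compose2[OF f] continuous_on_compose2[OF G]
          bounded_linear.continuous_on[OF bounded_linear_blinfun_inner_left]) auto
  qed auto
  then have D: "((\<lambda>x. integral (cbox a b) (\<lambda>y. \<kappa> (y - x) * f y)) has_derivative integral (cbox a b) (fx x0)) (at x0)"
    using at_within_open[of x0 "ball x0 1"] by simp
  have "(correlation r \<kappa> f has_derivative integral (cbox a b) (fx x0)) (at x0)"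
  proof (rule has_derivative_transform_within_open[OF D])
    show "open (ball x0 1)" "x0 \<in> ball x0 1" by auto
    show "integral (cbox a b) (\<lambda>y. \<kappa> (y - x) * f y) = correlation r \<kappa> f x" if "x \<in> ball x0 1" for x
      unfolding a_def b_def using correlation_shifted_box[OF supp that] by (rule sym)
  qed
  moreover have "blinfun_apply (integral (cbox a b) (fx x0)) k = correlation r (\<lambda>w. - (k \<bullet> G w)) f x0" for k
  proof -
    have "continuous_on (cbox a b) (fx x0)" unfolding fx_def
      by (intro continuous_intros continuous_on_compose2[OF f] continuous_on_compose2[OF G]
          bounded_linear.continuous_on[OF bounded_linear_blinfun_inner_left]) auto
    then have "fx x0 integrable_on cbox a b" by (rule integrable_continuous)
    from integral_linear[OF this, of "\<lambda>B. blinfun_apply B k"]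
    have "blinfun_apply (integral (cbox a b) (fx x0)) k = integral (cbox a b) (\<lambda>y. blinfun_apply (fx x0 y) k)"
      using blinfun.bounded_linear_left by (auto simp: o_def)
    also have "\<dots> = integral (cbox a b) (\<lambda>y. - (k \<bullet> G (y - x0)) * f y)"
      by (intro integral_cong) (simp add: fx_def blinfun.scaleR_left blinfun.minus_left)
    also have "\<dots> = correlation r (\<lambda>w. - (k \<bullet> G w)) f x0"
      unfolding a_def b_def by (rule correlation_shifted_box[symmetric]) (simp_all add: supp')
    finally show ?thesis .
  qed
  then have "blinfun_apply (integral (cbox a b) (fx x0)) = (\<lambda>k. correlation r (\<lambda>w. - (k \<bullet> G w)) f x0)"
    by blast
  ultimately show ?thesis by (simp only:)
qed

text \<open>
  The cube of this function is a \<open>C\<^sup>2\<close> kernel, supported in the ball of radius \<open>r\<close>.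
\<close>

definition cap :: "real \<Rightarrow> 'a::euclidean_space \<Rightarrow> real" where
  "cap r w = max 0 (r^2 - w \<bullet> w)"

definition bump_mass :: "'a::euclidean_space itself \<Rightarrow> real \<Rightarrow> real" where
  "bump_mass _ r = integral (cbox (- r *\<^sub>R One) (r *\<^sub>R One)) (\<lambda>w::'a. cap r w ^ 3)"

lemma cap_nonneg: "cap r w \<ge> 0" by (simp add: cap_def)

lemma cap_eq_0:
  assumes "r > 0" "norm w \<ge> r"
  shows "cap r w = 0"
proof -
  have "r^2 \<le> (norm w)^2" using assms by (intro power_mono) auto
  then show ?thesis by (simp add: cap_def power2_norm_eq_inner)
qed

lemma cap_outside_box:
  assumes "r > 0" "w \<notin> cbox (- r *\<^sub>R One) (r *\<^sub>R One)"
  shows "cap r w = 0"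
proof (rule cap_eq_0)
  obtain i where i: "i \<in> Basis" "\<bar>w \<bullet> i\<bar> > r" using assms(2) by (force simp: mem_box)
  show "norm w \<ge> r" using Basis_le_norm[OF i(1), of w] i(2) by simp
qed fact

lemma continuous_cap: "continuous_on S (cap r)"
  unfolding cap_def[abs_def] by (intro continuous_intros)

lemma positive_part_power_deriv:
  "((\<lambda>s::real. max 0 s ^ Suc (Suc n)) has_real_derivative real (Suc (Suc n)) * max 0 s ^ Suc n) (at s)"
proof -
  consider "s < 0" | "s = 0" | "s > 0" by linarith
  then show ?thesis
  proof cases
    case 1
    have "((\<lambda>s::real. 0) has_real_derivative 0) (at s)" by simp
    then show ?thesis
      by (rule has_field_derivative_transform_within_open[of _ _ _ "{..<0}", THEN DERIV_cong]) (use 1 in auto)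
  next
    case 3
    have "((\<lambda>s::real. s ^ Suc (Suc n)) has_real_derivative real (Suc (Suc n)) * s ^ Suc n) (at s)"
      using DERIV_pow[of "Suc (Suc n)" s] by simp
    then show ?thesis
      by (rule has_field_derivative_transform_within_open[of _ _ _ "{0<..}", THEN DERIV_cong]) (use 3 in auto)
  next
    case 2
    have "((\<lambda>h. max 0 h ^ Suc (Suc n) / h) \<longlongrightarrow> 0) (at (0::real))"
    proof (rule Lim_null_comparison)
      show "\<forall>\<^sub>F h in at (0::real). norm (max 0 h ^ Suc (Suc n) / h) \<le> max 0 h ^ Suc n"
        by (intro always_eventually) (auto simp: max_def)
      have "isCont (\<lambda>h. max 0 h ^ Suc n) (0::real)" by (intro continuous_intros)
      then show "((\<lambda>h. max 0 h ^ Suc n) \<longlongrightarrow> 0) (at (0::real))" by (simp add: isCont_def)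
    qed
    then show ?thesis unfolding 2 DERIV_def by simp
  qed
qed

lemma cap_power_deriv:
  "((\<lambda>w. cap r w ^ Suc (Suc n)) has_derivative
      (\<lambda>k. k \<bullet> ((- 2 * real (Suc (Suc n)) * cap r w ^ Suc n) *\<^sub>R w))) (at w)"
proof -
  have "((\<lambda>w. r^2 - w \<bullet> w) has_derivative (\<lambda>k. - 2 * (k \<bullet> w))) (at w)"
    by (auto intro!: derivative_eq_intros simp: inner_commute)
  from has_derivative_compose[OF this
      positive_part_power_deriv[of n "r^2 - w \<bullet> w", unfolded has_field_derivative_def]]
  show ?thesis unfolding cap_def
    by (rule has_derivative_eq_rhs) (simp add: fun_eq_iff algebra_simps)
qed

lemma cap_cubed_deriv:
  "((\<lambda>w. cap r w ^ 3) has_derivative (\<lambda>k. k \<bullet> ((- 6 * cap r w ^ 2) *\<^sub>R w))) (at w)"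
  using cap_power_deriv[of r 1 w] by (simp add: eval_nat_numeral)

lemma bump_gradient_deriv:
  "((\<lambda>w. - (v \<bullet> ((- 6 * cap r w ^ 2) *\<^sub>R w))) has_derivative
     (\<lambda>k. k \<bullet> ((6 * cap r w ^ 2) *\<^sub>R v - (24 * cap r w * (w \<bullet> v)) *\<^sub>R w))) (at w)"
proof -
  have "((\<lambda>w. cap r w ^ 2) has_derivative (\<lambda>k. k \<bullet> ((- 4 * cap r w) *\<^sub>R w))) (at w)"
    using cap_power_deriv[of r 0 w] by (simp add: eval_nat_numeral)
  then have "((\<lambda>w. 6 * cap r w ^ 2) has_derivative (\<lambda>k. 6 * (k \<bullet> ((- 4 * cap r w) *\<^sub>R w)))) (at w)"
    by (rule has_derivative_mult_right)
  moreover have "((\<lambda>w. v \<bullet> w) has_derivative (\<lambda>k. v \<bullet> k)) (at w)"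
    by (auto intro!: derivative_eq_intros)
  ultimately have "((\<lambda>w. (6 * cap r w ^ 2) * (v \<bullet> w)) has_derivative
     (\<lambda>k. 6 * cap r w ^ 2 * (v \<bullet> k) + 6 * (k \<bullet> ((- 4 * cap r w) *\<^sub>R w)) * (v \<bullet> w))) (at w)"
    by (rule has_derivative_mult)
  moreover have "6 * cap r w ^ 2 * (v \<bullet> k) + 6 * (k \<bullet> ((- 4 * cap r w) *\<^sub>R w)) * (v \<bullet> w)
      = k \<bullet> ((6 * cap r w ^ 2) *\<^sub>R v - (24 * cap r w * (w \<bullet> v)) *\<^sub>R w)" for k
    by (simp add: inner_diff_right inner_commute[of k v] inner_commute[of w v])
  moreover have "- (v \<bullet> ((- 6 * cap r w ^ 2) *\<^sub>R w)) = (6 * cap r w ^ 2) * (v \<bullet> w)" for w by simp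
  ultimately show ?thesis by (simp only:)
qed

lemma bump_mass_pos:
  assumes "r > 0"
  shows "bump_mass TYPE('a::euclidean_space) r > 0"
proof -
  let ?B = "cbox (- r *\<^sub>R One) (r *\<^sub>R One :: 'a)"
  have 0: "0 \<in> ?B" using assms by (auto simp: mem_box)
  have ne: "box (- r *\<^sub>R One) (r *\<^sub>R One :: 'a) \<noteq> {}" using assms by (auto simp: box_ne_empty)
  have cont: "continuous_on ?B (\<lambda>w. cap r w ^ 3)" by (intro continuous_intros continuous_cap)
  have "integral ?B (\<lambda>w. cap r w ^ 3) \<noteq> 0"
    using integral_cbox_eq_0_iff[OF cont ne] 0 assms by (auto simp: cap_nonneg cap_def)
  moreover have "integral ?B (\<lambda>w. cap r w ^ 3) \<ge> 0"
    by (intro integral_nonneg integrable_continuous cont) (auto simp: cap_nonneg)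
  ultimately show ?thesis unfolding bump_mass_def by simp
qed

definition mollify :: "real \<Rightarrow> ('a::euclidean_space \<Rightarrow> real) \<Rightarrow> 'a \<Rightarrow> real" where
  "mollify r f x = correlation r (\<lambda>w. cap r w ^ 3) f x / bump_mass TYPE('a) r"

text \<open>
  The kernels of the next two definitions are the first and second derivatives of the cubed cap, with
  the signs that come from differentiating in \<open>x\<close> rather than in the integration variable.
\<close>

definition mollify_deriv :: "real \<Rightarrow> ('a::euclidean_space \<Rightarrow> real) \<Rightarrow> 'a \<Rightarrow> 'a \<Rightarrow> real" where
  "mollify_deriv r f x v =
     correlation r (\<lambda>w. - (v \<bullet> ((- 6 * cap r w ^ 2) *\<^sub>R w))) f x / bump_mass TYPE('a) r"

definition mollify_hess :: "real \<Rightarrow> ('a::euclidean_space \<Rightarrow> real) \<Rightarrow> 'a \<Rightarrow> 'a \<Rightarrow> 'a \<Rightarrow> real" where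
  "mollify_hess r f x v k =
     correlation r (\<lambda>w. - (k \<bullet> ((6 * cap r w ^ 2) *\<^sub>R v - (24 * cap r w * (w \<bullet> v)) *\<^sub>R w))) f x / bump_mass TYPE('a) r"

lemma mollify_hess_sym: "mollify_hess r f x v k = mollify_hess r f x k v"
  unfolding mollify_hess_def by (simp add: inner_simps inner_commute mult_ac)

context
  fixes r :: real and f :: "'a::euclidean_space \<Rightarrow> real"
  assumes r: "r > 0" and f: "continuous_on UNIV f"
begin

lemma continuous_mollify: "continuous_on UNIV (mollify r f)"
  unfolding mollify_def[abs_def] divide_inverse
  by (intro continuous_intros continuous_correlation f continuous_cap)

lemma continuous_mollify_deriv: "continuous_on UNIV (\<lambda>x. mollify_deriv r f x v)"
  unfolding mollify_deriv_def[abs_def] divide_inverse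
  by (intro continuous_intros continuous_correlation f continuous_cap)

lemma continuous_mollify_hess: "continuous_on UNIV (\<lambda>x. mollify_hess r f x v k)"
  unfolding mollify_hess_def[abs_def] divide_inverse
  by (intro continuous_intros continuous_correlation f continuous_cap)

lemma mollify_has_derivative: "(mollify r f has_derivative mollify_deriv r f x) (at x)"
proof -
  have "(correlation r (\<lambda>w. cap r w ^ 3) f has_derivative
      (\<lambda>k. correlation r (\<lambda>w. - (k \<bullet> ((- 6 * cap r w ^ 2) *\<^sub>R w))) f x)) (at x)"
    by (rule correlation_has_derivative[OF cap_cubed_deriv _ _ _ f])
       (auto intro!: continuous_intros continuous_cap simp: cap_outside_box[OF r])
  then show ?thesis unfolding mollify_def[abs_def] mollify_deriv_def[abs_def] divide_inverse
    by (rule has_derivative_mult_left)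
qed

lemma mollify_deriv_has_derivative:
  "((\<lambda>x. mollify_deriv r f x v) has_derivative mollify_hess r f x v) (at x)"
proof -
  have "(correlation r (\<lambda>w. - (v \<bullet> ((- 6 * cap r w ^ 2) *\<^sub>R w))) f has_derivative
      (\<lambda>k. correlation r (\<lambda>w. - (k \<bullet> ((6 * cap r w ^ 2) *\<^sub>R v - (24 * cap r w * (w \<bullet> v)) *\<^sub>R w))) f x)) (at x)"
  proof (rule correlation_has_derivative[where \<kappa> = "\<lambda>w. - (v \<bullet> ((- 6 * cap r w ^ 2) *\<^sub>R w))"
      and G = "\<lambda>w. (6 * cap r w ^ 2) *\<^sub>R v - (24 * cap r w * (w \<bullet> v)) *\<^sub>R w", OF bump_gradient_deriv])
    show "continuous_on UNIV (\<lambda>w. (6 * cap r w ^ 2) *\<^sub>R v - (24 * cap r w * (w \<bullet> v)) *\<^sub>R w)"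
      by (intro continuous_intros continuous_cap)
  qed (simp_all add: cap_outside_box[OF r] f)
  then show ?thesis unfolding mollify_deriv_def[abs_def] mollify_hess_def[abs_def] divide_inverse
    by (rule has_derivative_mult_left)
qed

end

lemma mollify_translate: "mollify r f (x + y) = mollify r (\<lambda>w. f (w + y)) x"
  by (simp add: mollify_def correlation_def add_ac)

lemma mollify_const:
  assumes "r > 0"
  shows "mollify r (\<lambda>_. c) (x::'a::euclidean_space) = c"
  using bump_mass_pos[OF assms, where 'a='a] by (simp add: mollify_def correlation_def bump_mass_def)

lemma bump_times_integrable:
  fixes f :: "'a::euclidean_space \<Rightarrow> real"
  assumes "continuous_on UNIV f"
  shows "(\<lambda>w. cap r w ^ 3 * f (x + w)) integrable_on cbox (- r *\<^sub>R One) (r *\<^sub>R One)"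
  by (intro integrable_continuous continuous_intros continuous_cap continuous_on_compose2[OF assms]) auto

lemma mollify_add:
  assumes "continuous_on UNIV f" "continuous_on UNIV g"
  shows "mollify r (\<lambda>w. f w + g w) x = mollify r f x + mollify r g x"
  unfolding mollify_def correlation_def distrib_left
  by (subst integral_add) (use bump_times_integrable assms in \<open>auto simp: add_divide_distrib\<close>)

lemma mollify_cmult: "mollify r (\<lambda>w. c * f w) x = c * mollify r f x"
  unfolding mollify_def correlation_def by (simp add: mult.left_commute)

lemma mollify_mono:
  fixes f :: "'a::euclidean_space \<Rightarrow> real"
  assumes r: "r > 0" and f: "continuous_on UNIV f" and g: "continuous_on UNIV g"
    and le: "\<And>w. norm w \<le> r \<Longrightarrow> f (x + w) \<le> g (y + w)"
  shows "mollify r f x \<le> mollify r g y"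
proof -
  have "cap r w ^ 3 * f (x + w) \<le> cap r w ^ 3 * g (y + w)" for w
    using le[of w] cap_eq_0[OF r, of w] by (cases "norm w \<le> r") (auto intro!: mult_left_mono simp: cap_nonneg)
  then show ?thesis unfolding mollify_def correlation_def
    using bump_mass_pos[OF r, where 'a='a]
    by (intro divide_right_mono integral_le bump_times_integrable f g) auto
qed

lemma mollify_le:
  assumes r: "r > 0" and f: "continuous_on UNIV f" and le: "\<And>w. norm w \<le> r \<Longrightarrow> f (x + w) \<le> c"
  shows "mollify r f x \<le> c"
  using mollify_mono[OF r f, of "\<lambda>_. c" x x] le by (simp add: mollify_const[OF r])

lemma mollify_ge:
  assumes r: "r > 0" and f: "continuous_on UNIV f" and le: "\<And>w. norm w \<le> r \<Longrightarrow> c \<le> f (x + w)"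
  shows "c \<le> mollify r f x"
  using mollify_mono[OF r _ f, of "\<lambda>_. c" x x] le by (simp add: mollify_const[OF r])

text \<open>
  Every inequality between translates of two functions that involves only an additive constant survives
  mollification.  This gives Lipschitz bounds, slope bounds, periodicity and the Hopf-Lax inequality
  for the mollified functions.
\<close>

lemma mollify_diff_le:
  assumes r: "r > 0" and f: "continuous_on UNIV f" and g: "continuous_on UNIV g"
    and le: "\<And>w. norm w \<le> r \<Longrightarrow> f (x + w) \<le> g (y + w) + c"
  shows "mollify r f x \<le> mollify r g y + c"
proof -
  have "mollify r f x \<le> mollify r (\<lambda>w. g w + c) y"
    by (rule mollify_mono[OF r f]) (auto intro!: continuous_intros g le)
  also have "\<dots> = mollify r g y + c"
    using mollify_add[OF g, of "\<lambda>_. c"] mollify_const[OF r] by auto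
  finally show ?thesis .
qed

definition mollify_grad :: "real \<Rightarrow> ('a::euclidean_space \<Rightarrow> real) \<Rightarrow> 'a \<Rightarrow> 'a" where
  "mollify_grad r f x = (\<Sum>b\<in>Basis. mollify_deriv r f x b *\<^sub>R b)"

lemma inner_mollify_grad:
  assumes "r > 0" "continuous_on UNIV f"
  shows "k \<bullet> mollify_grad r f x = mollify_deriv r f x k"
proof -
  interpret D: linear "mollify_deriv r f x"
    using mollify_has_derivative[OF assms] by (rule has_derivative_linear)
  have "mollify_deriv r f x k = mollify_deriv r f x (\<Sum>b\<in>Basis. (k \<bullet> b) *\<^sub>R b)"
    by (simp add: euclidean_representation)
  also have "\<dots> = k \<bullet> mollify_grad r f x"
    by (simp add: D.sum D.scale mollify_grad_def inner_sum_right mult.commute)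
  finally show ?thesis by simp
qed

lemma mollify_gderiv:
  assumes "r > 0" "continuous_on UNIV f"
  shows "GDERIV (mollify r f) x :> mollify_grad r f x"
  unfolding gderiv_def inner_mollify_grad[OF assms] by (rule mollify_has_derivative[OF assms])

lemma continuous_mollify_grad:
  assumes "r > 0" "continuous_on UNIV f"
  shows "continuous_on UNIV (mollify_grad r f)"
  unfolding mollify_grad_def[abs_def] by (intro continuous_intros continuous_mollify_deriv assms)

lemma derivative_le_from_increments:
  fixes f :: "'a::real_normed_vector \<Rightarrow> real"
  assumes f: "(f has_derivative f') (at x)" and s0: "s0 > 0"
    and le: "\<And>s. 0 < s \<Longrightarrow> s \<le> s0 \<Longrightarrow> f (x + s *\<^sub>R v) \<le> f x + s * c"
  shows "f' v \<le> c"
proof -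
  interpret f': bounded_linear f' using f by (rule has_derivative_bounded_linear)
  have "((\<lambda>s. f (x + s *\<^sub>R v)) has_derivative (\<lambda>s. f' (s *\<^sub>R v))) (at 0)"
    by (rule has_derivative_compose[of "\<lambda>s. x + s *\<^sub>R v" "\<lambda>s. s *\<^sub>R v" 0 UNIV f])
       (use f in \<open>auto intro!: derivative_eq_intros\<close>)
  then have "((\<lambda>s. f (x + s *\<^sub>R v)) has_real_derivative f' v) (at 0)"
    by (simp add: f'.scaleR has_field_derivative_def mult.commute[of _ "f' v"])
  then have "((\<lambda>s. (f (x + s *\<^sub>R v) - f x) / s) \<longlongrightarrow> f' v) (at 0)"
    by (simp add: DERIV_def)
  then have "((\<lambda>s. (f (x + s *\<^sub>R v) - f x) / s) \<longlongrightarrow> f' v) (at_right 0)"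
    by (rule filterlim_mono) (auto simp: at_le)
  moreover have "\<forall>\<^sub>F s in at_right 0. (f (x + s *\<^sub>R v) - f x) / s \<le> c"
    using eventually_at_right_real[OF s0]
    by eventually_elim (use le in \<open>auto simp: field_simps\<close>)
  ultimately show ?thesis by (intro tendsto_upperbound) auto
qed

section \<open>Periodic functions\<close>

text \<open>
  Reduction modulo the lattice: a periodic function is determined by its values on the unit cube.
\<close>

lemma torus_periodic_int_shift:
  assumes "torus_periodic v"
  shows "v (x + (\<Sum>i\<in>S. of_int (k i) *\<^sub>R axis i 1)) = v x"
proof -
  have nat_shift: "v (y + real n *\<^sub>R axis i 1) = v y" for y i n
  proof (induction n)
    case (Suc n)
    have "v (y + real (Suc n) *\<^sub>R axis i 1) = v (y + real n *\<^sub>R axis i 1 + axis i 1)"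
      by (simp add: algebra_simps)
    also have "\<dots> = v y" using assms Suc unfolding torus_periodic_def by metis
    finally show ?case .
  qed simp
  have int_shift: "v (y + of_int m *\<^sub>R axis i 1) = v y" for y i m
  proof (cases "m \<ge> 0")
    case True
    then show ?thesis using nat_shift[of y "nat m" i] by simp
  next
    case False
    then show ?thesis using nat_shift[of "y + of_int m *\<^sub>R axis i 1" "nat (- m)" i] by simp
  qed
  show ?thesis
  proof (induction S rule: infinite_finite_induct)
    case (insert i S)
    have "v (x + (\<Sum>i\<in>insert i S. of_int (k i) *\<^sub>R axis i 1))
        = v (x + (\<Sum>i\<in>S. of_int (k i) *\<^sub>R axis i 1) + of_int (k i) *\<^sub>R axis i 1)"
      using insert by (simp add: add_ac)
    then show ?case using insert int_shift by simp
  qed simp_all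
qed

definition wrap :: "real ^ 'n \<Rightarrow> real ^ 'n" where "wrap x = (\<chi> i. frac (x $ i))"

lemma wrap_in_cube: "wrap x \<in> cbox 0 1"
  by (auto simp: wrap_def mem_box_cart frac_lt_1 less_imp_le)

lemma torus_periodic_wrap:
  assumes "torus_periodic v"
  shows "v (wrap x) = v x"
proof -
  have "wrap x + (\<Sum>i\<in>UNIV. of_int \<lfloor>x $ i\<rfloor> *\<^sub>R axis i 1) = x"
    by (vector wrap_def frac_def axis_def) (simp add: if_distrib sum.delta cong: if_cong)
  then show ?thesis using torus_periodic_int_shift[OF assms, of "wrap x" "\<lambda>i. \<lfloor>x $ i\<rfloor>" UNIV] by simp
qed

section \<open>The Hopf-Lax formula\<close>

text \<open>
  For \<open>\<Gamma>\<close> the epigraph of the Legendre transform of the Hamiltonian this is the classical formula.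
  Any convex \<open>\<Gamma>\<close> inside the epigraph that contains the optimal pairs for the relevant slopes will do.
\<close>

definition hopf_lax :: "((real ^ 'n) \<times> real) set \<Rightarrow> (real ^ 'n \<Rightarrow> real) \<Rightarrow> real ^ 'n \<Rightarrow> real \<Rightarrow> real" where
  "hopf_lax \<Gamma> g x t = (INF c\<in>\<Gamma>. g (x - t *\<^sub>R fst c) + t * snd c)"

context
  fixes \<Gamma> :: "((real ^ 'n) \<times> real) set" and g :: "real ^ 'n \<Rightarrow> real" and L Q M :: real
  assumes ne: "\<Gamma> \<noteq> {}" and cvx: "convex \<Gamma>"
    and speed: "\<And>c. c \<in> \<Gamma> \<Longrightarrow> norm (fst c) \<le> Q"
    and cost: "\<And>c. c \<in> \<Gamma> \<Longrightarrow> snd c \<ge> - M"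
    and lip: "\<And>x y. \<bar>g x - g y\<bar> \<le> L * norm (x - y)"
begin

lemma lip_nonneg: "L \<ge> 0"
proof -
  have "\<bar>g (axis undefined 1) - g 0\<bar> \<le> L" using lip[of "axis undefined 1" 0] by simp
  then show ?thesis by simp
qed

lemma hopf_lax_summand_ge:
  assumes c: "c \<in> \<Gamma>" and t: "t \<ge> 0"
  shows "g x - t * (L * Q + M) \<le> g (x - t *\<^sub>R fst c) + t * snd c"
proof -
  have "g x - g (x - t *\<^sub>R fst c) \<le> L * (t * norm (fst c))"
    using lip[of x "x - t *\<^sub>R fst c"] t by (simp add: abs_le_iff)
  also have "\<dots> \<le> L * (t * Q)" using speed[OF c] t lip_nonneg by (intro mult_left_mono) auto
  finally have "g x - g (x - t *\<^sub>R fst c) \<le> t * (L * Q)" by (simp add: mult_ac)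
  moreover have "- (t * M) \<le> t * snd c" using mult_left_mono[OF cost[OF c] t] by simp
  ultimately show ?thesis by (simp add: distrib_left)
qed

lemma hopf_lax_le:
  assumes "c \<in> \<Gamma>" "t \<ge> 0"
  shows "hopf_lax \<Gamma> g x t \<le> g (x - t *\<^sub>R fst c) + t * snd c"
  unfolding hopf_lax_def
  by (rule cINF_lower[OF _ assms(1)]) (use hopf_lax_summand_ge assms(2) in \<open>auto intro!: bdd_belowI2\<close>)

lemma hopf_lax_greatest:
  assumes "\<And>c. c \<in> \<Gamma> \<Longrightarrow> z \<le> g (x - t *\<^sub>R fst c) + t * snd c"
  shows "z \<le> hopf_lax \<Gamma> g x t"
  unfolding hopf_lax_def by (rule cINF_greatest[OF ne assms])

lemma hopf_lax_0: "hopf_lax \<Gamma> g x 0 = g x"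
  using ne by (simp add: hopf_lax_def)

text \<open>
  Using one control for time \<open>t\<close> and another for time \<open>s\<close> has the same effect as using their weighted
  mean for time \<open>t + s\<close>, and the mean is again a control because \<open>\<Gamma>\<close> is convex.
\<close>

lemma hopf_lax_step:
  assumes c: "c \<in> \<Gamma>" and s: "s \<ge> 0" and t: "t \<ge> 0"
  shows "hopf_lax \<Gamma> g x (t + s) \<le> hopf_lax \<Gamma> g (x - s *\<^sub>R fst c) t + s * snd c"
proof -
  have "hopf_lax \<Gamma> g x (t + s) - s * snd c \<le> hopf_lax \<Gamma> g (x - s *\<^sub>R fst c) t"
  proof (rule hopf_lax_greatest)
    fix c' assume c': "c' \<in> \<Gamma>"
    show "hopf_lax \<Gamma> g x (t + s) - s * snd c \<le> g (x - s *\<^sub>R fst c - t *\<^sub>R fst c') + t * snd c'"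
    proof (cases "t + s = 0")
      case True
      then have "t = 0" "s = 0" using s t by auto
      then show ?thesis by (simp add: hopf_lax_0)
    next
      case False
      then have ts: "t + s > 0" using s t by auto
      define c'' where "c'' = (t / (t + s)) *\<^sub>R c' + (s / (t + s)) *\<^sub>R c"
      have "c'' \<in> \<Gamma>" unfolding c''_def
        using ts s t by (intro convexD[OF cvx c' c]) (auto simp: add_divide_distrib[symmetric])
      then have "hopf_lax \<Gamma> g x (t + s) \<le> g (x - (t + s) *\<^sub>R fst c'') + (t + s) * snd c''"
        using s t by (intro hopf_lax_le) auto
      moreover have "(t + s) *\<^sub>R c'' = t *\<^sub>R c' + s *\<^sub>R c"
        unfolding c''_def using ts by (simp add: scaleR_add_right)
      then have "(t + s) *\<^sub>R fst c'' = t *\<^sub>R fst c' + s *\<^sub>R fst c"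
        and "(t + s) * snd c'' = t * snd c' + s * snd c"
        by (metis fst_scaleR fst_add, metis snd_scaleR snd_add real_scaleR_def)
      ultimately show ?thesis by (simp add: algebra_simps)
    qed
  qed
  then show ?thesis by simp
qed

lemma hopf_lax_shift:
  assumes "\<And>x. g (x + z) \<le> g x + m" and t: "t \<ge> 0"
  shows "hopf_lax \<Gamma> g (x + z) t \<le> hopf_lax \<Gamma> g x t + m"
proof -
  have "hopf_lax \<Gamma> g (x + z) t - m \<le> hopf_lax \<Gamma> g x t"
  proof (rule hopf_lax_greatest)
    fix c assume c: "c \<in> \<Gamma>"
    have "hopf_lax \<Gamma> g (x + z) t \<le> g (x - t *\<^sub>R fst c + z) + t * snd c"
      using hopf_lax_le[OF c t, of "x + z"] by (simp add: algebra_simps)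
    then show "hopf_lax \<Gamma> g (x + z) t - m \<le> g (x - t *\<^sub>R fst c) + t * snd c"
      using assms(1)[of "x - t *\<^sub>R fst c"] by simp
  qed
  then show ?thesis by simp
qed

lemma hopf_lax_lipschitz:
  assumes t: "t \<ge> 0"
  shows "\<bar>hopf_lax \<Gamma> g x t - hopf_lax \<Gamma> g y t\<bar> \<le> L * norm (x - y)"
proof -
  have "hopf_lax \<Gamma> g x t \<le> hopf_lax \<Gamma> g y t + L * norm (x - y)" for x y
  proof -
    have "g (z + (x - y)) \<le> g z + L * norm (x - y)" for z using lip[of "z + (x - y)" z] by (simp add: abs_le_iff)
    from hopf_lax_shift[OF this t, of y] show ?thesis by simp
  qed
  from this[of x y] this[of y x] show ?thesis by (simp add: norm_minus_commute abs_le_iff)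
qed

lemma hopf_lax_periodic:
  assumes "torus_periodic g" "t \<ge> 0"
  shows "torus_periodic (\<lambda>x. hopf_lax \<Gamma> g x t)"
  unfolding torus_periodic_def
proof (intro allI)
  fix x i
  have per: "g (y + axis i 1) = g y" for y using assms(1) unfolding torus_periodic_def by auto
  have per': "g (y - axis i 1) = g y" for y using per[of "y - axis i 1"] by simp
  show "hopf_lax \<Gamma> g (x + axis i 1) t = hopf_lax \<Gamma> g x t"
    using hopf_lax_shift[of "axis i 1" 0 t x] hopf_lax_shift[of "- axis i 1" 0 t "x + axis i 1"]
      assms(2) per per' by simp
qed

lemma hopf_lax_time_lipschitz:
  obtains C where "C \<ge> 0" "\<And>x t s. t \<ge> 0 \<Longrightarrow> s \<ge> 0 \<Longrightarrow> \<bar>hopf_lax \<Gamma> g x t - hopf_lax \<Gamma> g x s\<bar> \<le> C * \<bar>t - s\<bar>"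
proof -
  obtain c0 where c0: "c0 \<in> \<Gamma>" using ne by auto
  define C where "C = L * Q + \<bar>M\<bar> + \<bar>snd c0\<bar>"
  have Q: "Q \<ge> 0" using speed[OF c0] norm_ge_zero order_trans by blast
  then have C: "C \<ge> 0" unfolding C_def using lip_nonneg by auto
  have inc: "\<bar>hopf_lax \<Gamma> g x (t + s) - hopf_lax \<Gamma> g x t\<bar> \<le> C * s" if t: "t \<ge> 0" and s: "s \<ge> 0" for x t s
  proof -
    have "hopf_lax \<Gamma> g x (t + s) \<le> hopf_lax \<Gamma> g (x - s *\<^sub>R fst c0) t + s * snd c0"
      by (rule hopf_lax_step[OF c0 s t])
    moreover have "hopf_lax \<Gamma> g (x - s *\<^sub>R fst c0) t - hopf_lax \<Gamma> g x t \<le> L * (s * norm (fst c0))"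
      using hopf_lax_lipschitz[OF t, of "x - s *\<^sub>R fst c0" x] s by (simp add: abs_le_iff)
    moreover have "L * (s * norm (fst c0)) \<le> L * (s * Q)"
      using speed[OF c0] s lip_nonneg by (intro mult_left_mono) auto
    moreover have "s * snd c0 \<le> s * \<bar>snd c0\<bar>" using s by (intro mult_left_mono) auto
    moreover have "0 \<le> s * \<bar>M\<bar>" using s by simp
    ultimately have up: "hopf_lax \<Gamma> g x (t + s) - hopf_lax \<Gamma> g x t \<le> C * s"
      unfolding C_def by (simp add: algebra_simps)
    have "hopf_lax \<Gamma> g x t - C * s \<le> hopf_lax \<Gamma> g x (t + s)"
    proof (rule hopf_lax_greatest)
      fix c assume c: "c \<in> \<Gamma>"
      have 1: "hopf_lax \<Gamma> g x t \<le> g (x - t *\<^sub>R fst c) + t * snd c" by (rule hopf_lax_le[OF c t])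
      have 2: "g (x - t *\<^sub>R fst c) - s * (L * Q + M) \<le> g (x - t *\<^sub>R fst c - s *\<^sub>R fst c) + s * snd c"
        by (rule hopf_lax_summand_ge[OF c s])
      have "s * (L * Q + M) \<le> s * C" unfolding C_def using s by (intro mult_left_mono) auto
      then show "hopf_lax \<Gamma> g x t - C * s \<le> g (x - (t + s) *\<^sub>R fst c) + (t + s) * snd c"
        using 1 2 by (simp add: algebra_simps)
    qed
    then show ?thesis using up by (simp add: abs_le_iff)
  qed
  have "\<bar>hopf_lax \<Gamma> g x t - hopf_lax \<Gamma> g x s\<bar> \<le> C * \<bar>t - s\<bar>" if "t \<ge> 0" "s \<ge> 0" for x t s
    using inc[of s "t - s" x] inc[of t "s - t" x] that by (cases "s \<le> t") (auto simp: abs_minus_commute)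
  then show ?thesis using that C by blast
qed

text \<open>
  An infimum of translates of \<open>g\<close>, raised by constants, inherits semiconcavity with the same constant.
\<close>

lemma hopf_lax_semiconcave:
  assumes K: "semiconcave K g" and t: "t \<ge> 0"
  shows "semiconcave K (\<lambda>x. hopf_lax \<Gamma> g x t)"
  unfolding semiconcave_def
proof (intro conjI allI ballI)
  show "K > 0" using K unfolding semiconcave_def by auto
  fix x y :: "real ^ 'n" and l :: real assume l: "l \<in> {0<..<1}"
  show "l * hopf_lax \<Gamma> g x t + (1 - l) * hopf_lax \<Gamma> g y t - l * (1 - l) * K * (norm (x - y))\<^sup>2
      \<le> hopf_lax \<Gamma> g (l *\<^sub>R x + (1 - l) *\<^sub>R y) t"
  proof (rule hopf_lax_greatest)
    fix c assume c: "c \<in> \<Gamma>"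
    let ?q = "t *\<^sub>R fst c"
    have "l * hopf_lax \<Gamma> g x t \<le> l * (g (x - ?q) + t * snd c)"
      using l by (intro mult_left_mono hopf_lax_le c t) auto
    moreover have "(1 - l) * hopf_lax \<Gamma> g y t \<le> (1 - l) * (g (y - ?q) + t * snd c)"
      using l by (intro mult_left_mono hopf_lax_le c t) auto
    moreover have "l * g (x - ?q) + (1 - l) * g (y - ?q) - l * (1 - l) * K * (norm ((x - ?q) - (y - ?q)))\<^sup>2
        \<le> g (l *\<^sub>R (x - ?q) + (1 - l) *\<^sub>R (y - ?q))"
      using K l unfolding semiconcave_def by blast
    moreover have "l *\<^sub>R (x - ?q) + (1 - l) *\<^sub>R (y - ?q) = l *\<^sub>R x + (1 - l) *\<^sub>R y - ?q"
      by (simp add: algebra_simps)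
    ultimately show "l * hopf_lax \<Gamma> g x t + (1 - l) * hopf_lax \<Gamma> g y t - l * (1 - l) * K * (norm (x - y))\<^sup>2
        \<le> g (l *\<^sub>R x + (1 - l) *\<^sub>R y - ?q) + t * snd c"
      by (simp add: algebra_simps)
  qed
qed

end

section \<open>Identification of the viscosity solution\<close>

text \<open>
  The comparison function \<open>W\<close> is a smooth cone around \<open>x0 + t q\<close>, steeper than \<open>g\<close> and raised at rate
  \<open>l\<close>.  With \<open>p\<close> its spatial gradient, \<open>W\<^sub>t + H (DW) = l - p \<bullet> q + H p \<ge> 0\<close>.
\<close>

lemma viscosity_le_hopf_lax:
  fixes H :: "real ^ 'n \<Rightarrow> real"
  assumes T: "T > 0" and u: "viscosity_solution H g T u"
    and lip: "\<And>x y. \<bar>g x - g y\<bar> \<le> L * norm (x - y)" and L: "L \<ge> 0"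
    and fenchel: "\<And>p. p \<bullet> q \<le> H p + l"
    and t: "t \<in> {0..T}"
  shows "u (x, t) \<le> g (x - t *\<^sub>R q) + t * l"
proof (rule field_le_epsilon)
  fix e :: real assume e: "e > 0"
  \<comment> \<open>The rounding radius \<open>d\<close> makes the tip of the cone exceed \<open>g x0\<close> by \<open>e\<close>.\<close>
  define d where "d = e / (L + 1)"
  have d: "d > 0" using e L by (simp add: d_def)
  define x0 where "x0 = x - t *\<^sub>R q"
  define y where "y z = fst z - x0 - snd z *\<^sub>R q" for z :: "(real ^ 'n) \<times> real"
  define S where "S z = sqrt (d\<^sup>2 + y z \<bullet> y z)" for z
  define W where "W z = g x0 + (L + 1) * S z + snd z * l" for z
  define p where "p z = ((L + 1) / S z) *\<^sub>R y z" for z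
  define D where "D z = (p z, l - p z \<bullet> q)" for z
  have pos: "d\<^sup>2 + y z \<bullet> y z > 0" for z using d by (simp add: add_pos_nonneg)
  then have S_pos: "S z > 0" for z unfolding S_def by simp
  have S_ge: "norm (y z) \<le> S z" for z
    unfolding S_def by (rule real_le_rsqrt) (simp add: power2_norm_eq_inner)
  have S_le: "S z \<le> d + norm (y z)" for z
    unfolding S_def by (rule real_le_lsqrt) (use d in \<open>auto simp: power2_sum power2_norm_eq_inner\<close>)
  have cont_y: "continuous_on A y" for A unfolding y_def[abs_def] by (intro continuous_intros)
  have cont_S: "continuous_on A S" for A unfolding S_def[abs_def] by (intro continuous_intros cont_y)
  have cont_p: "continuous_on A p" for A unfolding p_def[abs_def]
    by (intro continuous_intros cont_y cont_S) (use S_pos in \<open>auto simp: less_imp_neq[THEN not_sym]\<close>)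
  have deriv: "GDERIV W z :> D z" for z
  proof -
    have y': "(y has_derivative (\<lambda>k. fst k - snd k *\<^sub>R q)) (at z)"
      unfolding y_def[abs_def] by (auto intro!: derivative_eq_intros)
    have "((\<lambda>z. d\<^sup>2 + y z \<bullet> y z) has_derivative (\<lambda>k. 2 * ((fst k - snd k *\<^sub>R q) \<bullet> y z))) (at z)"
      by (auto intro!: derivative_eq_intros y' simp: inner_commute)
    from has_derivative_compose[OF this
        DERIV_real_sqrt[OF pos, unfolded has_field_derivative_def, of z]]
    have S': "(S has_derivative (\<lambda>k. inverse (S z) / 2 * (2 * ((fst k - snd k *\<^sub>R q) \<bullet> y z)))) (at z)"
      unfolding S_def[abs_def] .
    have "(W has_derivative (\<lambda>k. 0 + (L + 1) * (inverse (S z) / 2 * (2 * ((fst k - snd k *\<^sub>R q) \<bullet> y z))) + snd k * l)) (at z)"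
      unfolding W_def[abs_def]
      by (intro has_derivative_add has_derivative_const has_derivative_mult_right has_derivative_mult_left
          has_derivative_snd has_derivative_ident S')
    moreover have "0 + (L + 1) * (inverse (S z) / 2 * (2 * ((fst k - snd k *\<^sub>R q) \<bullet> y z))) + snd k * l = k \<bullet> D z" for k
    proof -
      define a b c where "a = inverse (S z)" and "b = fst k \<bullet> y z" and "c = q \<bullet> y z"
      have "k \<bullet> D z = fst k \<bullet> p z + snd k * (l - p z \<bullet> q)" by (simp add: D_def inner_prod_def)
      also have "fst k \<bullet> p z = (L + 1) * a * b" by (simp add: p_def a_def b_def divide_inverse)
      also have "p z \<bullet> q = (L + 1) * a * c"
        by (simp add: p_def a_def c_def divide_inverse inner_commute[of "y z" q])
      finally have e1: "k \<bullet> D z = (L + 1) * a * b + snd k * (l - (L + 1) * a * c)" .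
      have e2: "(fst k - snd k *\<^sub>R q) \<bullet> y z = b - snd k * c"
        by (simp add: b_def c_def inner_diff_left)
      show ?thesis unfolding e1 e2 a_def[symmetric] by (simp add: algebra_simps)
    qed
    ultimately show ?thesis unfolding gderiv_def by (simp only:)
  qed
  have cont_u: "continuous_on (UNIV \<times> {0..T}) u" and per: "\<And>s. s \<in> {0..T} \<Longrightarrow> torus_periodic (\<lambda>x. u (x, s))"
    and init: "\<And>x. u (x, 0) = g x"
    using u unfolding viscosity_solution_def by auto
  have "compact ((cbox 0 1 :: (real ^ 'n) set) \<times> {0..T})" by (intro compact_Times) auto
  then have "compact (u ` (cbox 0 1 \<times> {0..T}))"
    by (intro compact_continuous_image continuous_on_subset[OF cont_u]) auto
  then obtain M where "\<forall>z\<in>u ` (cbox 0 1 \<times> {0..T}). norm z \<le> M"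
    using compact_imp_bounded bounded_iff by blast
  then have M: "\<bar>u (x, s)\<bar> \<le> M" if "s \<in> {0..T}" for x s
    using torus_periodic_wrap[OF per[OF that], of x] wrap_in_cube[of x] that by force
  \<comment> \<open>Outside the ball of this radius \<open>W\<close> exceeds its value at \<open>x0\<close> by at least \<open>2 M\<close>.\<close>
  define \<rho> where "\<rho> = 2 * M + 2 * T * norm q + d"
  have "u (x, t) \<le> W (x, t)"
  proof (rule subsolution_le_C1_supersolution[where H = H and T = T and D = D and B = "cball x0 \<rho>"])
    show "viscosity_subsolution H T u" using u unfolding viscosity_solution_def by auto
    show "continuous_on (UNIV \<times> {0..T}) W" unfolding W_def[abs_def] by (intro continuous_intros cont_S)
    show "test_function T W D" unfolding test_function_def
      using deriv by (auto simp: D_def intro!: continuous_intros cont_p)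
    show "0 \<le> snd (D z) + H (fst (D z))" for z using fenchel[of "p z"] by (simp add: D_def)
    show "u (x, 0) \<le> W (x, 0)" for x
    proof -
      have "g x \<le> g x0 + L * norm (x - x0)" using lip[of x x0] by (simp add: abs_le_iff)
      also have "\<dots> \<le> g x0 + (L + 1) * S (x, 0)"
        using S_ge[of "(x, 0)"] L by (auto simp: y_def intro!: mult_mono)
      finally show ?thesis by (simp add: init W_def)
    qed
    show "\<exists>y\<in>cball x0 \<rho>. u (x, t) - W (x, t) \<le> u (y, t) - W (y, t)" if t: "t \<in> {0..T}" for x t
    proof (cases "x \<in> cball x0 \<rho>")
      case False
      then have far: "norm (x - x0) > \<rho>" by (simp add: dist_norm norm_minus_commute)
      have tq: "t * norm q \<le> T * norm q" using t by (intro mult_right_mono) auto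
      have "norm (x - x0) \<le> norm (y (x, t)) + t * norm q"
        using norm_triangle_ineq[of "y (x, t)" "t *\<^sub>R q"] t by (simp add: y_def)
      also have "\<dots> \<le> S (x, t) + T * norm q" using S_ge[of "(x, t)"] tq by linarith
      finally have "S (x, t) \<ge> norm (x - x0) - T * norm q" by simp
      moreover have "S (x0, t) \<le> d + T * norm q" using S_le[of "(x0, t)"] tq t by (simp add: y_def)
      ultimately have diff: "S (x, t) - S (x0, t) \<ge> 2 * M" using far unfolding \<rho>_def by linarith
      have "M \<ge> 0" using M[OF t, of x] by linarith
      then have "1 * (S (x, t) - S (x0, t)) \<le> (L + 1) * (S (x, t) - S (x0, t))"
        using L diff by (intro mult_right_mono) auto
      then have "W (x, t) - W (x0, t) \<ge> 2 * M" using diff unfolding W_def by (simp add: algebra_simps)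
      moreover have "u (x, t) - u (x0, t) \<le> 2 * M" using M[OF t, of x] M[OF t, of x0] by linarith
      moreover have "\<rho> \<ge> 0" unfolding \<rho>_def using \<open>M \<ge> 0\<close> T d by (intro add_nonneg_nonneg) auto
      ultimately show ?thesis by (intro bexI[of _ x0]) auto
    qed auto
  qed (use cont_u t in auto)
  also have "W (x, t) = g (x - t *\<^sub>R q) + t * l + (L + 1) * d"
    using d by (simp add: W_def S_def y_def x0_def)
  also have "(L + 1) * d = e" using L by (simp add: d_def)
  finally show "u (x, t) \<le> g (x - t *\<^sub>R q) + t * l + e" .
qed

text \<open>
  The inequality of \<open>hopf_lax_step\<close> is linear in the function, so it passes to a space-time
  mollification \<open>Z\<close>, for which it becomes \<open>Z\<^sub>t + DZ \<bullet> q \<le> l\<close> for every control.  The slopes of \<open>Z\<close> along the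
  axes are at most \<open>R\<close>, hence some control satisfies \<open>DZ \<bullet> q - l \<ge> H (DZ)\<close>, and \<open>Z\<close> is a classical
  subsolution.
\<close>

lemma hopf_lax_le_viscosity:
  fixes H :: "real ^ 'n \<Rightarrow> real"
  assumes T: "T > 0" and u: "viscosity_solution H g T u"
    and ne: "\<Gamma> \<noteq> {}" and cvx: "convex \<Gamma>"
    and speed: "\<And>c. c \<in> \<Gamma> \<Longrightarrow> norm (fst c) \<le> Q"
    and cost: "\<And>c. c \<in> \<Gamma> \<Longrightarrow> snd c \<ge> - M"
    and touch: "\<And>p. (\<And>i. \<bar>p $ i\<bar> \<le> R) \<Longrightarrow> \<exists>c\<in>\<Gamma>. p \<bullet> fst c \<ge> H p + snd c"
    and lip: "\<And>x y. \<bar>g x - g y\<bar> \<le> L * norm (x - y)"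
    and lipR: "\<And>x i s. g (x + s *\<^sub>R axis i 1) \<le> g x + R * \<bar>s\<bar>"
    and t: "t \<in> {0..T}"
  shows "hopf_lax \<Gamma> g x t \<le> u (x, t)"
proof -
  note hl = ne cvx speed cost lip
  obtain C where C: "C \<ge> 0" and
    time_lip: "\<And>x t s. t \<ge> 0 \<Longrightarrow> s \<ge> 0 \<Longrightarrow> \<bar>hopf_lax \<Gamma> g x t - hopf_lax \<Gamma> g x s\<bar> \<le> C * \<bar>t - s\<bar>"
    using hopf_lax_time_lipschitz[OF hl] by blast
  have L: "L \<ge> 0" by (rule lip_nonneg[OF hl])
  \<comment> \<open>Extended to negative times only to have a continuous function on the whole space.\<close>
  define E where "E z = hopf_lax \<Gamma> g (fst z) (max 0 (snd z))" for z :: "(real ^ 'n) \<times> real"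
  have E_lip: "\<bar>E z - E z'\<bar> \<le> L * norm (fst z - fst z') + C * \<bar>snd z - snd z'\<bar>" for z z'
  proof -
    have "\<bar>E z - E z'\<bar> \<le> \<bar>hopf_lax \<Gamma> g (fst z) (max 0 (snd z)) - hopf_lax \<Gamma> g (fst z') (max 0 (snd z))\<bar>
        + \<bar>hopf_lax \<Gamma> g (fst z') (max 0 (snd z)) - hopf_lax \<Gamma> g (fst z') (max 0 (snd z'))\<bar>"
      unfolding E_def by linarith
    also have "\<dots> \<le> L * norm (fst z - fst z') + C * \<bar>max 0 (snd z) - max 0 (snd z')\<bar>"
      using hopf_lax_lipschitz[OF hl] time_lip by (intro add_mono) auto
    also have "\<dots> \<le> L * norm (fst z - fst z') + C * \<bar>snd z - snd z'\<bar>"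
      using C by (intro add_left_mono mult_left_mono) auto
    finally show ?thesis .
  qed
  have E_lip': "\<bar>E z - E z'\<bar> \<le> (L + C) * norm (z - z')" for z z'
  proof -
    have "L * norm (fst z - fst z') + C * \<bar>snd z - snd z'\<bar> \<le> L * norm (z - z') + C * norm (z - z')"
      using L C norm_fst_le[of "fst (z - z')" "snd (z - z')"] norm_snd_le[of "snd (z - z')" "fst (z - z')"]
      by (intro add_mono mult_left_mono) (auto simp: minus_prod_def)
    then show ?thesis using E_lip[of z z'] by (simp add: distrib_right)
  qed
  have cont_E: "continuous_on UNIV E"
  proof (rule lipschitz_on_continuous_on)
    show "(L + C)-lipschitz_on UNIV E"
      by (rule lipschitz_onI) (use E_lip' L C in \<open>auto simp: dist_norm\<close>)
  qed
  have cont_u: "continuous_on (UNIV \<times> {0..T}) u" and per: "\<And>s. s \<in> {0..T} \<Longrightarrow> torus_periodic (\<lambda>x. u (x, s))"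
    and init: "\<And>x. u (x, 0) = g x"
    using u unfolding viscosity_solution_def by auto
  show ?thesis
  proof (rule field_le_epsilon)
    fix e :: real assume e: "e > 0"
    define m where "m = e / 2"
    define r where "r = m / (2 * (L + C) + 1)"
    have r: "r > 0" using e L C by (simp add: r_def m_def)
    have rm: "(L + C) * (2 * r) \<le> m"
    proof -
      have "(2 * (L + C) + 1) * r = m" using L C by (simp add: r_def)
      then show ?thesis using r by (simp add: algebra_simps)
    qed
    \<comment> \<open>The time shift by \<open>r\<close> keeps the mollification at \<open>t \<ge> 0\<close> within nonnegative times; lowering by
      \<open>m\<close> puts \<open>Z\<close> below \<open>g\<close> at \<open>t = 0\<close>.\<close>
    define Z where "Z z = mollify r E (z + (0, r)) - m" for z
    define D where "D z = mollify_grad r E (z + (0, r))" for z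
    have cont_Z: "continuous_on A Z" for A unfolding Z_def[abs_def]
      by (intro continuous_intros continuous_on_compose2[OF continuous_mollify[OF r cont_E]]) auto
    have cont_D: "continuous_on A D" for A unfolding D_def[abs_def]
      by (intro continuous_intros continuous_on_compose2[OF continuous_mollify_grad[OF r cont_E]]) auto
    have deriv: "(Z has_derivative (\<lambda>k. k \<bullet> D z)) (at z)" for z
    proof -
      have "((\<lambda>z. mollify r E (z + (0, r))) has_derivative (\<lambda>k. k \<bullet> D z)) (at z)"
        by (rule has_derivative_compose[of "\<lambda>z. z + (0, r)" "\<lambda>k. k" z UNIV "mollify r E"])
           (use mollify_gderiv[OF r cont_E, of "z + (0, r)"] in
             \<open>auto simp: gderiv_def D_def intro!: derivative_eq_intros\<close>)
      then show ?thesis unfolding Z_def[abs_def] by (auto intro!: derivative_eq_intros)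
    qed
    have near: "\<bar>E (z + (0, r) + w) - E z\<bar> \<le> m" if w: "norm w \<le> r" for z w
    proof -
      have "norm ((0, r) + w) \<le> 2 * r"
        using norm_triangle_ineq[of "(0, r)" w] w r by (simp add: norm_prod_def)
      then have "(L + C) * norm ((0, r) + w) \<le> (L + C) * (2 * r)" using L C by (intro mult_left_mono) auto
      moreover have "z + (0, r) + w - z = (0, r) + w" by simp
      ultimately show ?thesis using E_lip'[of "z + (0, r) + w" z] rm by simp
    qed
    have Z_le: "Z z \<le> E z" for z
    proof -
      have "mollify r E (z + (0, r)) \<le> E z + m"
        by (rule mollify_le[OF r cont_E]) (use near[of _ z] in \<open>auto simp: abs_le_iff algebra_simps\<close>)
      then show ?thesis by (simp add: Z_def)
    qed
    have Z_ge: "E z - e \<le> Z z" for z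
    proof -
      have "E z - m \<le> mollify r E (z + (0, r))"
        by (rule mollify_ge[OF r cont_E]) (use near[of _ z] in \<open>auto simp: abs_le_iff algebra_simps\<close>)
      then show ?thesis by (simp add: Z_def m_def)
    qed
    have Z_per: "torus_periodic (\<lambda>x. Z (x, s))" for s
      unfolding torus_periodic_def
    proof (intro allI)
      fix x i
      have "torus_periodic g" using per[of 0] T init by auto
      then have "E (z + (axis i 1, 0)) = E z" for z
        using hopf_lax_periodic[OF hl, of "max 0 (snd z)"] unfolding torus_periodic_def E_def by simp
      moreover have "z + (axis i 1, r) + w = (z + (0, r) + w) + (axis i 1, 0)" for z w :: "(real ^ 'n) \<times> real"
        by (simp add: prod_eq_iff)
      ultimately have "E (z + (axis i 1, r) + w) = E (z + (0, r) + w)" for z w by (simp only:)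
      then have "mollify r E ((x, s) + (axis i 1, r)) = mollify r E ((x, s) + (0, r))"
        by (intro order.antisym mollify_mono[OF r cont_E cont_E]) (simp_all only: order.refl)
      then show "Z (x + axis i 1, s) = Z (x, s)" by (simp add: Z_def)
    qed
    have sub: "snd (D z) + H (fst (D z)) \<le> 0" if z: "z \<in> UNIV \<times> {0<..<T}" for z
    proof -
      have slope: "a * fst (D z) $ i \<le> R" if a: "a = 1 \<or> a = -1" for a i
      proof -
        have "(axis i a, 0) \<bullet> D z \<le> R"
        proof (rule derivative_le_from_increments[OF deriv zero_less_one])
          fix s :: real assume s: "0 < s" "s \<le> 1"
          have "E (z + s *\<^sub>R (axis i a, 0) + (0, r) + w) \<le> E (z + (0, r) + w) + s * R" for w
          proof -
            have "s *\<^sub>R axis i a = (s * a) *\<^sub>R axis i (1 :: real)"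
              by (auto simp: vec_eq_iff axis_def)
            then have "g (y + s *\<^sub>R axis i a) \<le> g y + s * R" for y
              using lipR[of y "s * a" i] s a by (auto simp: mult.commute abs_mult)
            from hopf_lax_shift[OF hl this, where t = "max 0 (snd (z + (0, r) + w))" and x = "fst w + fst z"]
            show ?thesis unfolding E_def by (simp add: add_ac)
          qed
          then have "mollify r E (z + s *\<^sub>R (axis i a, 0) + (0, r)) \<le> mollify r E (z + (0, r)) + s * R"
            by (rule mollify_diff_le[OF r cont_E cont_E])
          then show "Z (z + s *\<^sub>R (axis i a, 0)) \<le> Z z + s * R" by (simp add: Z_def)
        qed
        moreover have "(axis i a, 0) \<bullet> D z = a * fst (D z) $ i"
          by (simp add: inner_prod_def inner_axis')
        ultimately show ?thesis by simp
      qed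
      have "\<bar>fst (D z) $ i\<bar> \<le> R" for i using slope[of 1 i] slope[of "-1" i] by auto
      then obtain c where c: "c \<in> \<Gamma>" "fst (D z) \<bullet> fst c \<ge> H (fst (D z)) + snd c" using touch by blast
      have "- (fst c, 1) \<bullet> D z \<ge> - snd c"
      proof -
        have "((\<lambda>z. - Z z) has_derivative (\<lambda>k. - (k \<bullet> D z))) (at z)"
          using deriv by (auto intro!: derivative_eq_intros)
        then have "- (- (fst c, 1) \<bullet> D z) \<le> snd c"
        proof (rule derivative_le_from_increments)
          show "snd z > 0" using z by auto
          fix s assume s: "0 < s" "s \<le> snd z"
          have "E (z + (0, r) + w) \<le> E (z + s *\<^sub>R - (fst c, 1) + (0, r) + w) + s * snd c"
            if w: "norm w \<le> r" for w
          proof -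
            have "\<bar>snd w\<bar> \<le> r" using norm_snd_le[of "snd w" "fst w"] w by simp
            then have "snd z + r + snd w - s \<ge> 0" using s by auto
            then show ?thesis
              using hopf_lax_step[OF hl c(1), of s "snd z + r + snd w - s" "fst z + fst w"] s
              unfolding E_def by (simp add: algebra_simps)
          qed
          then have "mollify r E (z + (0, r)) \<le> mollify r E (z + s *\<^sub>R - (fst c, 1) + (0, r)) + s * snd c"
            by (rule mollify_diff_le[OF r cont_E cont_E])
          then show "- Z (z + s *\<^sub>R - (fst c, 1)) \<le> - Z z + s * snd c" by (simp add: Z_def)
        qed
        then show ?thesis by simp
      qed
      then show ?thesis using c(2) by (simp add: inner_prod_def inner_commute)
    qed
    have "- u (x, t) \<le> - Z (x, t)"
    proof (rule subsolution_le_C1_supersolution[where H = "\<lambda>p. - H (- p)" and T = T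
          and u = "\<lambda>z. - u z" and W = "\<lambda>z. - Z z" and D = "\<lambda>z. - D z" and B = "cbox 0 1"])
      show "viscosity_subsolution (\<lambda>p. - H (- p)) T (\<lambda>z. - u z)"
        using u unfolding viscosity_solution_def by (auto intro: supersolution_neg)
      show "test_function T (\<lambda>z. - Z z) (\<lambda>z. - D z)"
        unfolding test_function_def gderiv_def
        using deriv by (auto intro!: continuous_intros cont_D derivative_eq_intros)
      show "0 \<le> snd (- D z) + - H (- fst (- D z))" if "z \<in> UNIV \<times> {0<..<T}" for z
        using sub[OF that] by simp
      show "- u (x, 0) \<le> - Z (x, 0)" for x
        using Z_le[of "(x, 0)"] init[of x] hopf_lax_0[OF hl] by (simp add: E_def)
      show "\<exists>y\<in>cbox 0 1. - u (x, t) - - Z (x, t) \<le> - u (y, t) - - Z (y, t)" if "t \<in> {0..T}" for x t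
        using torus_periodic_wrap[OF per[OF that], of x] torus_periodic_wrap[OF Z_per[of t], of x]
          wrap_in_cube[of x] by (intro bexI[of _ "wrap x"]) auto
    qed (use cont_u cont_Z t in \<open>auto intro!: continuous_intros\<close>)
    then show "hopf_lax \<Gamma> g x t \<le> u (x, t) + e"
      using Z_ge[of "(x, t)"] t by (simp add: E_def)
  qed
qed

lemma viscosity_eq_hopf_lax:
  fixes H :: "real ^ 'n \<Rightarrow> real"
  assumes T: "T > 0" and u: "viscosity_solution H g T u"
    and ne: "\<Gamma> \<noteq> {}" and cvx: "convex \<Gamma>"
    and speed: "\<And>c. c \<in> \<Gamma> \<Longrightarrow> norm (fst c) \<le> Q"
    and cost: "\<And>c. c \<in> \<Gamma> \<Longrightarrow> snd c \<ge> - M"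
    and fenchel: "\<And>c p. c \<in> \<Gamma> \<Longrightarrow> p \<bullet> fst c \<le> H p + snd c"
    and touch: "\<And>p. (\<And>i. \<bar>p $ i\<bar> \<le> R) \<Longrightarrow> \<exists>c\<in>\<Gamma>. p \<bullet> fst c \<ge> H p + snd c"
    and lip: "\<And>x y. \<bar>g x - g y\<bar> \<le> L * norm (x - y)"
    and lipR: "\<And>x i s. g (x + s *\<^sub>R axis i 1) \<le> g x + R * \<bar>s\<bar>"
    and t: "t \<in> {0..T}"
  shows "u (x, t) = hopf_lax \<Gamma> g x t"
proof (rule order.antisym)
  note hl = ne cvx speed cost lip
  show "u (x, t) \<le> hopf_lax \<Gamma> g x t"
  proof (rule hopf_lax_greatest[OF hl])
    fix c assume "c \<in> \<Gamma>"
    then show "u (x, t) \<le> g (x - t *\<^sub>R fst c) + t * snd c"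
      by (intro viscosity_le_hopf_lax[OF T u lip lip_nonneg[OF hl] _ t] fenchel)
  qed
  show "hopf_lax \<Gamma> g x t \<le> u (x, t)"
    by (rule hopf_lax_le_viscosity[OF T u hl(1-4) touch lip lipR t])
qed

section \<open>Monotonicity and stability of the scheme\<close>

definition scheme_step ::
    "((real ^ 'n) \<times> (real ^ 'n) \<Rightarrow> real) \<Rightarrow> real \<Rightarrow> real \<Rightarrow> (real ^ 'n \<Rightarrow> real) \<Rightarrow> real ^ 'n \<Rightarrow> real" where
  "scheme_step F h dt v x = v x - dt * F (- fwd_diff h v x, bwd_diff h v x)"

lemma scheme_Suc: "scheme F g h dt (Suc n) = scheme_step F h dt (scheme F g h dt n)"
  by (simp add: scheme_step_def fun_eq_iff)

definition slope_box :: "real \<Rightarrow> ((real ^ 'n) \<times> (real ^ 'n)) set" where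
  "slope_box R = {\<zeta>. \<forall>i. \<bar>fst \<zeta> $ i\<bar> \<le> R \<and> \<bar>snd \<zeta> $ i\<bar> \<le> R}"

lemma compact_slope_box: "compact (slope_box R :: ((real ^ 'n) \<times> (real ^ 'n)) set)"
proof -
  have "slope_box R = cbox (\<chi> i. - R) (\<chi> i. R) \<times> (cbox (\<chi> i. - R) (\<chi> i. R) :: (real ^ 'n) set)"
    by (auto simp: slope_box_def mem_box_cart abs_le_iff minus_le_iff)
  then show ?thesis by (simp add: compact_Times)
qed

lemma tangent_below_convex:
  fixes f :: "'a::real_normed_vector \<Rightarrow> real"
  assumes "convex_on UNIV f" and f': "(f has_derivative f') (at x)"
  shows "f y \<ge> f x + f' (y - x)"
proof -
  have "f' (y - x) \<le> f y - f x"
  proof (rule derivative_le_from_increments[OF f' zero_less_one])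
    fix s :: real assume s: "0 < s" "s \<le> 1"
    have "f ((1 - s) *\<^sub>R x + s *\<^sub>R y) \<le> (1 - s) * f x + s * f y"
      using s by (intro convex_onD[OF assms(1)]) auto
    then show "f (x + s *\<^sub>R (y - x)) \<le> f x + s * (f y - f x)" by (simp add: algebra_simps)
  qed
  then show ?thesis by simp
qed

lemma pair_coordinates:
  assumes "linear f"
  shows "f (p, q) = (\<Sum>i\<in>UNIV. p $ i * f (axis i 1, 0)) + (\<Sum>i\<in>UNIV. q $ i * f (0, axis i (1::real)) :: real)"
proof -
  interpret linear f by fact
  have "(p, q) = (\<Sum>i\<in>UNIV. p $ i *\<^sub>R (axis i 1, 0)) + (\<Sum>i\<in>UNIV. q $ i *\<^sub>R (0, axis i 1))"
    using basis_expansion[of p] basis_expansion[of q]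
    by (simp add: prod_eq_iff fst_sum snd_sum scalar_mult_eq_scaleR)
  then have "f (p, q) = f ((\<Sum>i\<in>UNIV. p $ i *\<^sub>R (axis i 1, 0)) + (\<Sum>i\<in>UNIV. q $ i *\<^sub>R (0, axis i 1)))"
    by (simp only:)
  then show ?thesis by (simp only: add sum scale real_scaleR_def)
qed

text \<open>
  In this form the inequality compares \<open>v\<close> with a combination of two of its translates at the same
  point \<open>w\<close>, which suits operators that commute with translations.
\<close>

lemma semiconcave_iff_centred:
  fixes v :: "real ^ 'n \<Rightarrow> real"
  shows "semiconcave K v \<longleftrightarrow> K > 0 \<and> (\<forall>w z. \<forall>l\<in>{0<..<1}.
     l * v (w + (1 - l) *\<^sub>R z) + (1 - l) * v (w - l *\<^sub>R z) \<le> v w + l * (1 - l) * K * (norm z)\<^sup>2)"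
  (is "_ \<longleftrightarrow> _ \<and> ?C")
proof -
  have "?C" if K: "semiconcave K v"
  proof (intro allI ballI)
    fix w z :: "real ^ 'n" and l :: real assume l: "l \<in> {0<..<1}"
    have "l *\<^sub>R (w + (1 - l) *\<^sub>R z) + (1 - l) *\<^sub>R (w - l *\<^sub>R z) = w" by (simp add: algebra_simps)
    moreover have "w + (1 - l) *\<^sub>R z - (w - l *\<^sub>R z) = z" by (simp add: algebra_simps)
    ultimately show "l * v (w + (1 - l) *\<^sub>R z) + (1 - l) * v (w - l *\<^sub>R z) \<le> v w + l * (1 - l) * K * (norm z)\<^sup>2"
      using K[unfolded semiconcave_def, THEN conjunct2, rule_format, OF l, of "w + (1 - l) *\<^sub>R z" "w - l *\<^sub>R z"]
      by simp
  qed
  moreover have "semiconcave K v" if "K > 0" and C: "?C"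
    unfolding semiconcave_def
  proof (intro conjI allI ballI)
    fix x y :: "real ^ 'n" and l :: real assume l: "l \<in> {0<..<1}"
    let ?w = "l *\<^sub>R x + (1 - l) *\<^sub>R y"
    have "?w + (1 - l) *\<^sub>R (x - y) = x" "?w - l *\<^sub>R (x - y) = y" by (simp_all add: algebra_simps)
    then show "l * v x + (1 - l) * v y - l * (1 - l) * K * (norm (x - y))\<^sup>2 \<le> v ?w"
      using C[rule_format, OF l, of ?w "x - y"] by simp
  qed fact
  ultimately show ?thesis unfolding semiconcave_def by blast
qed

context
  fixes F :: "(real ^ 'n) \<times> (real ^ 'n) \<Rightarrow> real" and F' h dt R
  assumes F': "\<And>\<zeta>. (F has_derivative blinfun_apply (F' \<zeta>)) (at \<zeta>)" and contF': "continuous_on UNIV F'"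
    and h: "h > 0" and dt: "dt > 0" and mono: "monotonicity_condition F R h dt"
begin

text \<open>
  The monotonicity condition restricted to one grid value: the update is then \<open>\<phi> s\<close>, and moving that
  value moves the slopes along a line with direction \<open>v\<close>.
\<close>

lemma derivative_sign_from_mono:
  assumes mono: "mono_on A \<phi>" and \<phi>: "\<And>s. \<phi> s = k * s - dt * F (\<zeta> + (m * (s - y)) *\<^sub>R v)"
    and S: "open S" "y \<in> S" "S \<subseteq> A"
  shows "dt * (m * blinfun_apply (F' \<zeta>) v) \<le> k"
proof -
  have "((\<lambda>s. \<zeta> + (m * (s - y)) *\<^sub>R v) has_derivative (\<lambda>t. (m * t) *\<^sub>R v)) (at y)"
    by (auto intro!: derivative_eq_intros)
  from has_derivative_compose[OF this F']
  have "((\<lambda>s. F (\<zeta> + (m * (s - y)) *\<^sub>R v)) has_real_derivative m * blinfun_apply (F' \<zeta>) v) (at y)"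
    unfolding has_field_derivative_def
    by (rule has_derivative_eq_rhs) (simp add: fun_eq_iff blinfun.scaleR_right)
  then have "((\<lambda>s. k * s - dt * F (\<zeta> + (m * (s - y)) *\<^sub>R v)) has_real_derivative
      k * 1 - dt * (m * blinfun_apply (F' \<zeta>) v)) (at y)"
    by (intro DERIV_diff DERIV_cmult DERIV_ident)
  moreover have "mono_on A (\<lambda>s. k * s - dt * F (\<zeta> + (m * (s - y)) *\<^sub>R v))"
    using mono \<phi> by (simp add: mono_on_def)
  moreover have "y \<in> interior A" using S by (metis interior_maximal subsetD)
  ultimately have "0 \<le> k * 1 - dt * (m * blinfun_apply (F' \<zeta>) v)" by (intro mono_on_imp_deriv_nonneg)
  then show ?thesis by simp
qed

lemma derivative_signs_interior:
  assumes P: "\<And>i. \<bar>P $ i\<bar> < R" and Q: "\<And>i. \<bar>Q $ i\<bar> < R"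
  shows "blinfun_apply (F' (P, Q)) (axis i 1, 0) \<ge> 0"
    and "blinfun_apply (F' (P, Q)) (0, axis i 1) \<ge> 0"
    and "dt / h * blinfun_apply (F' (P, Q)) (\<chi> i. 1, \<chi> i. 1) \<le> 1"
proof -
  \<comment> \<open>Grid values with central value \<open>0\<close> that realise the slopes \<open>(P, Q)\<close>.\<close>
  define a where "a = (\<chi> i. - h * P $ i)"
  define b where "b = (\<chi> i. - h * Q $ i)"
  have slope: "\<bar>s / h\<bar> \<le> R" if "s \<in> {- R * h<..<R * h}" for s
    using that h by (auto simp: abs_le_iff field_simps)
  have neighbour: "- h * p \<in> {- R * h<..<R * h}" if "\<bar>p\<bar> < R" for p
  proof -
    have "h * p < h * R" "h * (- p) < h * R" using that h by (auto simp only: mult_less_cancel_left_pos abs_less_iff)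
    then show ?thesis by (simp add: mult.commute)
  qed
  note mono' = mono[unfolded monotonicity_condition_def]
  have nonneg: "0 \<le> d" if "dt * (- 1 / h * d) \<le> 0" for d
    using that dt h by (simp add: zero_le_mult_iff zero_le_divide_iff)
  show "blinfun_apply (F' (P, Q)) (axis i 1, 0) \<ge> 0"
  proof (rule nonneg, rule derivative_sign_from_mono[where S = "{- R * h<..<R * h}" and y = "- h * P $ i"])
    show "mono_on {s. slopes_bounded R h 0 (\<chi> j. if j = i then s else a $ j) b}
        (\<lambda>s. update_op F h dt 0 (\<chi> j. if j = i then s else a $ j) b)"
      using mono' by blast
    fix s
    have "- fwd_slope h 0 (\<chi> j. if j = i then s else a $ j) = P + (- 1 / h * (s - (- h * P $ i))) *\<^sub>R axis i 1"
      using h by (auto simp: vec_eq_iff fwd_slope_def a_def axis_def field_simps)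
    moreover have "bwd_slope h 0 b = Q" using h by (auto simp: vec_eq_iff bwd_slope_def b_def)
    ultimately show "update_op F h dt 0 (\<chi> j. if j = i then s else a $ j) b
        = 0 * s - dt * F ((P, Q) + (- 1 / h * (s - (- h * P $ i))) *\<^sub>R (axis i 1, 0))"
      by (simp add: update_op_def)
  next
    have "fwd_slope h 0 (\<chi> j. if j = i then s else a $ j) $ k = (if k = i then s / h else - P $ k)"
      and "bwd_slope h 0 b $ k = Q $ k" for s k
      using h by (auto simp: fwd_slope_def bwd_slope_def a_def b_def)
    then show "{- R * h<..<R * h} \<subseteq> {s. slopes_bounded R h 0 (\<chi> j. if j = i then s else a $ j) b}"
      using slope P Q unfolding slopes_bounded_def by (auto simp: less_imp_le)
  qed (use neighbour[OF P] in auto)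
  show "blinfun_apply (F' (P, Q)) (0, axis i 1) \<ge> 0"
  proof (rule nonneg, rule derivative_sign_from_mono[where S = "{- R * h<..<R * h}" and y = "- h * Q $ i"])
    show "mono_on {s. slopes_bounded R h 0 a (\<chi> j. if j = i then s else b $ j)}
        (\<lambda>s. update_op F h dt 0 a (\<chi> j. if j = i then s else b $ j))"
      using mono' by blast
    fix s
    have "bwd_slope h 0 (\<chi> j. if j = i then s else b $ j) = Q + (- 1 / h * (s - (- h * Q $ i))) *\<^sub>R axis i 1"
      using h by (auto simp: vec_eq_iff bwd_slope_def b_def axis_def field_simps)
    moreover have "- fwd_slope h 0 a = P" using h by (auto simp: vec_eq_iff fwd_slope_def a_def)
    ultimately show "update_op F h dt 0 a (\<chi> j. if j = i then s else b $ j)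
        = 0 * s - dt * F ((P, Q) + (- 1 / h * (s - (- h * Q $ i))) *\<^sub>R (0, axis i 1))"
      by (simp add: update_op_def)
  next
    have "bwd_slope h 0 (\<chi> j. if j = i then s else b $ j) $ k = (if k = i then - (s / h) else Q $ k)"
      and "fwd_slope h 0 a $ k = - P $ k" for s k
      using h by (auto simp: fwd_slope_def bwd_slope_def a_def b_def)
    then show "{- R * h<..<R * h} \<subseteq> {s. slopes_bounded R h 0 a (\<chi> j. if j = i then s else b $ j)}"
      using slope P Q unfolding slopes_bounded_def by (auto simp: less_imp_le)
  qed (use neighbour[OF Q] in auto)
  have "dt * (1 / h * blinfun_apply (F' (P, Q)) (\<chi> i. 1, \<chi> i. 1)) \<le> 1"
  proof (rule derivative_sign_from_mono[where y = 0])
    show "mono_on {s. slopes_bounded R h s a b} (\<lambda>s. update_op F h dt s a b)" using mono' by blast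
    fix s
    have slopes: "- fwd_slope h s a = P + (s / h) *\<^sub>R (\<chi> i. 1)" "bwd_slope h s b = Q + (s / h) *\<^sub>R (\<chi> i. 1)" for s
      using h by (auto simp: vec_eq_iff fwd_slope_def bwd_slope_def a_def b_def field_simps)
    then show "update_op F h dt s a b = 1 * s - dt * F ((P, Q) + (1 / h * (s - 0)) *\<^sub>R (\<chi> i. 1, \<chi> i. 1))"
      by (simp add: update_op_def)
    let ?S = "\<Inter>i\<in>UNIV. {s. \<bar>P $ i + s / h\<bar> < R} \<inter> {s. \<bar>Q $ i + s / h\<bar> < R}"
    show "open ?S"
      by (intro open_INT ballI open_Int open_Collect_less continuous_intros) (use h in auto)
    show "0 \<in> ?S" using P Q by auto
    have "\<bar>fwd_slope h s a $ i\<bar> = \<bar>P $ i + s / h\<bar>" "\<bar>bwd_slope h s b $ i\<bar> = \<bar>Q $ i + s / h\<bar>" for s i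
      using arg_cong[OF slopes(1)[of s], of "\<lambda>v. \<bar>v $ i\<bar>"] arg_cong[OF slopes(2)[of s], of "\<lambda>v. \<bar>v $ i\<bar>"] by simp_all
    then show "?S \<subseteq> {s. slopes_bounded R h s a b}"
      unfolding slopes_bounded_def by (auto intro: less_imp_le)
  qed
  then show "dt / h * blinfun_apply (F' (P, Q)) (\<chi> i. 1, \<chi> i. 1) \<le> 1" by simp
qed

text \<open>
  At a corner of the box the condition in the central value is void, as no other central value is
  admissible.  The signs on the closed box therefore follow from those inside by continuity.
\<close>

lemma derivative_signs:
  assumes R: "R > 0" and \<zeta>: "\<zeta> \<in> slope_box R"
  shows "blinfun_apply (F' \<zeta>) (axis i 1, 0) \<ge> 0"
    and "blinfun_apply (F' \<zeta>) (0, axis i 1) \<ge> 0"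
    and "dt / h * blinfun_apply (F' \<zeta>) (\<chi> i. 1, \<chi> i. 1) \<le> 1"
proof -
  have cl: "closure {0..<1} = {0..1::real}" by simp
  have cont: "continuous_on (closure {0..<1}) (\<lambda>s. blinfun_apply (F' (s *\<^sub>R \<zeta>)) v)" for v
    by (intro continuous_intros continuous_on_compose2[OF contF']) auto
  have int: "\<bar>fst (s *\<^sub>R \<zeta>) $ i\<bar> < R" "\<bar>snd (s *\<^sub>R \<zeta>) $ i\<bar> < R" if s: "s \<in> {0..<1}" for s i
  proof -
    have "s * \<bar>p\<bar> < R" if "\<bar>p\<bar> \<le> R" for p
    proof -
      have "s * \<bar>p\<bar> \<le> s * R" using s that by (intro mult_left_mono) auto
      also have "\<dots> < R" using s R by simp
      finally show ?thesis .
    qed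
    then show "\<bar>fst (s *\<^sub>R \<zeta>) $ i\<bar> < R" "\<bar>snd (s *\<^sub>R \<zeta>) $ i\<bar> < R"
      using \<zeta> s by (auto simp: slope_box_def abs_mult)
  qed
  note interior = derivative_signs_interior[of "fst (s *\<^sub>R \<zeta>)" "snd (s *\<^sub>R \<zeta>)" for s, unfolded prod.collapse, OF int]
  have 1: "1 \<in> closure {0..<1::real}" by simp
  show "blinfun_apply (F' \<zeta>) (axis i 1, 0) \<ge> 0"
    using continuous_ge_on_closure[OF cont 1, of 0] interior(1) by simp
  show "blinfun_apply (F' \<zeta>) (0, axis i 1) \<ge> 0"
    using continuous_ge_on_closure[OF cont 1, of 0] interior(2) by simp
  have "continuous_on (closure {0..<1}) (\<lambda>s. dt / h * blinfun_apply (F' (s *\<^sub>R \<zeta>)) (\<chi> i. 1, \<chi> i. 1))"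
    by (intro continuous_intros cont)
  from continuous_le_on_closure[OF this 1, of 1] show "dt / h * blinfun_apply (F' \<zeta>) (\<chi> i. 1, \<chi> i. 1) \<le> 1"
    using interior(3) by simp
qed

lemma derivative_sum_le:
  assumes "R > 0" "\<zeta> \<in> slope_box R"
  shows "(\<Sum>i\<in>UNIV. blinfun_apply (F' \<zeta>) (axis i 1, 0)) + (\<Sum>i\<in>UNIV. blinfun_apply (F' \<zeta>) (0, axis i 1)) \<le> h / dt"
proof -
  have "blinfun_apply (F' \<zeta>) (\<chi> i. 1, \<chi> i. 1)
      = (\<Sum>i\<in>UNIV. blinfun_apply (F' \<zeta>) (axis i 1, 0)) + (\<Sum>i\<in>UNIV. blinfun_apply (F' \<zeta>) (0, axis i 1))"
    by (subst pair_coordinates) (auto intro: bounded_linear.linear[OF blinfun.bounded_linear_right])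
  then show ?thesis using derivative_signs(3)[OF assms] h dt by (simp add: field_simps)
qed

text \<open>
  By convexity the tangent of \<open>F\<close> at the slopes of the larger function \<open>v2\<close> bounds the difference
  of the two numerical fluxes from below, so the signs of the derivatives at this single point suffice.
\<close>

lemma scheme_step_mono:
  assumes conv: "convex_on UNIV F" and R: "R > 0"
    and box: "(- fwd_diff h v2 x, bwd_diff h v2 x) \<in> slope_box R"
    and le: "\<And>y. v1 y \<le> v2 y"
  shows "scheme_step F h dt v1 x \<le> scheme_step F h dt v2 x"
proof -
  define \<xi>1 where "\<xi>1 = (- fwd_diff h v1 x, bwd_diff h v1 x)"
  define \<xi>2 where "\<xi>2 = (- fwd_diff h v2 x, bwd_diff h v2 x)"
  define A where "A i = blinfun_apply (F' \<xi>2) (axis i 1, 0)" for i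
  define B where "B i = blinfun_apply (F' \<xi>2) (0, axis i 1)" for i
  define d where "d y = v2 y - v1 y" for y
  have d0: "d y \<ge> 0" for y using le by (simp add: d_def)
  have AB: "A i \<ge> 0" "B i \<ge> 0" for i
    using derivative_signs[OF R box] unfolding A_def B_def \<xi>2_def by auto
  have sumAB: "(\<Sum>i\<in>UNIV. A i) + (\<Sum>i\<in>UNIV. B i) \<le> h / dt"
    using derivative_sum_le[OF R box] unfolding A_def B_def \<xi>2_def .
  have "F \<xi>1 \<ge> F \<xi>2 + blinfun_apply (F' \<xi>2) (\<xi>1 - \<xi>2)" by (rule tangent_below_convex[OF conv F'])
  moreover have "blinfun_apply (F' \<xi>2) (\<xi>1 - \<xi>2)
      = (\<Sum>i\<in>UNIV. (d (x + h *\<^sub>R axis i 1) - d x) / h * A i) + (\<Sum>i\<in>UNIV. (d (x - h *\<^sub>R axis i 1) - d x) / h * B i)"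
  proof -
    have eq: "\<xi>1 - \<xi>2 = (\<chi> i. (d (x + h *\<^sub>R axis i 1) - d x) / h, \<chi> i. (d (x - h *\<^sub>R axis i 1) - d x) / h)"
      by (auto simp: \<xi>1_def \<xi>2_def vec_eq_iff fwd_diff_def bwd_diff_def fwd_slope_def bwd_slope_def d_def diff_divide_distrib)
    show ?thesis unfolding A_def B_def eq
      by (subst pair_coordinates) (simp_all add: bounded_linear.linear[OF blinfun.bounded_linear_right])
  qed
  moreover have "(\<Sum>i\<in>UNIV. (d (x + h *\<^sub>R axis i 1) - d x) / h * A i) \<ge> (\<Sum>i\<in>UNIV. - (d x) / h * A i)"
    using AB d0 h by (intro sum_mono mult_right_mono divide_right_mono) auto
  moreover have "(\<Sum>i\<in>UNIV. (d (x - h *\<^sub>R axis i 1) - d x) / h * B i) \<ge> (\<Sum>i\<in>UNIV. - (d x) / h * B i)"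
    using AB d0 h by (intro sum_mono mult_right_mono divide_right_mono) auto
  ultimately have "F \<xi>1 - F \<xi>2 \<ge> - (d x) / h * ((\<Sum>i\<in>UNIV. A i) + (\<Sum>i\<in>UNIV. B i))"
    unfolding sum_distrib_left[symmetric] distrib_left by linarith
  moreover have "- (d x) / h * ((\<Sum>i\<in>UNIV. A i) + (\<Sum>i\<in>UNIV. B i)) \<ge> - (d x) / h * (h / dt)"
    using sumAB d0 h by (intro mult_left_mono_neg) auto
  ultimately have "F \<xi>1 - F \<xi>2 \<ge> - (d x) / dt" using h by simp
  then have "dt * (F \<xi>1 - F \<xi>2) \<ge> - d x" using dt by (simp add: field_simps)
  then show ?thesis unfolding scheme_step_def \<xi>1_def[symmetric] \<xi>2_def[symmetric] d_def
    by (simp add: algebra_simps)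
qed

text \<open>
  The translate of \<open>v\<close> by \<open>z\<close> is compared with \<open>v + c\<close>.  Suitable \<open>z\<close> and \<open>c\<close> give Lipschitz
  bounds, slope bounds and periodicity.
\<close>

lemma scheme_step_le_shift:
  assumes conv: "convex_on UNIV F" and R: "R > 0"
    and slopes: "discrete_slopes_bounded R h v" and le: "\<And>x. v (x + z) \<le> v x + c"
  shows "scheme_step F h dt v (x + z) \<le> scheme_step F h dt v x + c"
proof -
  define v1 where "v1 y = v (y + z)" for y
  define v2 where "v2 y = v y + c" for y
  have D2: "fwd_diff h v2 = fwd_diff h v" "bwd_diff h v2 = bwd_diff h v"
    by (auto simp: fun_eq_iff v2_def fwd_diff_def bwd_diff_def fwd_slope_def bwd_slope_def vec_eq_iff)
  have "scheme_step F h dt v1 x \<le> scheme_step F h dt v2 x"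
  proof (rule scheme_step_mono[OF conv R])
    show "(- fwd_diff h v2 x, bwd_diff h v2 x) \<in> slope_box R"
      using slopes unfolding D2 slope_box_def discrete_slopes_bounded_def by simp
    show "v1 y \<le> v2 y" for y using le by (simp add: v1_def v2_def)
  qed
  moreover have "scheme_step F h dt v1 x = scheme_step F h dt v (x + z)"
    by (simp add: scheme_step_def v1_def fwd_diff_def bwd_diff_def algebra_simps)
  moreover have "scheme_step F h dt v2 x = scheme_step F h dt v x + c"
    unfolding scheme_step_def D2 by (simp add: v2_def)
  ultimately show ?thesis by simp
qed

lemma discrete_slopes_bounded_iff:
  "discrete_slopes_bounded R h v \<longleftrightarrow> (\<forall>x i. \<bar>v (x + h *\<^sub>R axis i 1) - v x\<bar> \<le> R * h)"
proof -
  have "discrete_slopes_bounded R h v \<longleftrightarrow>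
      (\<forall>x i. \<bar>v (x + h *\<^sub>R axis i 1) - v x\<bar> \<le> R * h \<and> \<bar>v x - v (x - h *\<^sub>R axis i 1)\<bar> \<le> R * h)"
    using h unfolding discrete_slopes_bounded_def
    by (simp add: fwd_diff_def bwd_diff_def fwd_slope_def bwd_slope_def abs_divide divide_le_eq)
  moreover have "\<bar>v x - v (x - h *\<^sub>R axis i 1)\<bar> \<le> R * h"
    if "\<forall>x i. \<bar>v (x + h *\<^sub>R axis i 1) - v x\<bar> \<le> R * h" for x i
    using that[rule_format, of "x - h *\<^sub>R axis i 1" i] by simp
  ultimately show ?thesis by blast
qed

lemma scheme_step_slopes:
  assumes conv: "convex_on UNIV F" and R: "R > 0" and slopes: "discrete_slopes_bounded R h v"
  shows "discrete_slopes_bounded R h (scheme_step F h dt v)"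
  unfolding discrete_slopes_bounded_iff
proof (intro allI)
  fix x :: "real ^ 'n" and i
  have b: "\<bar>v (x + h *\<^sub>R axis i 1) - v x\<bar> \<le> R * h" for x
    using slopes unfolding discrete_slopes_bounded_iff by blast
  have up: "v (x + h *\<^sub>R axis i 1) \<le> v x + R * h" for x using b[of x] by (simp add: abs_le_iff)
  have down: "v (x + - (h *\<^sub>R axis i 1)) \<le> v x + R * h" for x
    using b[of "x - h *\<^sub>R axis i 1"] by (simp add: abs_le_iff)
  show "\<bar>scheme_step F h dt v (x + h *\<^sub>R axis i 1) - scheme_step F h dt v x\<bar> \<le> R * h"
    using scheme_step_le_shift[OF conv R slopes up, of x]
      scheme_step_le_shift[OF conv R slopes down, of "x + h *\<^sub>R axis i 1"] by (simp add: abs_le_iff)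
qed

text \<open>
  The convexity of \<open>F\<close> makes a step of the scheme a concave operator: the step applied to the
  combination \<open>v1\<close> of two translates dominates the combination of the steps, and by monotonicity it
  is dominated by the step applied to \<open>v + c\<close>.
\<close>

lemma scheme_step_semiconcave:
  assumes conv: "convex_on UNIV F" and R: "R > 0"
    and slopes: "discrete_slopes_bounded R h v" and K: "semiconcave K v"
  shows "semiconcave K (scheme_step F h dt v)"
  unfolding semiconcave_iff_centred
proof (intro conjI allI ballI)
  show "K > 0" using K unfolding semiconcave_def by blast
  fix w z :: "real ^ 'n" and l :: real assume l: "l \<in> {0<..<1}"
  define c where "c = l * (1 - l) * K * (norm z)\<^sup>2"
  define v1 where "v1 y = l * v (y + (1 - l) *\<^sub>R z) + (1 - l) * v (y - l *\<^sub>R z)" for y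
  define v2 where "v2 y = v y + c" for y
  let ?\<xi> = "\<lambda>y. (- fwd_diff h v y, bwd_diff h v y)"
  have D2: "fwd_diff h v2 = fwd_diff h v" "bwd_diff h v2 = bwd_diff h v"
    by (auto simp: fun_eq_iff v2_def fwd_diff_def bwd_diff_def fwd_slope_def bwd_slope_def vec_eq_iff)
  have "scheme_step F h dt v1 w \<le> scheme_step F h dt v2 w"
  proof (rule scheme_step_mono[OF conv R])
    show "(- fwd_diff h v2 w, bwd_diff h v2 w) \<in> slope_box R"
      using slopes unfolding D2 slope_box_def discrete_slopes_bounded_def by simp
    show "v1 y \<le> v2 y" for y
      using K[unfolded semiconcave_iff_centred, THEN conjunct2, rule_format, OF l, of y z]
      by (simp add: v1_def v2_def c_def)
  qed
  moreover have "scheme_step F h dt v2 w = scheme_step F h dt v w + c"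
    unfolding scheme_step_def D2 by (simp add: v2_def)
  moreover have "l * scheme_step F h dt v (w + (1 - l) *\<^sub>R z) + (1 - l) * scheme_step F h dt v (w - l *\<^sub>R z)
      \<le> scheme_step F h dt v1 w"
  proof -
    have "(- fwd_diff h v1 w, bwd_diff h v1 w)
        = l *\<^sub>R ?\<xi> (w + (1 - l) *\<^sub>R z) + (1 - l) *\<^sub>R ?\<xi> (w - l *\<^sub>R z)"
      using h by (auto simp: v1_def fwd_diff_def bwd_diff_def fwd_slope_def bwd_slope_def vec_eq_iff field_simps)
    moreover have "F (l *\<^sub>R ?\<xi> (w + (1 - l) *\<^sub>R z) + (1 - l) *\<^sub>R ?\<xi> (w - l *\<^sub>R z))
        \<le> l * F (?\<xi> (w + (1 - l) *\<^sub>R z)) + (1 - l) * F (?\<xi> (w - l *\<^sub>R z))"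
      using convex_onD[OF conv, of "1 - l" "?\<xi> (w + (1 - l) *\<^sub>R z)" "?\<xi> (w - l *\<^sub>R z)"] l by simp
    ultimately have "dt * F (- fwd_diff h v1 w, bwd_diff h v1 w)
        \<le> dt * (l * F (?\<xi> (w + (1 - l) *\<^sub>R z)) + (1 - l) * F (?\<xi> (w - l *\<^sub>R z)))"
      using dt by (intro mult_left_mono) (auto simp only: less_imp_le)
    then show ?thesis unfolding scheme_step_def by (simp add: v1_def algebra_simps)
  qed
  ultimately show "l * scheme_step F h dt v (w + (1 - l) *\<^sub>R z) + (1 - l) * scheme_step F h dt v (w - l *\<^sub>R z)
      \<le> scheme_step F h dt v w + l * (1 - l) * K * (norm z)\<^sup>2"
    unfolding c_def by linarith
qed

lemma scheme_slopes:
  assumes "convex_on UNIV F" "R > 0" "discrete_slopes_bounded R h g"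
  shows "discrete_slopes_bounded R h (scheme F g h dt n)"
proof (induction n)
  case 0 then show ?case using assms by simp
next
  case (Suc n) then show ?case unfolding scheme_Suc using assms by (intro scheme_step_slopes)
qed

lemma scheme_le_shift:
  assumes "convex_on UNIV F" "R > 0" "discrete_slopes_bounded R h g" "\<And>x. g (x + z) \<le> g x + c"
  shows "scheme F g h dt n (x + z) \<le> scheme F g h dt n x + c"
proof (induction n arbitrary: x)
  case 0 then show ?case using assms by simp
next
  case (Suc n)
  then show ?case unfolding scheme_Suc by (intro scheme_step_le_shift scheme_slopes assms)
qed

lemma scheme_semiconcave:
  assumes "convex_on UNIV F" "R > 0" "discrete_slopes_bounded R h g" "semiconcave K g"
  shows "semiconcave K (scheme F g h dt n)"
proof (induction n)
  case 0 then show ?case using assms by simp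
next
  case (Suc n)
  then show ?case unfolding scheme_Suc by (intro scheme_step_semiconcave scheme_slopes assms)
qed

end

section \<open>Controls given by the numerical Hamiltonian\<close>

text \<open>
  The affine function \<open>(P, Q) \<mapsto> \<alpha> \<bullet> P + \<beta> \<bullet> Q - l\<close> lies below \<open>F\<close>; on the diagonal \<open>(- p, p)\<close> it is
  \<open>p \<bullet> (\<beta> - \<alpha>) - l\<close>, so that \<open>\<beta> - \<alpha>\<close> is a velocity and \<open>l\<close> a cost for the Hamiltonian \<open>F (- p, p)\<close>.
  The numbers \<open>dt / h * \<alpha>\<^sub>i\<close> and \<open>dt / h * \<beta>\<^sub>i\<close> are the probabilities of jumps to the neighbours
  \<open>x + h e\<^sub>i\<close> and \<open>x - h e\<^sub>i\<close>, and \<open>a \<le> h / dt\<close> makes their sum at most \<open>1\<close>.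
\<close>

definition controls :: "((real ^ 'n) \<times> (real ^ 'n) \<Rightarrow> real) \<Rightarrow> real \<Rightarrow> ((real ^ 'n) \<times> real) set" where
  "controls F a = {(\<beta> - \<alpha>, l) | \<alpha> \<beta> l. (\<forall>i. 0 \<le> \<alpha> $ i \<and> 0 \<le> \<beta> $ i) \<and>
     (\<Sum>i\<in>UNIV. \<alpha> $ i) + (\<Sum>i\<in>UNIV. \<beta> $ i) \<le> a \<and> (\<forall>P Q. \<alpha> \<bullet> P + \<beta> \<bullet> Q \<le> F (P, Q) + l)}"

lemma convex_controls: "convex (controls F a)"
proof (rule convexI)
  fix c1 c2 and s t :: real assume c: "c1 \<in> controls F a" "c2 \<in> controls F a" and st: "0 \<le> s" "0 \<le> t" "s + t = 1"
  obtain \<alpha>1 \<beta>1 l1 where c1: "c1 = (\<beta>1 - \<alpha>1, l1)" "\<And>i. 0 \<le> \<alpha>1 $ i" "\<And>i. 0 \<le> \<beta>1 $ i"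
      "(\<Sum>i\<in>UNIV. \<alpha>1 $ i) + (\<Sum>i\<in>UNIV. \<beta>1 $ i) \<le> a" "\<And>P Q. \<alpha>1 \<bullet> P + \<beta>1 \<bullet> Q \<le> F (P, Q) + l1"
    using c(1) unfolding controls_def by auto
  obtain \<alpha>2 \<beta>2 l2 where c2: "c2 = (\<beta>2 - \<alpha>2, l2)" "\<And>i. 0 \<le> \<alpha>2 $ i" "\<And>i. 0 \<le> \<beta>2 $ i"
      "(\<Sum>i\<in>UNIV. \<alpha>2 $ i) + (\<Sum>i\<in>UNIV. \<beta>2 $ i) \<le> a" "\<And>P Q. \<alpha>2 \<bullet> P + \<beta>2 \<bullet> Q \<le> F (P, Q) + l2"
    using c(2) unfolding controls_def by auto
  let ?\<alpha> = "s *\<^sub>R \<alpha>1 + t *\<^sub>R \<alpha>2" and ?\<beta> = "s *\<^sub>R \<beta>1 + t *\<^sub>R \<beta>2" and ?l = "s * l1 + t * l2"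
  have "s *\<^sub>R c1 + t *\<^sub>R c2 = (?\<beta> - ?\<alpha>, ?l)" by (simp add: c1(1) c2(1) algebra_simps)
  moreover have "0 \<le> ?\<alpha> $ i" "0 \<le> ?\<beta> $ i" for i using c1(2,3) c2(2,3) st by auto
  moreover have "(\<Sum>i\<in>UNIV. ?\<alpha> $ i) + (\<Sum>i\<in>UNIV. ?\<beta> $ i) \<le> a"
  proof -
    have "(\<Sum>i\<in>UNIV. ?\<alpha> $ i) + (\<Sum>i\<in>UNIV. ?\<beta> $ i)
        = s * ((\<Sum>i\<in>UNIV. \<alpha>1 $ i) + (\<Sum>i\<in>UNIV. \<beta>1 $ i)) + t * ((\<Sum>i\<in>UNIV. \<alpha>2 $ i) + (\<Sum>i\<in>UNIV. \<beta>2 $ i))"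
      by (simp add: sum.distrib sum_distrib_left[symmetric] algebra_simps)
    also have "\<dots> \<le> s * a + t * a" using c1(4) c2(4) st by (intro add_mono mult_left_mono)
    also have "\<dots> = a" using st by (simp add: distrib_right[symmetric])
    finally show ?thesis .
  qed
  moreover have "?\<alpha> \<bullet> P + ?\<beta> \<bullet> Q \<le> F (P, Q) + ?l" for P Q
  proof -
    have "?\<alpha> \<bullet> P + ?\<beta> \<bullet> Q = s * (\<alpha>1 \<bullet> P + \<beta>1 \<bullet> Q) + t * (\<alpha>2 \<bullet> P + \<beta>2 \<bullet> Q)"
      by (simp add: inner_simps algebra_simps)
    also have "\<dots> \<le> s * (F (P, Q) + l1) + t * (F (P, Q) + l2)"
      by (intro add_mono[OF mult_left_mono[OF c1(5) st(1)] mult_left_mono[OF c2(5) st(2)]])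
    also have "\<dots> = (s + t) * F (P, Q) + ?l" by (simp add: algebra_simps)
    finally show ?thesis using st by simp
  qed
  ultimately show "s *\<^sub>R c1 + t *\<^sub>R c2 \<in> controls F a" unfolding controls_def by blast
qed

lemma controls_speed:
  assumes "c \<in> controls F a"
  shows "norm (fst c) \<le> a"
proof -
  obtain \<alpha> \<beta> l where c: "c = (\<beta> - \<alpha>, l)" "\<And>i. 0 \<le> \<alpha> $ i" "\<And>i. 0 \<le> \<beta> $ i"
      "(\<Sum>i\<in>UNIV. \<alpha> $ i) + (\<Sum>i\<in>UNIV. \<beta> $ i) \<le> a"
    using assms unfolding controls_def by auto
  have "norm (\<beta> - \<alpha>) \<le> (\<Sum>i\<in>UNIV. \<bar>(\<beta> - \<alpha>) $ i\<bar>)" by (rule norm_le_l1_cart)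
  also have "\<dots> \<le> (\<Sum>i\<in>UNIV. \<alpha> $ i + \<beta> $ i)"
  proof (rule sum_mono)
    fix i show "\<bar>(\<beta> - \<alpha>) $ i\<bar> \<le> \<alpha> $ i + \<beta> $ i" using c(2)[of i] c(3)[of i] by simp
  qed
  also have "\<dots> \<le> a" using c(4) by (simp add: sum.distrib)
  finally show ?thesis by (simp add: c(1))
qed

lemma controls_fenchel:
  assumes "c \<in> controls F a"
  shows "p \<bullet> fst c \<le> F (- p, p) + snd c"
proof -
  obtain \<alpha> \<beta> l where c: "c = (\<beta> - \<alpha>, l)" "\<And>P Q. \<alpha> \<bullet> P + \<beta> \<bullet> Q \<le> F (P, Q) + l"
    using assms unfolding controls_def by auto
  show ?thesis using c(2)[of "- p" p] by (simp add: c(1) inner_simps inner_commute)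
qed

lemma controls_cost:
  assumes "c \<in> controls F a"
  shows "snd c \<ge> - F (0, 0)"
  using controls_fenchel[OF assms, of 0] by simp

lemma sum_over_option:
  assumes "finite I"
  shows "(\<Sum>j\<in>insert None (Some ` I). k j) = k None + (\<Sum>i\<in>I. k (Some i))"
  using assms by (subst sum.insert) (auto simp: sum.reindex)

lemma sum_over_sum_type:
  fixes k :: "'a::finite + 'b::finite \<Rightarrow> 'c::comm_monoid_add"
  shows "(\<Sum>i\<in>UNIV. k i) = (\<Sum>i\<in>UNIV. k (Inl i)) + (\<Sum>i\<in>UNIV. k (Inr i))"
  unfolding UNIV_Plus_UNIV[symmetric] by (subst sum.Plus) (auto simp: o_def)

lemma convex_on_subconvex_combination:
  fixes f :: "'a::real_vector \<Rightarrow> real"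
  assumes f: "convex_on UNIV f" and I: "finite I" and w: "\<And>i. i \<in> I \<Longrightarrow> w i \<ge> 0" "sum w I \<le> 1"
  shows "f (\<Sum>i\<in>I. w i *\<^sub>R y i) \<le> (\<Sum>i\<in>I. w i * f (y i)) + (1 - sum w I) * f 0"
proof -
  define J where "J = insert None (Some ` I)"
  define w' where "w' j = (case j of None \<Rightarrow> 1 - sum w I | Some i \<Rightarrow> w i)" for j
  define y' where "y' j = (case j of None \<Rightarrow> 0 | Some i \<Rightarrow> y i)" for j
  note sum_J = sum_over_option[OF I, folded J_def]
  have "f (\<Sum>j\<in>J. w' j *\<^sub>R y' j) \<le> (\<Sum>j\<in>J. w' j * f (y' j))"
  proof (rule convex_on_sum[OF _ _ f])
    show "sum w' J = 1" unfolding sum_J by (simp add: w'_def)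
    show "0 \<le> w' j" if "j \<in> J" for j using w that by (auto simp: w'_def J_def)
  qed (auto simp: J_def I)
  then show ?thesis unfolding sum_J by (simp add: w'_def y'_def)
qed

lemma semiconcave_imp_convex:
  assumes "semiconcave K v"
  shows "convex_on UNIV (\<lambda>k. K * (k \<bullet> k) - v (x + k))"
proof (rule convex_onI)
  fix t :: real and a b assume t: "0 < t" "t < 1"
  have "t * v (x + b) + (1 - t) * v (x + a) - t * (1 - t) * K * (norm ((x + b) - (x + a)))\<^sup>2
      \<le> v (t *\<^sub>R (x + b) + (1 - t) *\<^sub>R (x + a))"
    using assms[unfolded semiconcave_def, THEN conjunct2, rule_format, of t "x + b" "x + a"] t by simp
  moreover have "(x + b) - (x + a) = b - a" by simp
  moreover have "t *\<^sub>R (x + b) + (1 - t) *\<^sub>R (x + a) = x + ((1 - t) *\<^sub>R a + t *\<^sub>R b)"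
    by (simp add: algebra_simps)
  ultimately have 1: "t * v (x + b) + (1 - t) * v (x + a) - t * (1 - t) * K * (norm (b - a))\<^sup>2
      \<le> v (x + ((1 - t) *\<^sub>R a + t *\<^sub>R b))" by (simp only:)
  have 2: "((1 - t) *\<^sub>R a + t *\<^sub>R b) \<bullet> ((1 - t) *\<^sub>R a + t *\<^sub>R b)
      = (1 - t) * (a \<bullet> a) + t * (b \<bullet> b) - t * (1 - t) * (norm (b - a))\<^sup>2"
    by (simp add: power2_norm_eq_inner inner_simps inner_commute algebra_simps)
  show "K * (((1 - t) *\<^sub>R a + t *\<^sub>R b) \<bullet> ((1 - t) *\<^sub>R a + t *\<^sub>R b)) - v (x + ((1 - t) *\<^sub>R a + t *\<^sub>R b))
      \<le> (1 - t) * (K * (a \<bullet> a) - v (x + a)) + t * (K * (b \<bullet> b) - v (x + b))"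
    unfolding 2 using 1 by (simp add: algebra_simps)
qed simp

text \<open>
  Replacing \<open>F\<close> by the smaller affine function leaves an average of \<open>v\<close> over the stencil with mean
  \<open>x - dt q\<close>.  Jensen's inequality for the concave function \<open>v - K \<bar>\<cdot>\<bar>\<^sup>2\<close> bounds it by the value at the
  mean plus \<open>K\<close> times the variance, which is at most \<open>h\<^sup>2 * (dt / h) * a\<close>.
\<close>

lemma scheme_step_le_control:
  assumes K: "semiconcave K v" and c: "c \<in> controls F a" and h: "h > 0" and dt: "dt > 0" and a: "a \<le> h / dt"
  shows "scheme_step F h dt v x \<le> v (x - dt *\<^sub>R fst c) + dt * snd c + K * h * dt * a"
proof -
  obtain \<alpha> \<beta> l where c: "c = (\<beta> - \<alpha>, l)" "\<And>i. 0 \<le> \<alpha> $ i" "\<And>i. 0 \<le> \<beta> $ i"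
      "(\<Sum>i\<in>UNIV. \<alpha> $ i) + (\<Sum>i\<in>UNIV. \<beta> $ i) \<le> a" "\<And>P Q. \<alpha> \<bullet> P + \<beta> \<bullet> Q \<le> F (P, Q) + l"
    using c unfolding controls_def by auto
  \<comment> \<open>The jump probabilities, indexed by the forward neighbours (\<open>Inl\<close>) and the backward ones (\<open>Inr\<close>).\<close>
  define w where "w i = (dt / h) * (case i of Inl i \<Rightarrow> \<alpha> $ i | Inr i \<Rightarrow> \<beta> $ i)" for i
  define y where "y i = (case i of Inl i \<Rightarrow> h *\<^sub>R axis i 1 | Inr i \<Rightarrow> - (h *\<^sub>R axis i (1::real)))" for i :: "'a + 'a"
  define \<phi> where "\<phi> k = K * (k \<bullet> k) - v (x + k)" for k
  have sum_w: "sum w UNIV = dt / h * ((\<Sum>i\<in>UNIV. \<alpha> $ i) + (\<Sum>i\<in>UNIV. \<beta> $ i))"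
    unfolding sum_over_sum_type by (simp add: w_def sum_distrib_left distrib_left)
  have "sum w UNIV \<le> dt / h * a" unfolding sum_w using c(4) h dt by (intro mult_left_mono) auto
  moreover have "dt / h * a \<le> dt / h * (h / dt)" using a h dt by (intro mult_left_mono) auto
  moreover have "dt / h * (h / dt) = 1" using h dt by simp
  ultimately have w1: "sum w UNIV \<le> 1" and w2: "sum w UNIV \<le> dt / h * a" by linarith+
  have w0: "w i \<ge> 0" for i using c(2,3) h dt by (auto simp: w_def split: sum.split)
  have K0: "K > 0" using K unfolding semiconcave_def by auto
  have mean: "(\<Sum>i\<in>UNIV. w i *\<^sub>R y i) = - (dt *\<^sub>R fst c)"
  proof -
    have e: "(\<Sum>i\<in>UNIV. p $ i *\<^sub>R axis i 1) = p" for p :: "real ^ 'a"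
      using basis_expansion[of p] by (simp add: scalar_mult_eq_scaleR)
    have "(\<Sum>i\<in>UNIV. w i *\<^sub>R y i) = (\<Sum>i\<in>UNIV. dt *\<^sub>R (\<alpha> $ i *\<^sub>R axis i 1)) - (\<Sum>i\<in>UNIV. dt *\<^sub>R (\<beta> $ i *\<^sub>R axis i 1))"
      unfolding sum_over_sum_type using h by (simp add: w_def y_def sum_negf)
    also have "\<dots> = dt *\<^sub>R \<alpha> - dt *\<^sub>R \<beta>" unfolding scaleR_sum_right[symmetric] e ..
    finally show ?thesis by (simp add: c(1) scaleR_diff_right)
  qed
  have "\<phi> (\<Sum>i\<in>UNIV. w i *\<^sub>R y i) \<le> (\<Sum>i\<in>UNIV. w i * \<phi> (y i)) + (1 - sum w UNIV) * \<phi> 0"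
    unfolding \<phi>_def by (rule convex_on_subconvex_combination[OF semiconcave_imp_convex[OF K]]) (use w0 w1 in auto)
  moreover have "\<phi> (\<Sum>i\<in>UNIV. w i *\<^sub>R y i) \<ge> - v (x - dt *\<^sub>R fst c)"
  proof -
    have "0 \<le> K * (m \<bullet> m)" for m :: "real ^ 'a" using K0 by simp
    from this[of "- (dt *\<^sub>R fst c)"] show ?thesis
      unfolding mean \<phi>_def by (simp only: add_uminus_conv_diff)
  qed
  moreover have "(\<Sum>i\<in>UNIV. w i * \<phi> (y i)) = K * h\<^sup>2 * sum w UNIV - (\<Sum>i\<in>UNIV. w i * v (x + y i))"
  proof -
    have "y i \<bullet> y i = h\<^sup>2" for i
      by (simp add: y_def power2_eq_square inner_axis split: sum.split)
    then have "(\<Sum>i\<in>UNIV. w i * \<phi> (y i)) = (\<Sum>i\<in>UNIV. K * h\<^sup>2 * w i - w i * v (x + y i))"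
      by (intro sum.cong refl) (simp add: \<phi>_def right_diff_distrib)
    then show ?thesis by (simp only: sum_subtractf sum_distrib_left)
  qed
  moreover have "K * h\<^sup>2 * sum w UNIV \<le> K * h\<^sup>2 * (dt / h * a)"
    using w2 K0 by (intro mult_left_mono) auto
  moreover have "K * h\<^sup>2 * (dt / h * a) = K * h * dt * a" using h by (simp add: power2_eq_square)
  ultimately have jensen: "(\<Sum>i\<in>UNIV. w i * v (x + y i)) + (1 - sum w UNIV) * v x
      \<le> v (x - dt *\<^sub>R fst c) + K * h * dt * a"
    by (simp add: \<phi>_def)
  have "scheme_step F h dt v x \<le> v x + dt * (l - (\<alpha> \<bullet> (- fwd_diff h v x) + \<beta> \<bullet> bwd_diff h v x))"
  proof -
    have "dt * (\<alpha> \<bullet> (- fwd_diff h v x) + \<beta> \<bullet> bwd_diff h v x - l) \<le> dt * F (- fwd_diff h v x, bwd_diff h v x)"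
      using c(5)[of "- fwd_diff h v x" "bwd_diff h v x"] dt by (intro mult_left_mono) auto
    then show ?thesis unfolding scheme_step_def by (simp add: algebra_simps)
  qed
  also have "dt * (l - (\<alpha> \<bullet> (- fwd_diff h v x) + \<beta> \<bullet> bwd_diff h v x))
      = dt * l + (\<Sum>i\<in>UNIV. w i * (v (x + y i) - v x))"
  proof -
    have "\<alpha> \<bullet> (- fwd_diff h v x) = - (\<Sum>i\<in>UNIV. \<alpha> $ i * ((v (x + h *\<^sub>R axis i 1) - v x) / h))"
      unfolding sum_negf[symmetric] inner_vec_def
      by (intro sum.cong refl) (simp add: fwd_diff_def fwd_slope_def)
    moreover have "\<beta> \<bullet> bwd_diff h v x = - (\<Sum>i\<in>UNIV. \<beta> $ i * ((v (x - h *\<^sub>R axis i 1) - v x) / h))"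
      unfolding sum_negf[symmetric] inner_vec_def
      by (intro sum.cong refl) (simp add: bwd_diff_def bwd_slope_def diff_divide_distrib right_diff_distrib)
    moreover have "(\<Sum>i\<in>UNIV. w (Inl i) * (v (x + y (Inl i)) - v x))
        = dt * (\<Sum>i\<in>UNIV. \<alpha> $ i * ((v (x + h *\<^sub>R axis i 1) - v x) / h))"
      unfolding sum_distrib_left by (intro sum.cong refl) (simp add: w_def y_def)
    moreover have "(\<Sum>i\<in>UNIV. w (Inr i) * (v (x + y (Inr i)) - v x))
        = dt * (\<Sum>i\<in>UNIV. \<beta> $ i * ((v (x - h *\<^sub>R axis i 1) - v x) / h))"
      unfolding sum_distrib_left by (intro sum.cong refl) (simp add: w_def y_def)
    ultimately show ?thesis unfolding sum_over_sum_type by (simp add: algebra_simps)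
  qed
  also have "(\<Sum>i\<in>UNIV. w i * (v (x + y i) - v x)) = (\<Sum>i\<in>UNIV. w i * v (x + y i)) - sum w UNIV * v x"
    by (simp add: right_diff_distrib sum_subtractf sum_distrib_right)
  finally show ?thesis using jensen by (simp add: c(1) algebra_simps)
qed

text \<open>
  The control given by the tangent of \<open>F\<close> at \<open>(- p, p)\<close>; its velocity is \<open>DH p\<close> for \<open>H p = F (- p, p)\<close>.
\<close>

definition optimal_control ::
    "((real ^ 'n) \<times> (real ^ 'n) \<Rightarrow> real) \<Rightarrow> ((real ^ 'n) \<times> (real ^ 'n) \<Rightarrow> ((real ^ 'n) \<times> (real ^ 'n)) \<Rightarrow>\<^sub>L real)
      \<Rightarrow> real ^ 'n \<Rightarrow> (real ^ 'n) \<times> real" where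
  "optimal_control F F' p =
     (\<chi> i. blinfun_apply (F' (- p, p)) (- axis i 1, axis i 1), blinfun_apply (F' (- p, p)) (- p, p) - F (- p, p))"

lemma inner_optimal_control:
  "k \<bullet> fst (optimal_control F F' p) = blinfun_apply (F' (- p, p)) (- k, k)"
proof -
  interpret D: bounded_linear "blinfun_apply (F' (- p, p))" by (rule blinfun.bounded_linear_right)
  have "(- k, k) = (\<Sum>i\<in>UNIV. k $ i *\<^sub>R (- axis i 1, axis i 1))"
    using basis_expansion[of k] by (simp add: prod_eq_iff fst_sum snd_sum scalar_mult_eq_scaleR sum_negf)
  then have "blinfun_apply (F' (- p, p)) (- k, k) = blinfun_apply (F' (- p, p)) (\<Sum>i\<in>UNIV. k $ i *\<^sub>R (- axis i 1, axis i 1))"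
    by (simp only:)
  then show ?thesis by (simp only: D.sum D.scaleR real_scaleR_def) (simp add: optimal_control_def inner_vec_def)
qed

lemma optimal_control_in_controls:
  assumes conv: "convex_on UNIV F" and F': "\<And>\<zeta>. (F has_derivative blinfun_apply (F' \<zeta>)) (at \<zeta>)"
    and pos: "\<And>i. blinfun_apply (F' (- p, p)) (axis i 1, 0) \<ge> 0" "\<And>i. blinfun_apply (F' (- p, p)) (0, axis i 1) \<ge> 0"
    and le: "(\<Sum>i\<in>UNIV. blinfun_apply (F' (- p, p)) (axis i 1, 0)) + (\<Sum>i\<in>UNIV. blinfun_apply (F' (- p, p)) (0, axis i 1)) \<le> a"
  shows "optimal_control F F' p \<in> controls F a"
proof -
  define \<alpha> where "\<alpha> = (\<chi> i. blinfun_apply (F' (- p, p)) (axis i 1, 0))"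
  define \<beta> where "\<beta> = (\<chi> i. blinfun_apply (F' (- p, p)) (0, axis i 1))"
  have eq: "blinfun_apply (F' (- p, p)) (P, Q) = \<alpha> \<bullet> P + \<beta> \<bullet> Q" for P Q
    by (subst pair_coordinates)
       (auto simp: bounded_linear.linear[OF blinfun.bounded_linear_right] \<alpha>_def \<beta>_def inner_vec_def mult.commute)
  have "fst (optimal_control F F' p) = \<beta> - \<alpha>"
    unfolding optimal_control_def fst_conv eq vec_eq_iff by (simp add: inner_axis)
  then have "optimal_control F F' p = (\<beta> - \<alpha>, blinfun_apply (F' (- p, p)) (- p, p) - F (- p, p))"
    by (simp add: prod_eq_iff optimal_control_def)
  moreover have "\<alpha> \<bullet> P + \<beta> \<bullet> Q \<le> F (P, Q) + (blinfun_apply (F' (- p, p)) (- p, p) - F (- p, p))" for P Q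
    using tangent_below_convex[OF conv F', of "(- p, p)" "(P, Q)", unfolded blinfun.diff_right eq]
    unfolding eq by linarith
  moreover have "(\<Sum>i\<in>UNIV. \<alpha> $ i) + (\<Sum>i\<in>UNIV. \<beta> $ i) \<le> a" using le by (simp add: \<alpha>_def \<beta>_def)
  moreover have "\<forall>i. 0 \<le> \<alpha> $ i \<and> 0 \<le> \<beta> $ i" using pos by (simp add: \<alpha>_def \<beta>_def)
  ultimately show ?thesis unfolding controls_def by blast
qed

section \<open>Integrals over the torus\<close>

text \<open>
  The unit cube and its translate by \<open>s e\<^sub>i\<close> complete each other to the same box by slabs that
  differ by \<open>e\<^sub>i\<close>.
\<close>

lemma integral_torus_shift_pos:
  fixes G :: "real ^ 'n \<Rightarrow> real"
  assumes per: "torus_periodic G" and cont: "continuous_on UNIV G" and s: "0 \<le> s" "s \<le> 1"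
  shows "integral (cbox 0 1) (\<lambda>x. G (x + s *\<^sub>R axis i 1)) = integral (cbox 0 1) G"
proof -
  let ?e = "axis i 1 :: real ^ 'n"
  let ?B = "cbox 0 (1 + s *\<^sub>R ?e)"
  have int: "G integrable_on cbox a b" for a b by (intro integrable_continuous continuous_on_subset[OF cont]) auto
  have e: "?e \<in> Basis" by (simp add: axis_in_Basis_iff)
  have "integral (cbox 0 1) (\<lambda>x. G (x + s *\<^sub>R ?e)) = integral (cbox 0 1) (G \<circ> ((+) (s *\<^sub>R ?e)))"
    by (simp add: o_def add.commute)
  also have "\<dots> = integral (cbox (0 + s *\<^sub>R ?e) (1 + s *\<^sub>R ?e)) G" by (rule integral_shift_cbox_plus)
  finally have 1: "integral (cbox 0 1) (\<lambda>x. G (x + s *\<^sub>R ?e)) = integral (cbox (s *\<^sub>R ?e) (1 + s *\<^sub>R ?e)) G" by simp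
  have inner_e: "x \<bullet> ?e = x $ i" for x by (simp add: inner_axis)
  have "?B \<inter> {x. x \<bullet> ?e \<le> s} = cbox 0 (1 - ?e + s *\<^sub>R ?e)"
    unfolding inner_e interval_split_cart(1)[unfolded interval_cbox_cart]
    by (rule arg_cong[where f = "cbox 0"]) (use s in \<open>auto simp: vec_eq_iff axis_def\<close>)
  moreover have "?B \<inter> {x. x \<bullet> ?e \<ge> s} = cbox (s *\<^sub>R ?e) (1 + s *\<^sub>R ?e)"
    unfolding inner_e interval_split_cart(2)[unfolded interval_cbox_cart]
    by (rule arg_cong[where f = "\<lambda>a. cbox a (1 + s *\<^sub>R ?e)"]) (use s in \<open>auto simp: vec_eq_iff axis_def\<close>)
  ultimately have 2: "integral ?B G = integral (cbox 0 (1 - ?e + s *\<^sub>R ?e)) G + integral (cbox (s *\<^sub>R ?e) (1 + s *\<^sub>R ?e)) G"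
    using integral_split[OF int e, of 0 "1 + s *\<^sub>R ?e" s] by simp
  have "?B \<inter> {x. x \<bullet> ?e \<le> 1} = cbox 0 1"
    unfolding inner_e interval_split_cart(1)[unfolded interval_cbox_cart]
    by (rule arg_cong[where f = "cbox 0"]) (use s in \<open>auto simp: vec_eq_iff axis_def\<close>)
  moreover have "?B \<inter> {x. x \<bullet> ?e \<ge> 1} = cbox (0 + ?e) ((1 - ?e + s *\<^sub>R ?e) + ?e)"
  proof -
    have "(1 - ?e + s *\<^sub>R ?e) + ?e = 1 + s *\<^sub>R ?e" by simp
    then show ?thesis unfolding inner_e interval_split_cart(2)[unfolded interval_cbox_cart]
      by (intro arg_cong2[where f = cbox]) (use s in \<open>auto simp: vec_eq_iff axis_def\<close>)
  qed
  ultimately have 3: "integral ?B G = integral (cbox 0 1) G + integral (cbox (0 + ?e) ((1 - ?e + s *\<^sub>R ?e) + ?e)) G"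
    using integral_split[OF int e, of 0 "1 + s *\<^sub>R ?e" 1] by simp
  have "integral (cbox (0 + ?e) ((1 - ?e + s *\<^sub>R ?e) + ?e)) G = integral (cbox 0 (1 - ?e + s *\<^sub>R ?e)) (G \<circ> ((+) ?e))"
    by (rule integral_shift_cbox_plus[symmetric])
  also have "G \<circ> ((+) ?e) = G" using per by (auto simp: torus_periodic_def fun_eq_iff add.commute)
  finally show ?thesis using 1 2 3 by simp
qed

lemma torus_periodic_translate: "torus_periodic v \<Longrightarrow> torus_periodic (\<lambda>x. v (x + z))"
  unfolding torus_periodic_def by (metis add.assoc add.commute)

lemma integral_torus_shift:
  fixes G :: "real ^ 'n \<Rightarrow> real"
  assumes per: "torus_periodic G" and cont: "continuous_on UNIV G" and s: "\<bar>s\<bar> \<le> 1"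
  shows "integral (cbox 0 1) (\<lambda>x. G (x + s *\<^sub>R axis i 1)) = integral (cbox 0 1) G"
proof (cases "s \<ge> 0")
  case True
  then show ?thesis using assms integral_torus_shift_pos by auto
next
  case False
  have "continuous_on UNIV (\<lambda>x. G (x + s *\<^sub>R axis i 1))"
    by (intro continuous_on_compose2[OF cont] continuous_intros) auto
  from integral_torus_shift_pos[OF torus_periodic_translate[OF per] this, of "- s" i]
  show ?thesis using False s by simp
qed

text \<open>
  The integral of a translate does not depend on the translation; differentiate under the integral.
\<close>

lemma integral_torus_partial_derivative:
  fixes G :: "real ^ 'n \<Rightarrow> real"
  assumes per: "torus_periodic G" and G': "\<And>x. (G has_derivative G' x) (at x)"
    and cont': "continuous_on UNIV (\<lambda>x. G' x (axis i 1))"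
  shows "integral (cbox 0 1) (\<lambda>x. G' x (axis i 1)) = 0"
proof -
  let ?e = "axis i 1 :: real ^ 'n"
  have cont: "continuous_on UNIV G"
    by (rule has_derivative_continuous_on[OF has_derivative_at_withinI[OF G']])
  have "((\<lambda>s. integral (cbox 0 1) (\<lambda>x. G (x + s *\<^sub>R ?e))) has_field_derivative
      integral (cbox 0 1) (\<lambda>x. G' (x + 0 *\<^sub>R ?e) ?e)) (at 0 within {-1..1})"
  proof (rule leibniz_rule_field_derivative)
    fix s :: real and x
    have "((\<lambda>s. x + s *\<^sub>R ?e) has_derivative (\<lambda>k. k *\<^sub>R ?e)) (at s)"
      by (auto intro!: derivative_eq_intros)
    from has_derivative_compose[OF this G']
    have "((\<lambda>s. G (x + s *\<^sub>R ?e)) has_derivative (\<lambda>k. G' (x + s *\<^sub>R ?e) (k *\<^sub>R ?e))) (at s)" .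
    moreover interpret D: linear "G' (x + s *\<^sub>R ?e)" by (rule has_derivative_linear[OF G'])
    have "G' (x + s *\<^sub>R ?e) (k *\<^sub>R ?e) = G' (x + s *\<^sub>R ?e) ?e * k" for k by (simp add: D.scale)
    ultimately have "((\<lambda>s. G (x + s *\<^sub>R ?e)) has_field_derivative G' (x + s *\<^sub>R ?e) ?e) (at s)"
      unfolding has_field_derivative_def by (simp only:)
    then show "((\<lambda>s. G (x + s *\<^sub>R ?e)) has_field_derivative G' (x + s *\<^sub>R ?e) ?e) (at s within {-1..1})"
      by (rule has_field_derivative_at_within)
  next
    show "(\<lambda>x. G (x + s *\<^sub>R ?e)) integrable_on cbox 0 1" for s
      by (intro integrable_continuous continuous_on_compose2[OF cont] continuous_intros) auto
    show "continuous_on ({-1..1} \<times> cbox 0 1) (\<lambda>(s, x). G' (x + s *\<^sub>R ?e) ?e)"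
      unfolding case_prod_unfold by (intro continuous_on_compose2[OF cont'] continuous_intros) auto
  qed auto
  then have "((\<lambda>s. integral (cbox 0 1) (\<lambda>x. G (x + s *\<^sub>R ?e))) has_field_derivative
      integral (cbox 0 1) (\<lambda>x. G' x ?e)) (at 0)"
    by (simp add: at_within_interior[of 0 "{-1..1}"] interior_atLeastAtMost_real)
  moreover have "((\<lambda>s. integral (cbox 0 1) (\<lambda>x. G (x + s *\<^sub>R ?e))) has_field_derivative 0) (at 0)"
    by (rule has_field_derivative_transform_within_open[of "\<lambda>_. integral (cbox 0 1) G" _ _ "{-1<..<1}"])
       (use integral_torus_shift[OF per cont] in auto)
  ultimately show ?thesis by (rule DERIV_unique)
qed

section \<open>Traces of products and second derivatives\<close>

lemma sum_insert_square:
  fixes B :: "'i \<Rightarrow> 'i \<Rightarrow> real"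
  assumes "finite S" "k \<notin> S"
  shows "(\<Sum>i\<in>insert k S. \<Sum>j\<in>insert k S. B i j)
    = B k k + (\<Sum>j\<in>S. B k j) + (\<Sum>i\<in>S. B i k) + (\<Sum>i\<in>S. \<Sum>j\<in>S. B i j)"
  using assms by (simp add: sum.distrib)

text \<open>
  The trace of the product of two nonnegative forms, \<open>C\<close> symmetric.  One step of Gaussian
  elimination writes \<open>C\<close> as a rank-one form plus a nonnegative form \<open>C'\<close> on the remaining indices;
  \<open>A\<close> is nonnegative against the first, and induction treats the second.
\<close>

lemma trace_product_nonneg:
  fixes A C :: "'i \<Rightarrow> 'i \<Rightarrow> real"
  assumes "finite S" and "\<And>i j. C i j = C j i"
    and "\<And>y. 0 \<le> (\<Sum>i\<in>S. \<Sum>j\<in>S. C i j * (y i * y j))"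
    and "\<And>y. 0 \<le> (\<Sum>i\<in>S. \<Sum>j\<in>S. A i j * (y i * y j))"
  shows "0 \<le> (\<Sum>i\<in>S. \<Sum>j\<in>S. A i j * C i j)"
  using assms
proof (induction S arbitrary: C rule: finite_induct)
  case (insert k S)
  note sym = insert.prems(1) and C = insert.prems(2) and A = insert.prems(3)
  note split = sum_insert_square[OF insert.hyps(1,2)]
  define c where "c = C k k"
  \<comment> \<open>If \<open>c = 0\<close>, the whole row vanishes, and division by zero makes \<open>C'\<close> equal to \<open>C\<close>.\<close>
  define C' where "C' i j = C i j - C i k * C k j / c" for i j
  have quad: "0 \<le> c * (t * t) + 2 * t * (\<Sum>j\<in>S. C k j * y j) + (\<Sum>i\<in>S. \<Sum>j\<in>S. C i j * (y i * y j))" for t y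
  proof -
    define z where "z i = (if i = k then t else y i)" for i
    have zk: "z k = t" and zS: "\<And>i. i \<in> S \<Longrightarrow> z i = y i" using insert.hyps(2) by (auto simp: z_def)
    have "0 \<le> (\<Sum>i\<in>insert k S. \<Sum>j\<in>insert k S. C i j * (z i * z j))" by (rule C)
    also have "\<dots> = C k k * (t * t) + (\<Sum>j\<in>S. C k j * (t * y j)) + (\<Sum>i\<in>S. C i k * (y i * t))
        + (\<Sum>i\<in>S. \<Sum>j\<in>S. C i j * (y i * y j))"
      unfolding split zk by (simp add: zS cong: sum.cong)
    also have "(\<Sum>i\<in>S. C i k * (y i * t)) = t * (\<Sum>j\<in>S. C k j * y j)"
      unfolding sum_distrib_left by (intro sum.cong refl) (simp add: sym[of _ k])
    also have "(\<Sum>j\<in>S. C k j * (t * y j)) = t * (\<Sum>j\<in>S. C k j * y j)"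
      unfolding sum_distrib_left by (intro sum.cong refl) simp
    finally show ?thesis by (simp add: c_def)
  qed
  have c0: "c \<ge> 0" using quad[of 1 "\<lambda>_. 0"] by simp
  have row0: "C k j = 0" if "c = 0" "j \<in> S" for j
  proof (rule ccontr)
    assume nz: "C k j \<noteq> 0"
    define y where "y i = (if i = j then 1 else 0 :: real)" for i
    have "(\<Sum>i\<in>S. C k i * y i) = C k j" "(\<Sum>i\<in>S. \<Sum>l\<in>S. C i l * (y i * y l)) = C j j"
      using that(2) insert.hyps(1) by (simp_all add: y_def if_distrib[of "(*) _"] sum.delta cong: if_cong)
    then have "0 \<le> 2 * t * C k j + C j j" for t using quad[of t y] that(1) by simp
    from this[of "- (C j j + 1) / (2 * C k j)"] show False using nz by (simp add: field_simps)
  qed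
  have C'sym: "C' i j = C' j i" for i j
    unfolding C'_def using sym[of i j] sym[of i k] sym[of j k] by simp
  have C'k: "C' k j = 0" "C' j k = 0" if "j \<in> insert k S" for j
  proof -
    show "C' k j = 0"
      using that row0[of j] by (cases "c = 0") (auto simp: C'_def c_def)
    then show "C' j k = 0" using C'sym by simp
  qed
  have C'psd: "0 \<le> (\<Sum>i\<in>S. \<Sum>j\<in>S. C' i j * (y i * y j))" for y
  proof -
    define m where "m = (\<Sum>j\<in>S. C k j * y j)"
    have "(\<Sum>i\<in>S. \<Sum>j\<in>S. C' i j * (y i * y j))
        = (\<Sum>i\<in>S. \<Sum>j\<in>S. C i j * (y i * y j)) - (\<Sum>i\<in>S. \<Sum>j\<in>S. (C k i * y i) * (C k j * y j)) / c"
      unfolding C'_def sum_divide_distrib sum_subtractf[symmetric]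
      by (intro sum.cong refl) (simp add: sym[of _ k] algebra_simps)
    also have "(\<Sum>i\<in>S. \<Sum>j\<in>S. (C k i * y i) * (C k j * y j)) = m * m"
      unfolding m_def by (rule sum_product[symmetric])
    finally have eq: "(\<Sum>i\<in>S. \<Sum>j\<in>S. C' i j * (y i * y j)) = (\<Sum>i\<in>S. \<Sum>j\<in>S. C i j * (y i * y j)) - m * m / c" .
    have "0 \<le> (\<Sum>i\<in>S. \<Sum>j\<in>S. C i j * (y i * y j)) - m * m / c"
      \<comment> \<open>The minimum over the eliminated variable.\<close>
      using quad[of "- m / c" y] c0 unfolding m_def[symmetric]
      by (cases "c = 0") (auto simp: field_simps)
    then show ?thesis by (simp only: eq)
  qed
  have A_S: "0 \<le> (\<Sum>i\<in>S. \<Sum>j\<in>S. A i j * (y i * y j))" for y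
  proof -
    define z where "z i = (if i = k then 0 else y i)" for i
    have zk: "z k = 0" and zS: "\<And>i. i \<in> S \<Longrightarrow> z i = y i" using insert.hyps(2) by (auto simp: z_def)
    have "0 \<le> (\<Sum>i\<in>insert k S. \<Sum>j\<in>insert k S. A i j * (z i * z j))" by (rule A)
    then show ?thesis unfolding split zk by (simp add: zS cong: sum.cong)
  qed
  have "0 \<le> (\<Sum>i\<in>S. \<Sum>j\<in>S. A i j * C' i j)"
    by (rule insert.IH) (use C'sym C'psd A_S in auto)
  also have "\<dots> = (\<Sum>i\<in>insert k S. \<Sum>j\<in>insert k S. A i j * C' i j)"
    unfolding split using C'k by simp
  also have "\<dots> = (\<Sum>i\<in>insert k S. \<Sum>j\<in>insert k S. A i j * C i j)
      - (\<Sum>i\<in>insert k S. \<Sum>j\<in>insert k S. A i j * (C i k * C j k)) / c"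
    unfolding C'_def sum_divide_distrib sum_subtractf[symmetric]
    by (intro sum.cong refl) (simp add: sym[of k] right_diff_distrib)
  finally have "(\<Sum>i\<in>insert k S. \<Sum>j\<in>insert k S. A i j * (C i k * C j k)) / c
      \<le> (\<Sum>i\<in>insert k S. \<Sum>j\<in>insert k S. A i j * C i j)" by simp
  moreover have "0 \<le> (\<Sum>i\<in>insert k S. \<Sum>j\<in>insert k S. A i j * (C i k * C j k)) / c"
    using A[of "\<lambda>i. C i k"] c0 by (rule divide_nonneg_nonneg)
  ultimately show ?case by linarith
qed simp

lemma convex_second_derivative_nonneg:
  fixes f :: "'a::real_normed_vector \<Rightarrow> real"
  assumes conv: "convex_on UNIV f" and f1: "\<And>x. (f has_derivative f1 x) (at x)"
    and f2: "((\<lambda>x. f1 x y) has_derivative f2) (at x)"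
  shows "f2 y \<ge> 0"
proof -
  have "((\<lambda>x. - f1 x y) has_derivative (\<lambda>k. - f2 k)) (at x)" using f2 by (rule has_derivative_minus)
  then have "- f2 y \<le> 0"
  proof (rule derivative_le_from_increments[OF _ zero_less_one])
    fix s :: real assume s: "0 < s" "s \<le> 1"
    let ?y = "x + s *\<^sub>R y"
    have lin: "f1 x (s *\<^sub>R y) = s * f1 x y" "f1 ?y (- (s *\<^sub>R y)) = - (s * f1 ?y y)"
      using has_derivative_linear[OF f1] by (simp_all add: linear_scale linear_neg)
    have "f x + s * f1 x y \<le> f ?y" "f ?y - s * f1 ?y y \<le> f x"
      using tangent_below_convex[OF conv f1[of x], of ?y] tangent_below_convex[OF conv f1[of ?y], of x] lin
      by simp_all
    then have "s * f1 x y \<le> s * f1 ?y y" by linarith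
    then show "- f1 ?y y \<le> - f1 x y + s * 0" using s by simp
  qed
  then show ?thesis by simp
qed

lemma mollify_semiconcave:
  fixes v :: "real ^ 'n \<Rightarrow> real"
  assumes r: "r > 0" and v: "continuous_on UNIV v" and K: "semiconcave K v"
  shows "semiconcave K (mollify r v)"
  unfolding semiconcave_iff_centred
proof (intro conjI allI ballI)
  show "K > 0" using K unfolding semiconcave_def by blast
  fix w z :: "real ^ 'n" and l :: real assume l: "l \<in> {0<..<1}"
  let ?v1 = "\<lambda>y. v (y + (1 - l) *\<^sub>R z)" and ?v2 = "\<lambda>y. v (y - l *\<^sub>R z)"
  have cont: "continuous_on UNIV ?v1" "continuous_on UNIV ?v2"
    by (intro continuous_on_compose2[OF v] continuous_intros; simp)+
  have "mollify r (\<lambda>y. l * ?v1 y + (1 - l) * ?v2 y) w \<le> mollify r v w + l * (1 - l) * K * (norm z)\<^sup>2"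
  proof (rule mollify_diff_le[OF r _ v])
    show "continuous_on UNIV (\<lambda>y. l * ?v1 y + (1 - l) * ?v2 y)" by (intro continuous_intros cont)
    show "l * ?v1 (w + y) + (1 - l) * ?v2 (w + y) \<le> v (w + y) + l * (1 - l) * K * (norm z)\<^sup>2" for y
      using K l unfolding semiconcave_iff_centred by blast
  qed
  moreover have "mollify r (\<lambda>y. l * ?v1 y + (1 - l) * ?v2 y) w
      = l * mollify r v (w + (1 - l) *\<^sub>R z) + (1 - l) * mollify r v (w - l *\<^sub>R z)"
  proof -
    have "continuous_on UNIV (\<lambda>y. l * ?v1 y)" "continuous_on UNIV (\<lambda>y. (1 - l) * ?v2 y)"
      by (intro continuous_intros cont)+
    then have "mollify r (\<lambda>y. l * ?v1 y + (1 - l) * ?v2 y) w = l * mollify r ?v1 w + (1 - l) * mollify r ?v2 w"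
      by (simp add: mollify_add mollify_cmult)
    then show ?thesis
      using mollify_translate[of r v w "(1 - l) *\<^sub>R z"] mollify_translate[of r v w "- (l *\<^sub>R z)"] by simp
  qed
  ultimately show "l * mollify r v (w + (1 - l) *\<^sub>R z) + (1 - l) * mollify r v (w - l *\<^sub>R z)
      \<le> mollify r v w + l * (1 - l) * K * (norm z)\<^sup>2" by simp
qed

lemma semiconcave_tangent_above:
  fixes V :: "real ^ 'n \<Rightarrow> real"
  assumes K: "semiconcave K V" and V': "(V has_derivative V') (at x)"
  shows "V (x + k) \<le> V x + V' k + K * (k \<bullet> k)"
proof -
  have "((\<lambda>k. V (x + k)) has_derivative V') (at 0)"
    by (rule has_derivative_compose[of "\<lambda>k. x + k" "\<lambda>k. k" 0 UNIV V])
       (use V' in \<open>auto intro!: derivative_eq_intros\<close>)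
  then have "((\<lambda>k. K * (k \<bullet> k) - V (x + k)) has_derivative (\<lambda>k. - V' k)) (at 0)"
    by (auto intro!: derivative_eq_intros)
  from tangent_below_convex[OF semiconcave_imp_convex[OF K] this, of k] show ?thesis by simp
qed

lemma mollify_hess_le:
  fixes v :: "real ^ 'n \<Rightarrow> real"
  assumes r: "r > 0" and v: "continuous_on UNIV v" and K: "semiconcave K v"
  shows "mollify_hess r v x y y \<le> 2 * K * (y \<bullet> y)"
proof -
  let ?f = "\<lambda>k. K * (k \<bullet> k) - mollify r v (0 + k)"
  have 1: "convex_on UNIV ?f" by (rule semiconcave_imp_convex[OF mollify_semiconcave[OF r v K]])
  have 2: "(?f has_derivative (\<lambda>k. 2 * K * (z \<bullet> k) - mollify_deriv r v z k)) (at z)" for z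
    using mollify_has_derivative[OF r v, of z]
    by (auto intro!: derivative_eq_intros simp: inner_commute)
  have 3: "((\<lambda>z. 2 * K * (z \<bullet> y) - mollify_deriv r v z y) has_derivative
      (\<lambda>k. 2 * K * (k \<bullet> y) - mollify_hess r v x y k)) (at x)"
    using mollify_deriv_has_derivative[OF r v, of y x] by (auto intro!: derivative_eq_intros)
  have "0 \<le> 2 * K * (y \<bullet> y) - mollify_hess r v x y y"
    by (rule convex_second_derivative_nonneg[OF 1 2 3])
  then show ?thesis by simp
qed

section \<open>Divergence of the drift\<close>

lemma mollify_deriv_periodic:
  assumes "torus_periodic v"
  shows "torus_periodic (\<lambda>x. mollify_deriv r v x k)"
proof -
  have "v (x + axis i 1 + w) = v (x + w)" for x i w
    using assms unfolding torus_periodic_def by (metis add.assoc add.commute)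
  then show ?thesis unfolding torus_periodic_def mollify_deriv_def correlation_def by simp
qed

lemma mollify_periodic:
  assumes "torus_periodic v"
  shows "torus_periodic (mollify r v)"
proof -
  have "v (x + axis i 1 + w) = v (x + w)" for x i w
    using assms unfolding torus_periodic_def by (metis add.assoc add.commute)
  then show ?thesis unfolding torus_periodic_def mollify_def correlation_def by simp
qed

lemma mollify_grad_nth:
  fixes v :: "real ^ 'n \<Rightarrow> real"
  assumes "r > 0" "continuous_on UNIV v"
  shows "mollify_grad r v x $ i = mollify_deriv r v x (axis i 1)"
  using inner_mollify_grad[OF assms, of "axis i 1" x] by (simp add: inner_axis')

lemma bilinear_coordinates:
  fixes B :: "real ^ 'n \<Rightarrow> real ^ 'n \<Rightarrow> real"
  assumes "\<And>x. linear (B x)" "\<And>y. linear (\<lambda>x. B x y)"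
  shows "B y y = (\<Sum>i\<in>UNIV. \<Sum>j\<in>UNIV. B (axis i 1) (axis j 1) * (y $ i * y $ j))"
proof -
  have y: "y = (\<Sum>i\<in>UNIV. y $ i *\<^sub>R axis i 1)"
    using basis_expansion[of y] by (simp add: scalar_mult_eq_scaleR)
  have "B y y = B (\<Sum>i\<in>UNIV. y $ i *\<^sub>R axis i 1) y" using y by simp
  also have "\<dots> = (\<Sum>i\<in>UNIV. y $ i * B (axis i 1) y)"
    by (simp add: linear_sum[OF assms(2)] linear_scale[OF assms(2)])
  also have "\<dots> = (\<Sum>i\<in>UNIV. y $ i * B (axis i 1) (\<Sum>j\<in>UNIV. y $ j *\<^sub>R axis j 1))" using y by simp
  also have "\<dots> = (\<Sum>i\<in>UNIV. \<Sum>j\<in>UNIV. B (axis i 1) (axis j 1) * (y $ i * y $ j))"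
    by (simp add: linear_sum[OF assms(1)] linear_scale[OF assms(1)] sum_distrib_left mult_ac)
  finally show ?thesis .
qed

text \<open>
  The matrix \<open>2 K - D\<^sup>2V\<close> is symmetric and nonnegative for the mollified semiconcave function \<open>V\<close>,
  and \<open>D\<^sup>2H\<close> is nonnegative, so the trace of their product is nonnegative.
\<close>

lemma trace_bound:
  fixes v H :: "real ^ 'n \<Rightarrow> real"
  assumes r: "r > 0" and v: "continuous_on UNIV v" and K: "semiconcave K v"
    and conv: "convex_on UNIV H" and H': "\<And>p. (H has_derivative blinfun_apply (H' p)) (at p)"
    and H'': "\<And>p. (H' has_derivative blinfun_apply (H'' p)) (at p)"
    and B: "norm (H'' p) \<le> B"
  shows "(\<Sum>i\<in>UNIV. \<Sum>j\<in>UNIV. blinfun_apply (blinfun_apply (H'' p) (axis i 1)) (axis j 1) * mollify_hess r v x (axis i 1) (axis j 1))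
    \<le> 2 * K * real CARD('n) * B"
proof -
  define A where "A i j = blinfun_apply (blinfun_apply (H'' p) (axis i 1)) (axis j 1)" for i j :: 'n
  define C where "C i j = (if i = j then 2 * K else 0) - mollify_hess r v x (axis i 1) (axis j 1)" for i j :: 'n
  have K0: "K > 0" using K unfolding semiconcave_def by blast
  have lin: "linear (mollify_hess r v x y)" for y
    by (rule has_derivative_linear[OF mollify_deriv_has_derivative[OF r v]])
  have lin': "linear (\<lambda>y. mollify_hess r v x y k)" for k
    using lin[of k] by (simp only: mollify_hess_sym[of r v x _ k])
  have "0 \<le> (\<Sum>i\<in>UNIV. \<Sum>j\<in>UNIV. A i j * C i j)"
  proof (rule trace_product_nonneg)
    show "C i j = C j i" for i j unfolding C_def using mollify_hess_sym[of r v x] by auto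
    show "0 \<le> (\<Sum>i\<in>UNIV. \<Sum>j\<in>UNIV. C i j * (y i * y j))" for y
    proof -
      have "(\<Sum>i\<in>UNIV. \<Sum>j\<in>UNIV. C i j * (y i * y j))
          = 2 * K * ((\<chi> i. y i) \<bullet> (\<chi> i. y i)) - mollify_hess r v x (\<chi> i. y i) (\<chi> i. y i)"
        unfolding bilinear_coordinates[of "mollify_hess r v x", OF lin lin']
        by (simp add: C_def left_diff_distrib sum_subtractf inner_vec_def sum_distrib_left
            if_distrib[of "\<lambda>a. a * _"] sum.delta mult.assoc cong: if_cong)
      then show ?thesis using mollify_hess_le[OF r v K, of x "\<chi> i. y i"] by simp
    qed
    show "0 \<le> (\<Sum>i\<in>UNIV. \<Sum>j\<in>UNIV. A i j * (y i * y j))" for y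
    proof -
      define z where "z = (\<chi> i. y i)"
      have "((\<lambda>p. blinfun_apply (H' p) z) has_derivative (\<lambda>k. blinfun_apply (blinfun_apply (H'' p) k) z)) (at p)"
        using bounded_linear.has_derivative[OF blinfun.bounded_linear_left H''] .
      from convex_second_derivative_nonneg[OF conv H' this]
      have "0 \<le> blinfun_apply (blinfun_apply (H'' p) z) z" .
      also have "\<dots> = (\<Sum>i\<in>UNIV. \<Sum>j\<in>UNIV. A i j * (z $ i * z $ j))"
        unfolding A_def
        by (rule bilinear_coordinates)
           (auto intro!: bounded_linear.linear bounded_linear_intros)
      finally show ?thesis by (simp add: z_def)
    qed
  qed simp
  also have "(\<Sum>i\<in>UNIV. \<Sum>j\<in>UNIV. A i j * C i j)
      = 2 * K * (\<Sum>i\<in>UNIV. A i i) - (\<Sum>i\<in>UNIV. \<Sum>j\<in>UNIV. A i j * mollify_hess r v x (axis i 1) (axis j 1))"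
    by (simp add: C_def right_diff_distrib sum_subtractf sum_distrib_left if_distrib[of "\<lambda>a. _ * a"]
        sum.delta mult_ac cong: if_cong)
  finally have "(\<Sum>i\<in>UNIV. \<Sum>j\<in>UNIV. A i j * mollify_hess r v x (axis i 1) (axis j 1)) \<le> 2 * K * (\<Sum>i\<in>UNIV. A i i)"
    by simp
  also have "\<dots> \<le> 2 * K * (\<Sum>i\<in>(UNIV :: 'n set). B)"
  proof (intro mult_left_mono sum_mono)
    fix i :: 'n
    have "A i i \<le> norm (blinfun_apply (H'' p) (axis i 1)) * norm (axis i 1 :: real ^ 'n)"
      unfolding A_def using norm_blinfun[of "blinfun_apply (H'' p) (axis i 1)" "axis i 1"]
      by (simp add: abs_le_iff)
    also have "\<dots> \<le> norm (H'' p) * norm (axis i 1 :: real ^ 'n) * norm (axis i 1 :: real ^ 'n)"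
      by (intro mult_right_mono norm_blinfun) simp
    finally show "A i i \<le> B" using B by simp
  qed (use K0 in simp)
  finally show ?thesis by (simp add: A_def mult_ac)
qed

text \<open>
  Integration by parts for the drift \<open>b = DH (DV)\<close>: the left-hand side is \<open>\<integral> f div b\<close>, and
  \<open>div b = tr (D\<^sup>2H D\<^sup>2V)\<close> is bounded above by semiconcavity.  No lower bound holds,
  hence the assumption that \<open>f\<close> is nonnegative.
\<close>

lemma drift_divergence_bound:
  fixes v H f :: "real ^ 'n \<Rightarrow> real"
  assumes r: "r > 0" and v: "continuous_on UNIV v" and per: "torus_periodic v" and K: "semiconcave K v"
    and conv: "convex_on UNIV H" and H': "\<And>p. (H has_derivative blinfun_apply (H' p)) (at p)"
    and H'': "\<And>p. (H' has_derivative blinfun_apply (H'' p)) (at p)" and contH'': "continuous_on UNIV H''"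
    and B: "\<And>x. norm (H'' (mollify_grad r v x)) \<le> B"
    and f: "\<And>x. (f has_derivative Df x) (at x)" and contDf: "\<And>k. continuous_on UNIV (\<lambda>x. Df x k)"
    and perf: "torus_periodic f" and f0: "\<And>x. f x \<ge> 0"
  shows "integral (cbox 0 1) (\<lambda>x. - Df x (\<chi> i. blinfun_apply (H' (mollify_grad r v x)) (axis i 1)))
    \<le> 2 * K * real CARD('n) * B * integral (cbox 0 1) f"
proof -
  let ?p = "mollify_grad r v"
  define b where "b i x = blinfun_apply (H' (?p x)) (axis i 1)" for i x
  define Dp where "Dp x k = (\<Sum>j\<in>UNIV. mollify_hess r v x (axis j 1) k *\<^sub>R (axis j 1 :: real ^ 'n))" for x k
  define h where "h i j x = mollify_hess r v x (axis j 1) (axis i 1)" for i j x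
  define A where "A i j x = blinfun_apply (blinfun_apply (H'' (?p x)) (axis i 1)) (axis j 1)" for i j :: 'n and x
  have contp: "continuous_on UNIV ?p" by (rule continuous_mollify_grad[OF r v])
  have contH': "continuous_on UNIV H'"
    by (rule has_derivative_continuous_on[OF has_derivative_at_withinI[OF H'']])
  have contf: "continuous_on UNIV f"
    by (rule has_derivative_continuous_on[OF has_derivative_at_withinI[OF f]])
  have contb: "continuous_on UNIV (b i)" for i
    unfolding b_def[abs_def] by (intro continuous_intros continuous_on_compose2[OF contH' contp]) auto
  have conth: "continuous_on UNIV (h i j)" for i j
    unfolding h_def[abs_def] by (rule continuous_mollify_hess[OF r v])
  have contA: "continuous_on UNIV (A i j)" for i j
    unfolding A_def[abs_def] by (intro continuous_intros continuous_on_compose2[OF contH'' contp]) auto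
  have p': "(?p has_derivative Dp x) (at x)" for x
  proof -
    have "?p = (\<lambda>x. \<Sum>j\<in>UNIV. mollify_deriv r v x (axis j 1) *\<^sub>R axis j 1)"
    proof
      fix x show "?p x = (\<Sum>j\<in>UNIV. mollify_deriv r v x (axis j 1) *\<^sub>R axis j 1)"
        using basis_expansion[of "?p x"] by (simp add: scalar_mult_eq_scaleR mollify_grad_nth[OF r v])
    qed
    moreover have "((\<lambda>x. \<Sum>j\<in>UNIV. mollify_deriv r v x (axis j 1) *\<^sub>R (axis j 1 :: real ^ 'n)) has_derivative Dp x) (at x)"
      unfolding Dp_def[abs_def]
      by (intro has_derivative_sum has_derivative_scaleR_left mollify_deriv_has_derivative[OF r v])
    ultimately show ?thesis by (simp only:)
  qed
  have b': "(b i has_derivative (\<lambda>k. blinfun_apply (blinfun_apply (H'' (?p x)) (Dp x k)) (axis i 1))) (at x)" for i x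
    unfolding b_def[abs_def]
    by (rule bounded_linear.has_derivative[OF blinfun.bounded_linear_left has_derivative_compose[OF p' H'']])
  have b'_axis: "blinfun_apply (blinfun_apply (H'' (?p x)) (Dp x (axis i 1))) (axis i 1) = (\<Sum>j\<in>UNIV. h i j x * A j i x)" for i x
    unfolding Dp_def h_def A_def by (simp add: blinfun.sum_right blinfun.sum_left blinfun.scaleR_right blinfun.scaleR_left)
  have perb: "torus_periodic (b i)" for i
  proof -
    have "?p (x + axis j 1) = ?p x" for x j
      using mollify_deriv_periodic[OF per, of r] unfolding torus_periodic_def by (simp add: vec_eq_iff mollify_grad_nth[OF r v])
    then show ?thesis unfolding torus_periodic_def b_def by simp
  qed
  have div: "integral (cbox 0 1) (\<lambda>x. Df x (axis i 1) * b i x + f x * (\<Sum>j\<in>UNIV. h i j x * A j i x)) = 0" for i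
  proof -
    have "((\<lambda>x. f x * b i x) has_derivative
        (\<lambda>k. f x * blinfun_apply (blinfun_apply (H'' (?p x)) (Dp x k)) (axis i 1) + Df x k * b i x)) (at x)" for x
      by (rule has_derivative_mult[OF f b'])
    moreover have "torus_periodic (\<lambda>x. f x * b i x)" using perf perb unfolding torus_periodic_def by simp
    moreover have "continuous_on UNIV (\<lambda>x. f x * (\<Sum>j\<in>UNIV. h i j x * A j i x) + Df x (axis i 1) * b i x)"
      by (intro continuous_intros contf conth contA contDf contb)
    ultimately have "integral (cbox 0 1) (\<lambda>x. f x * (\<Sum>j\<in>UNIV. h i j x * A j i x) + Df x (axis i 1) * b i x) = 0"
      using integral_torus_partial_derivative[where G = "\<lambda>x. f x * b i x" and i = i and
          G' = "\<lambda>x k. f x * blinfun_apply (blinfun_apply (H'' (?p x)) (Dp x k)) (axis i 1) + Df x k * b i x"]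
      by (simp only: b'_axis)
    then show ?thesis by (simp add: add.commute)
  qed
  have int: "g integrable_on cbox 0 1" if "continuous_on UNIV g" for g :: "real ^ 'n \<Rightarrow> real"
    by (intro integrable_continuous continuous_on_subset[OF that]) auto
  have Df_b: "- Df x (\<chi> i. b i x) = f x * (\<Sum>i\<in>UNIV. \<Sum>j\<in>UNIV. h i j x * A j i x)
      - (\<Sum>i\<in>UNIV. Df x (axis i 1) * b i x + f x * (\<Sum>j\<in>UNIV. h i j x * A j i x))" for x
  proof -
    interpret D: linear "Df x" by (rule has_derivative_linear[OF f])
    have "(\<chi> i. b i x) = (\<Sum>i\<in>UNIV. b i x *\<^sub>R axis i 1)"
      using basis_expansion[of "\<chi> i. b i x"] by (simp add: scalar_mult_eq_scaleR)
    then have "Df x (\<chi> i. b i x) = (\<Sum>i\<in>UNIV. Df x (axis i 1) * b i x)"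
      by (simp add: D.sum D.scale mult.commute)
    then show ?thesis by (simp add: sum.distrib sum_distrib_left)
  qed
  have cont1: "continuous_on UNIV (\<lambda>x. f x * (\<Sum>i\<in>UNIV. \<Sum>j\<in>UNIV. h i j x * A j i x))"
    by (intro continuous_intros contf conth contA)
  have cont2: "continuous_on UNIV (\<lambda>x. Df x (axis i 1) * b i x + f x * (\<Sum>j\<in>UNIV. h i j x * A j i x))" for i
    by (intro continuous_intros contf conth contA contDf contb)
  have "integral (cbox 0 1) (\<lambda>x. - Df x (\<chi> i. b i x))
      = integral (cbox 0 1) (\<lambda>x. f x * (\<Sum>i\<in>UNIV. \<Sum>j\<in>UNIV. h i j x * A j i x))
        - integral (cbox 0 1) (\<lambda>x. \<Sum>i\<in>UNIV. Df x (axis i 1) * b i x + f x * (\<Sum>j\<in>UNIV. h i j x * A j i x))"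
    unfolding Df_b by (intro integral_diff int cont1 continuous_on_sum cont2)
  also have "integral (cbox 0 1) (\<lambda>x. \<Sum>i\<in>UNIV. Df x (axis i 1) * b i x + f x * (\<Sum>j\<in>UNIV. h i j x * A j i x)) = 0"
    by (subst integral_sum) (use int[OF cont2] div in auto)
  also have "integral (cbox 0 1) (\<lambda>x. f x * (\<Sum>i\<in>UNIV. \<Sum>j\<in>UNIV. h i j x * A j i x)) - 0
      \<le> integral (cbox 0 1) (\<lambda>x. (2 * K * real CARD('n) * B) * f x)"
  proof -
    have le: "f x * (\<Sum>i\<in>UNIV. \<Sum>j\<in>UNIV. h i j x * A j i x) \<le> (2 * K * real CARD('n) * B) * f x" for x
    proof -
      have "(\<Sum>i\<in>UNIV. \<Sum>j\<in>UNIV. h i j x * A j i x)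
          = (\<Sum>i\<in>UNIV. \<Sum>j\<in>UNIV. A i j x * mollify_hess r v x (axis i 1) (axis j 1))"
        by (subst sum.swap) (simp add: h_def mult.commute)
      then have "(\<Sum>i\<in>UNIV. \<Sum>j\<in>UNIV. h i j x * A j i x) \<le> 2 * K * real CARD('n) * B"
        using trace_bound[OF r v K conv H' H'' B, of x x] by (simp add: A_def)
      from mult_left_mono[OF this f0] show ?thesis by (simp add: mult.commute)
    qed
    have cont3: "continuous_on UNIV (\<lambda>x. (2 * K * real CARD('n) * B) * f x)"
      by (intro continuous_intros contf)
    show ?thesis unfolding diff_0_right by (rule integral_le[OF int[OF cont1] int[OF cont3] le])
  qed
  finally show ?thesis by (simp add: b_def)
qed

section \<open>Consistency in the mean\<close>

lemma mollify_close:
  assumes r: "r > 0" and v: "continuous_on UNIV v" and L: "L \<ge> 0"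
    and lip: "\<And>x y. \<bar>v x - v y\<bar> \<le> L * norm (x - y)"
  shows "\<bar>mollify r v x - v x\<bar> \<le> L * r"
proof -
  have near: "\<bar>v (x + w) - v x\<bar> \<le> L * r" if "norm w \<le> r" for w
  proof -
    have "\<bar>v (x + w) - v x\<bar> \<le> L * norm w" using lip[of "x + w" x] by simp
    also have "\<dots> \<le> L * r" using that L by (rule mult_left_mono)
    finally show ?thesis .
  qed
  have "mollify r v x \<le> v x + L * r"
    by (rule mollify_le[OF r v]) (use near in \<open>simp add: abs_le_iff algebra_simps\<close>)
  moreover have "v x - L * r \<le> mollify r v x"
    by (rule mollify_ge[OF r v]) (use near in \<open>simp add: abs_le_iff algebra_simps\<close>)
  ultimately show ?thesis by (simp add: abs_le_iff)
qed

lemma continuous_slopes: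
  fixes v :: "real ^ 'n \<Rightarrow> real"
  assumes "continuous_on UNIV v"
  shows "continuous_on UNIV (\<lambda>x. (- fwd_diff h v x, bwd_diff h v x))"
proof -
  have "continuous_on UNIV (\<lambda>x. v (x + h *\<^sub>R axis i 1))" "continuous_on UNIV (\<lambda>x. v (x - h *\<^sub>R axis i 1))" for i
    by (intro continuous_on_compose2[OF assms] continuous_intros; simp)+
  then show ?thesis
    unfolding fwd_diff_def[abs_def] bwd_diff_def[abs_def] fwd_slope_def bwd_slope_def divide_inverse
    by (auto intro!: continuous_intros assms)
qed

lemma integral_cube_mono:
  fixes f g :: "real ^ 'n \<Rightarrow> real"
  assumes "continuous_on UNIV f" "continuous_on UNIV g" "\<And>x. f x \<le> g x"
  shows "integral (cbox 0 1) f \<le> integral (cbox 0 1) g"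
  using assms by (intro integral_le integrable_continuous) (auto intro: continuous_on_subset)

lemma integral_cube_add:
  fixes f g :: "real ^ 'n \<Rightarrow> real"
  assumes "continuous_on UNIV f" "continuous_on UNIV g"
  shows "integral (cbox 0 1) (\<lambda>x. f x + g x) = integral (cbox 0 1) f + integral (cbox 0 1) g"
  using assms by (intro integral_add integrable_continuous) (auto intro: continuous_on_subset)

lemma integral_cube_const: "integral (cbox (0 :: real ^ 'n) 1) (\<lambda>x. c) = (c :: real)"
proof -
  have "measure lborel (cbox (0 :: real ^ 'n) 1) = 1" by (subst content_cbox_cart) (auto simp: interval_eq_empty_cart)
  then show ?thesis by simp
qed

text \<open>
  By convexity the flux at the discrete slopes exceeds \<open>F (- p, p)\<close> by at most a combination, with
  coefficients between \<open>0\<close> and \<open>M\<close>, of differences between discrete slopes and derivatives.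
  Passing from \<open>v\<close> to \<open>V\<close> costs \<open>2 L r / h\<close> in each of them.  Raised by \<open>K h\<close> the differences for \<open>V\<close>
  are nonnegative, so their coefficients may be replaced by \<open>M\<close>; what remains is a sum of second
  differences of \<open>V\<close>, of integral \<open>0\<close>, and constants.
\<close>

lemma numerical_flux_consistency:
  fixes v :: "real ^ 'n \<Rightarrow> real"
  assumes conv: "convex_on UNIV F" and F': "\<And>\<zeta>. (F has_derivative blinfun_apply (F' \<zeta>)) (at \<zeta>)"
    and pos: "\<And>\<zeta> i. \<zeta> \<in> slope_box R \<Longrightarrow> 0 \<le> blinfun_apply (F' \<zeta>) (axis i 1, 0) \<and> 0 \<le> blinfun_apply (F' \<zeta>) (0, axis i 1)"
    and M: "\<And>\<zeta> i. \<zeta> \<in> slope_box R \<Longrightarrow> blinfun_apply (F' \<zeta>) (axis i 1, 0) \<le> M \<and> blinfun_apply (F' \<zeta>) (0, axis i 1) \<le> M"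
    and r: "r > 0" and v: "continuous_on UNIV v" and per: "torus_periodic v" and K: "semiconcave K v"
    and L: "L \<ge> 0" and lip: "\<And>x y. \<bar>v x - v y\<bar> \<le> L * norm (x - y)"
    and box: "\<And>x. (- fwd_diff h v x, bwd_diff h v x) \<in> slope_box R"
    and h: "0 < h" "h \<le> 1"
  shows "integral (cbox 0 1) (\<lambda>x. F (- fwd_diff h v x, bwd_diff h v x))
    \<le> integral (cbox 0 1) (\<lambda>x. F (- mollify_grad r v x, mollify_grad r v x)) + M * real CARD('n) * (4 * (L * r) / h + 2 * K * h)"
proof -
  define V where "V = mollify r v"
  define \<xi> where "\<xi> x = (- fwd_diff h v x, bwd_diff h v x)" for x
  define p where "p = mollify_grad r v"
  define D where "D i x = (2 * V x - V (x + h *\<^sub>R axis i 1) - V (x - h *\<^sub>R axis i 1)) / h" for i x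
  let ?c = "4 * (L * r) / h + 2 * K * h"
  have contV: "continuous_on UNIV V" unfolding V_def by (rule continuous_mollify[OF r v])
  have contp: "continuous_on UNIV p" unfolding p_def by (rule continuous_mollify_grad[OF r v])
  have contF: "continuous_on UNIV F"
    by (rule has_derivative_continuous_on[OF has_derivative_at_withinI[OF F']])
  have K': "semiconcave K V" unfolding V_def by (rule mollify_semiconcave[OF r v K])
  have V': "(V has_derivative (\<lambda>k. k \<bullet> p x)) (at x)" for x
    using mollify_gderiv[OF r v, of x] unfolding gderiv_def V_def p_def .
  have close: "\<bar>V x - v x\<bar> \<le> L * r" for x unfolding V_def by (rule mollify_close[OF r v L lip])
  have tangent: "V (x + s *\<^sub>R axis i 1) \<le> V x + s * p x $ i + K * s\<^sup>2" for x i s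
    using semiconcave_tangent_above[OF K' V', of x "s *\<^sub>R axis i 1"]
    by (simp add: inner_axis' inner_axis power2_eq_square)
  have pointwise: "F (\<xi> x) \<le> F (- p x, p x) + M * (\<Sum>i\<in>UNIV. ?c + D i x)" for x
  proof -
    define A where "A i = blinfun_apply (F' (\<xi> x)) (axis i 1, 0)" for i
    define B where "B i = blinfun_apply (F' (\<xi> x)) (0, axis i 1)" for i
    have A: "0 \<le> A i" "A i \<le> M" and B: "0 \<le> B i" "B i \<le> M" for i
      using pos[OF box[of x]] M[OF box[of x]] unfolding A_def B_def \<xi>_def by auto
    have "F (\<xi> x) + blinfun_apply (F' (\<xi> x)) ((- p x, p x) - \<xi> x) \<le> F (- p x, p x)"
      by (rule tangent_below_convex[OF conv F'])
    moreover have "blinfun_apply (F' (\<xi> x)) ((- p x, p x) - \<xi> x)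
        = (\<Sum>i\<in>UNIV. ((v (x + h *\<^sub>R axis i 1) - v x) / h - p x $ i) * A i)
          + (\<Sum>i\<in>UNIV. ((v (x - h *\<^sub>R axis i 1) - v x) / h + p x $ i) * B i)"
    proof -
      have eq: "(- p x, p x) - \<xi> x = (\<chi> i. (v (x + h *\<^sub>R axis i 1) - v x) / h - p x $ i,
          \<chi> i. (v (x - h *\<^sub>R axis i 1) - v x) / h + p x $ i)"
        by (auto simp: \<xi>_def vec_eq_iff fwd_diff_def bwd_diff_def fwd_slope_def bwd_slope_def diff_divide_distrib)
      show ?thesis unfolding A_def B_def eq
        by (subst pair_coordinates) (simp_all add: bounded_linear.linear[OF blinfun.bounded_linear_right])
    qed
    ultimately have "F (\<xi> x) \<le> F (- p x, p x)
        + (\<Sum>i\<in>UNIV. - ((v (x + h *\<^sub>R axis i 1) - v x) / h - p x $ i) * A i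
            + - ((v (x - h *\<^sub>R axis i 1) - v x) / h + p x $ i) * B i)"
      unfolding sum.distrib mult_minus_left sum_negf by linarith
    also have "(\<Sum>i\<in>UNIV. - ((v (x + h *\<^sub>R axis i 1) - v x) / h - p x $ i) * A i
            + - ((v (x - h *\<^sub>R axis i 1) - v x) / h + p x $ i) * B i) \<le> (\<Sum>i\<in>UNIV. M * (?c + D i x))"
    proof (rule sum_mono)
      fix i
      \<comment> \<open>Errors of the one-sided differences of \<open>V\<close>; the gradient cancels in their sum.\<close>
      define \<tau> where "\<tau> = (V x - V (x + h *\<^sub>R axis i 1)) / h + p x $ i + K * h"
      define \<sigma> where "\<sigma> = (V x - V (x - h *\<^sub>R axis i 1)) / h - p x $ i + K * h"
      let ?e = "2 * (L * r) / h"
      have "h * (a / h + q + K * h) = a + h * q + K * h\<^sup>2" "h * (a / h - q + K * h) = a - h * q + K * h\<^sup>2" for a q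
        using h by (simp_all add: distrib_left right_diff_distrib power2_eq_square)
      then have "0 \<le> h * \<tau>" "0 \<le> h * \<sigma>"
        using tangent[of x h i] tangent[of x "- h" i] unfolding \<tau>_def \<sigma>_def by simp_all
      then have \<tau>\<sigma>: "0 \<le> \<tau>" "0 \<le> \<sigma>" using h by (simp_all add: zero_le_mult_iff)
      have Lr: "0 \<le> ?e" using L r h by simp
      have "0 \<le> K * h" using K h unfolding semiconcave_def by simp
      moreover have slope: "- ((v y - v x) / h) \<le> (V x - V y) / h + ?e" for y
      proof -
        have "v x - v y \<le> V x - V y + 2 * (L * r)" using close[of x] close[of y] by (simp add: abs_le_iff)
        then have "(v x - v y) / h \<le> (V x - V y + 2 * (L * r)) / h" using h by (intro divide_right_mono) auto
        then show ?thesis by (simp add: add_divide_distrib diff_divide_distrib)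
      qed
      ultimately have 1: "- ((v (x + h *\<^sub>R axis i 1) - v x) / h - p x $ i) \<le> ?e + \<tau>"
        and 2: "- ((v (x - h *\<^sub>R axis i 1) - v x) / h + p x $ i) \<le> ?e + \<sigma>"
        using slope[of "x + h *\<^sub>R axis i 1"] slope[of "x - h *\<^sub>R axis i 1"] unfolding \<tau>_def \<sigma>_def by linarith+
      have "- ((v (x + h *\<^sub>R axis i 1) - v x) / h - p x $ i) * A i \<le> (?e + \<tau>) * M"
        using 1 A(1)[of i] A(2)[of i] \<tau>\<sigma> Lr by (meson add_nonneg_nonneg mult_left_mono mult_right_mono order_trans)
      moreover have "- ((v (x - h *\<^sub>R axis i 1) - v x) / h + p x $ i) * B i \<le> (?e + \<sigma>) * M"
        using 2 B(1)[of i] B(2)[of i] \<tau>\<sigma> Lr by (meson add_nonneg_nonneg mult_left_mono mult_right_mono order_trans)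
      moreover have "(?e + \<tau>) * M + (?e + \<sigma>) * M = M * (?c + D i x)"
      proof -
        have "?e + \<tau> + (?e + \<sigma>) = ?c + D i x"
          by (simp add: \<tau>_def \<sigma>_def D_def add_divide_distrib diff_divide_distrib)
        then show ?thesis by (metis distrib_right mult.commute)
      qed
      ultimately show "- ((v (x + h *\<^sub>R axis i 1) - v x) / h - p x $ i) * A i
            + - ((v (x - h *\<^sub>R axis i 1) - v x) / h + p x $ i) * B i \<le> M * (?c + D i x)" by linarith
    qed
    finally show ?thesis by (simp add: sum_distrib_left)
  qed
  have contVs: "continuous_on UNIV (\<lambda>x. V (x + s *\<^sub>R axis i 1))" for s i
    by (intro continuous_on_compose2[OF contV] continuous_intros) auto
  have contD: "continuous_on UNIV (D i)" for i
  proof -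
    have "continuous_on UNIV (\<lambda>x. (2 * V x - V (x + h *\<^sub>R axis i 1) - V (x + (- h) *\<^sub>R axis i 1)) / h)"
      by (intro continuous_intros contV contVs) (use h in auto)
    then show ?thesis by (simp add: D_def[abs_def])
  qed
  have int: "g integrable_on cbox 0 1" if "continuous_on UNIV g" for g :: "real ^ 'n \<Rightarrow> real"
    by (intro integrable_continuous continuous_on_subset[OF that]) auto
  have D0: "integral (cbox 0 1) (D i) = 0" for i
  proof -
    have perV: "torus_periodic V" unfolding V_def by (rule mollify_periodic[OF per])
    have s: "integral (cbox 0 1) (\<lambda>x. V (x + s *\<^sub>R axis i 1)) = integral (cbox 0 1) V" if "\<bar>s\<bar> \<le> 1" for s
      by (rule integral_torus_shift[OF perV contV that])
    have "integral (cbox 0 1) (D i) = integral (cbox 0 1) (\<lambda>x. (2 * V x - V (x + h *\<^sub>R axis i 1) - V (x + (- h) *\<^sub>R axis i 1)) / h)"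
      by (simp add: D_def[abs_def])
    also have "\<dots> = integral (cbox 0 1) (\<lambda>x. 2 * V x - V (x + h *\<^sub>R axis i 1) - V (x + (- h) *\<^sub>R axis i 1)) / h"
      by simp
    also have "integral (cbox 0 1) (\<lambda>x. 2 * V x - V (x + h *\<^sub>R axis i 1) - V (x + (- h) *\<^sub>R axis i 1))
        = integral (cbox 0 1) (\<lambda>x. 2 * V x) - integral (cbox 0 1) (\<lambda>x. V (x + h *\<^sub>R axis i 1))
          - integral (cbox 0 1) (\<lambda>x. V (x + (- h) *\<^sub>R axis i 1))"
      by (subst integral_diff, (intro int continuous_intros contV contVs)+,
          subst integral_diff, (intro int continuous_intros contV contVs)+, rule refl)
    also have "\<dots> = 0" using s[of h] s[of "- h"] h by simp
    finally show ?thesis by simp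
  qed
  have cont1: "continuous_on UNIV (\<lambda>x. F (- p x, p x))"
    by (intro continuous_on_compose2[OF contF] continuous_intros contp) auto
  have cont2: "continuous_on UNIV (\<lambda>x. M * (\<Sum>i\<in>UNIV. ?c + D i x))"
    by (intro continuous_intros contD)
  have "integral (cbox 0 1) (\<lambda>x. F (\<xi> x)) \<le> integral (cbox 0 1) (\<lambda>x. F (- p x, p x) + M * (\<Sum>i\<in>UNIV. ?c + D i x))"
  proof (rule integral_cube_mono)
    show "continuous_on UNIV (\<lambda>x. F (\<xi> x))"
      unfolding \<xi>_def by (rule continuous_on_compose2[OF contF continuous_slopes[OF v]]) auto
    show "continuous_on UNIV (\<lambda>x. F (- p x, p x) + M * (\<Sum>i\<in>UNIV. ?c + D i x))"
      by (intro continuous_on_add cont1 cont2)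
  qed (rule pointwise)
  also have "\<dots> = integral (cbox 0 1) (\<lambda>x. F (- p x, p x)) + integral (cbox 0 1) (\<lambda>x. M * (\<Sum>i\<in>UNIV. ?c + D i x))"
    by (rule integral_cube_add[OF cont1 cont2])
  also have "integral (cbox 0 1) (\<lambda>x. M * (\<Sum>i\<in>UNIV. ?c + D i x)) = M * (\<Sum>i\<in>(UNIV :: 'n set). integral (cbox 0 1) (\<lambda>x. ?c + D i x))"
  proof -
    have "continuous_on UNIV (\<lambda>x. ?c + D i x)" for i by (intro continuous_intros contD)
    from int[OF this] show ?thesis by (simp add: integral_sum)
  qed
  also have "(\<Sum>i\<in>(UNIV :: 'n set). integral (cbox 0 1) (\<lambda>x. ?c + D i x)) = (\<Sum>i\<in>(UNIV :: 'n set). ?c)"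
  proof (intro sum.cong refl)
    fix i
    have "integral (cbox 0 1) (\<lambda>x. ?c + D i x) = integral (cbox (0 :: real ^ 'n) 1) (\<lambda>x. ?c) + integral (cbox 0 1) (D i)"
      by (rule integral_cube_add[OF continuous_on_const contD])
    then show "integral (cbox 0 1) (\<lambda>x. ?c + D i x) = ?c" unfolding D0 integral_cube_const by simp
  qed
  finally show ?thesis unfolding \<xi>_def p_def by (simp add: mult.assoc)
qed

section \<open>Growth of the mass difference\<close>

lemma mollify_grad_in_box:
  fixes v :: "real ^ 'n \<Rightarrow> real"
  assumes r: "r > 0" and v: "continuous_on UNIV v"
    and lipR: "\<And>x i s. v (x + s *\<^sub>R axis i 1) \<le> v x + R * \<bar>s\<bar>"
  shows "\<bar>mollify_grad r v x $ i\<bar> \<le> R"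
proof -
  have le: "mollify_deriv r v x (a *\<^sub>R axis i 1) \<le> R" if a: "a = 1 \<or> a = -1" for a
  proof (rule derivative_le_from_increments[OF mollify_has_derivative[OF r v] zero_less_one])
    fix s :: real assume s: "0 < s" "s \<le> 1"
    show "mollify r v (x + s *\<^sub>R a *\<^sub>R axis i 1) \<le> mollify r v x + s * R"
    proof (rule mollify_diff_le[OF r v v])
      fix w :: "real ^ 'n"
      have "v (x + w + (s * a) *\<^sub>R axis i 1) \<le> v (x + w) + R * \<bar>s * a\<bar>" by (rule lipR)
      moreover have "R * \<bar>s * a\<bar> = s * R" using a s by (auto simp: abs_mult)
      moreover have "x + w + (s * a) *\<^sub>R axis i 1 = x + s *\<^sub>R a *\<^sub>R axis i 1 + w" by simp
      ultimately show "v (x + s *\<^sub>R a *\<^sub>R axis i 1 + w) \<le> v (x + w) + s * R" by simp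
    qed
  qed
  have "mollify_deriv r v x (- axis i 1) = - mollify_deriv r v x (axis i 1)"
    by (rule linear_neg[OF has_derivative_linear[OF mollify_has_derivative[OF r v]]])
  then show ?thesis using le[of 1] le[of "-1"] by (simp add: mollify_grad_nth[OF r v] abs_le_iff)
qed

text \<open>
  Let \<open>u1\<close> be reachable from \<open>u0\<close> in one time step by the Hopf-Lax inequality, with \<open>v \<le> u0 + c\<close>.
  At each \<open>x\<close> the control is the one that is optimal for \<open>p = DV x\<close>.  Semiconcavity permits a
  Taylor expansion of \<open>U0 (x - dt q)\<close> from above with an error \<open>O(dt\<^sup>2)\<close> that does not depend on the
  mollification, and the cost contributes \<open>dt * (p \<bullet> q - H p)\<close>.  So \<open>\<integral> u1\<close> is at most
  \<open>\<integral> U0 - dt \<integral> D(U0 - V) \<bullet> q - dt \<integral> H (DV)\<close> up to small terms, while the scheme loses at most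
  \<open>dt \<integral> H (DV)\<close> up to consistency errors.
\<close>

lemma mass_increment:
  fixes u0 u1 v :: "real ^ 'n \<Rightarrow> real" and F' :: "(real ^ 'n) \<times> (real ^ 'n) \<Rightarrow> ((real ^ 'n) \<times> (real ^ 'n)) \<Rightarrow>\<^sub>L real"
  assumes conv: "convex_on UNIV F" and F': "\<And>\<zeta>. (F has_derivative blinfun_apply (F' \<zeta>)) (at \<zeta>)"
    and pos: "\<And>\<zeta> i. \<zeta> \<in> slope_box R \<Longrightarrow> 0 \<le> blinfun_apply (F' \<zeta>) (axis i 1, 0) \<and> 0 \<le> blinfun_apply (F' \<zeta>) (0, axis i 1)"
    and M: "\<And>\<zeta> i. \<zeta> \<in> slope_box R \<Longrightarrow> blinfun_apply (F' \<zeta>) (axis i 1, 0) \<le> M \<and> blinfun_apply (F' \<zeta>) (0, axis i 1) \<le> M"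
    and M0: "M \<ge> 0"
    and FH: "\<And>p. F (- p, p) = H p" and convH: "convex_on UNIV H"
    and H': "\<And>p. (H has_derivative blinfun_apply (H' p)) (at p)"
    and H'': "\<And>p. (H' has_derivative blinfun_apply (H'' p)) (at p)" and contH'': "continuous_on UNIV H''"
    and B: "\<And>p. (\<And>i. \<bar>p $ i\<bar> \<le> R) \<Longrightarrow> norm (H'' p) \<le> B" and B0: "B \<ge> 0"
    and a: "\<And>p. (\<And>i. \<bar>p $ i\<bar> \<le> R) \<Longrightarrow> norm (fst (optimal_control F F' p)) \<le> a"
    and u0: "continuous_on UNIV u0" "torus_periodic u0" "semiconcave K u0"
    and u1: "continuous_on UNIV u1"
    and v: "continuous_on UNIV v" "torus_periodic v" "semiconcave K v"
    and L: "L \<ge> 0" and lip: "\<And>x y. \<bar>u0 x - u0 y\<bar> \<le> L * norm (x - y)" "\<And>x y. \<bar>u1 x - u1 y\<bar> \<le> L * norm (x - y)"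
      "\<And>x y. \<bar>v x - v y\<bar> \<le> L * norm (x - y)"
    and lipR: "\<And>x i s. v (x + s *\<^sub>R axis i 1) \<le> v x + R * \<bar>s\<bar>"
    and box: "\<And>x. (- fwd_diff h v x, bwd_diff h v x) \<in> slope_box R"
    and step: "\<And>p x. (\<And>i. \<bar>p $ i\<bar> \<le> R) \<Longrightarrow>
        u1 x \<le> u0 (x - dt *\<^sub>R fst (optimal_control F F' p)) + dt * snd (optimal_control F F' p)"
    and below: "\<And>x. v x \<le> u0 x + c"
    and h: "0 < h" "h \<le> 1" and dt: "0 < dt"
  defines "C \<equiv> 2 * K * real CARD('n) * B"
  shows "integral (cbox 0 1) u1 - integral (cbox 0 1) (scheme_step F h dt v)
    \<le> (1 + dt * C) * (integral (cbox 0 1) u0 - integral (cbox 0 1) v)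
      + dt * (C * c + (2 * L + 2 * L * C + K * a\<^sup>2 + M * real CARD('n) * (4 * L + 2 * K)) * (h + dt))"
proof -
  \<comment> \<open>Small enough for \<open>L r\<close> to be negligible against \<open>h dt\<close>, and \<open>L r / h\<close> against \<open>h\<close>.\<close>
  define r where "r = h * min h dt"
  have r: "r > 0" using h dt by (simp add: r_def)
  define U0 where "U0 = mollify r u0"
  define V where "V = mollify r v"
  define p where "p = mollify_grad r v"
  define b where "b x = (\<chi> i. blinfun_apply (H' (p x)) (axis i 1))" for x
  define f where "f x = U0 x - V x + c" for x
  define Df where "Df x k = mollify_deriv r u0 x k - mollify_deriv r v x k" for x k
  have K0: "K > 0" using u0(3) unfolding semiconcave_def by blast
  have C0: "C \<ge> 0" using K0 B0 by (simp add: C_def)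
  have contU0: "continuous_on UNIV U0" and contV: "continuous_on UNIV V" and contp: "continuous_on UNIV p"
    unfolding U0_def V_def p_def using continuous_mollify[OF r] continuous_mollify_grad[OF r] u0 v by auto
  have contH': "continuous_on UNIV H'"
    by (rule has_derivative_continuous_on[OF has_derivative_at_withinI[OF H'']])
  have contH: "continuous_on UNIV H"
    by (rule has_derivative_continuous_on[OF has_derivative_at_withinI[OF H']])
  have contHp: "continuous_on UNIV (\<lambda>x. H (p x))" by (rule continuous_on_compose2[OF contH contp]) auto
  have contb: "continuous_on UNIV b"
    unfolding b_def[abs_def] by (intro continuous_on_vec_lambda continuous_intros continuous_on_compose2[OF contH' contp]) auto
  have Df_inner: "Df x k = k \<bullet> (mollify_grad r u0 x - mollify_grad r v x)" for x k
    by (simp add: Df_def inner_diff_right inner_mollify_grad[OF r] u0(1) v(1))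
  have contDfb: "continuous_on UNIV (\<lambda>x. - Df x (b x))"
    unfolding Df_inner by (intro continuous_intros contb continuous_mollify_grad[OF r] u0 v)
  have pbox: "\<bar>p x $ i\<bar> \<le> R" for x i unfolding p_def by (rule mollify_grad_in_box[OF r v(1) lipR])
  have H'F': "blinfun_apply (H' q) k = blinfun_apply (F' (- q, q)) (- k, k)" for q k
  proof -
    have "((\<lambda>q. (- q, q)) has_derivative (\<lambda>k. (- k, k))) (at q)" by (auto intro!: derivative_eq_intros)
    from has_derivative_compose[OF this F'] have "(H has_derivative (\<lambda>k. blinfun_apply (F' (- q, q)) (- k, k))) (at q)"
      by (simp add: FH)
    from has_derivative_unique[OF H' this] show ?thesis by (rule fun_cong)
  qed
  have b_eq: "b x = fst (optimal_control F F' (p x))" for x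
    by (simp add: b_def optimal_control_def H'F')
  have l_eq: "snd (optimal_control F F' (p x)) = b x \<bullet> p x - H (p x)" for x
    unfolding b_eq by (simp add: inner_commute[of "fst _"] inner_optimal_control) (simp add: optimal_control_def FH)
  have pointwise: "mollify r u1 x \<le> U0 x + dt * - Df x (b x) + - dt * H (p x) + K * a\<^sup>2 * dt\<^sup>2" for x
  proof -
    have "mollify r u1 x \<le> U0 (x - dt *\<^sub>R b x) + dt * (b x \<bullet> p x - H (p x))"
      unfolding U0_def
    proof (rule mollify_diff_le[OF r u1 u0(1)])
      show "u1 (x + w) \<le> u0 (x - dt *\<^sub>R b x + w) + dt * (b x \<bullet> p x - H (p x))" for w
        using step[OF pbox, of "x + w" x] unfolding b_eq[symmetric] l_eq by (simp add: algebra_simps)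
    qed
    also have "U0 (x - dt *\<^sub>R b x) \<le> U0 x - dt * mollify_deriv r u0 x (b x) + K * a\<^sup>2 * dt\<^sup>2"
    proof -
      have "U0 (x + - (dt *\<^sub>R b x)) \<le> U0 x + mollify_deriv r u0 x (- (dt *\<^sub>R b x)) + K * (- (dt *\<^sub>R b x) \<bullet> - (dt *\<^sub>R b x))"
        unfolding U0_def
        by (rule semiconcave_tangent_above[OF mollify_semiconcave[OF r u0(1,3)] mollify_has_derivative[OF r u0(1)]])
      moreover have "mollify_deriv r u0 x (- (dt *\<^sub>R b x)) = - (dt * mollify_deriv r u0 x (b x))"
        unfolding inner_mollify_grad[OF r u0(1), symmetric] by simp
      moreover have "K * (- (dt *\<^sub>R b x) \<bullet> - (dt *\<^sub>R b x)) \<le> K * a\<^sup>2 * dt\<^sup>2"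
      proof -
        have "(norm (b x))\<^sup>2 \<le> a\<^sup>2" using a[OF pbox] unfolding b_eq by (intro power_mono) auto
        then have "K * dt\<^sup>2 * (norm (b x))\<^sup>2 \<le> K * dt\<^sup>2 * a\<^sup>2" using K0 by (intro mult_left_mono) auto
        moreover have "- (dt *\<^sub>R b x) \<bullet> - (dt *\<^sub>R b x) = dt\<^sup>2 * (norm (b x))\<^sup>2"
          by (simp add: power2_norm_eq_inner power2_eq_square[of dt])
        ultimately show ?thesis by (simp only: mult_ac)
      qed
      ultimately show ?thesis by simp
    qed
    finally show ?thesis
      unfolding Df_def by (simp add: p_def inner_mollify_grad[OF r v(1)] algebra_simps)
  qed
  have contU1: "continuous_on UNIV (mollify r u1)" by (rule continuous_mollify[OF r u1])
  have "integral (cbox 0 1) (mollify r u1)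
      \<le> integral (cbox 0 1) (\<lambda>x. U0 x + dt * - Df x (b x) + - dt * H (p x) + K * a\<^sup>2 * dt\<^sup>2)"
    by (rule integral_cube_mono[OF contU1 _ pointwise]) (intro continuous_on_add continuous_on_mult continuous_on_const contU0 contDfb contHp)
  also have "\<dots> = integral (cbox 0 1) U0 + integral (cbox 0 1) (\<lambda>x. dt * - Df x (b x))
      + integral (cbox 0 1) (\<lambda>x. - dt * H (p x)) + K * a\<^sup>2 * dt\<^sup>2"
    by (subst integral_cube_add, (intro continuous_on_add continuous_on_mult continuous_on_const contU0 contDfb contHp)+)+
       (simp only: integral_cube_const)
  also have "integral (cbox 0 1) (\<lambda>x. dt * - Df x (b x)) = dt * integral (cbox 0 1) (\<lambda>x. - Df x (b x))"
    by (rule integral_mult_right)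
  also have "integral (cbox 0 1) (\<lambda>x. - dt * H (p x)) = - dt * integral (cbox 0 1) (\<lambda>x. H (p x))"
    by (rule integral_mult_right)
  finally have U1: "integral (cbox 0 1) (mollify r u1) \<le> integral (cbox 0 1) U0
      + dt * integral (cbox 0 1) (\<lambda>x. - Df x (b x)) + - dt * integral (cbox 0 1) (\<lambda>x. H (p x)) + K * a\<^sup>2 * dt\<^sup>2" .
  have "integral (cbox 0 1) (\<lambda>x. - Df x (b x)) \<le> C * integral (cbox 0 1) f"
    unfolding C_def b_def p_def
  proof (rule drift_divergence_bound[OF r v convH H' H'' contH''])
    show "norm (H'' (mollify_grad r v x)) \<le> B" for x using B[OF pbox[of x]] by (simp add: p_def)
    show "(f has_derivative Df x) (at x)" for x
      unfolding f_def[abs_def] Df_def[abs_def] U0_def V_def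
      using has_derivative_add[OF has_derivative_diff[OF mollify_has_derivative[OF r u0(1)] mollify_has_derivative[OF r v(1)]]
          has_derivative_const[of c]] by simp
    show "continuous_on UNIV (\<lambda>x. Df x k)" for k
      unfolding Df_def by (intro continuous_intros continuous_mollify_deriv[OF r] u0 v)
    show "torus_periodic f"
      using mollify_periodic[OF u0(2), of r] mollify_periodic[OF v(2), of r]
      unfolding f_def U0_def V_def torus_periodic_def by simp
    show "f x \<ge> 0" for x
    proof -
      have "V x \<le> U0 x + c" unfolding V_def U0_def by (rule mollify_diff_le[OF r v(1) u0(1) below])
      then show ?thesis by (simp add: f_def)
    qed
  qed
  then have drift: "dt * integral (cbox 0 1) (\<lambda>x. - Df x (b x)) \<le> dt * (C * integral (cbox 0 1) f)"
    using dt by (intro mult_left_mono) auto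
  have int_f: "integral (cbox 0 1) f = integral (cbox 0 1) U0 - integral (cbox 0 1) V + c"
  proof -
    have "integral (cbox 0 1) f = integral (cbox 0 1) (\<lambda>x. U0 x - V x) + c"
      unfolding f_def[abs_def] by (subst integral_cube_add) (auto intro!: continuous_intros contU0 contV simp only: integral_cube_const)
    also have "integral (cbox 0 1) (\<lambda>x. U0 x - V x) = integral (cbox 0 1) U0 - integral (cbox 0 1) V"
      by (intro integral_diff integrable_continuous) (auto intro: continuous_on_subset contU0 contV)
    finally show ?thesis .
  qed
  have close: "\<bar>integral (cbox 0 1) (mollify r w) - integral (cbox 0 1) w\<bar> \<le> L * r"
    if w: "continuous_on UNIV w" "\<And>x y. \<bar>w x - w y\<bar> \<le> L * norm (x - y)" for w :: "real ^ 'n \<Rightarrow> real"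
  proof -
    note cl = mollify_close[OF r w(1) L w(2)] and cm = continuous_mollify[OF r w(1)]
    have "integral (cbox 0 1) (mollify r w) \<le> integral (cbox 0 1) (\<lambda>x. w x + L * r)"
    proof (rule integral_cube_mono[OF cm])
      show "mollify r w x \<le> w x + L * r" for x using cl[of x] by (simp add: abs_le_iff)
    qed (intro continuous_intros w)
    moreover have "integral (cbox 0 1) w \<le> integral (cbox 0 1) (\<lambda>x. mollify r w x + L * r)"
    proof (rule integral_cube_mono[OF w(1)])
      show "w x \<le> mollify r w x + L * r" for x using cl[of x] by (simp add: abs_le_iff)
    qed (intro continuous_intros cm)
    ultimately show ?thesis
      using w(1) cm by (simp only: integral_cube_add continuous_on_const integral_cube_const)
  qed
  have scheme: "integral (cbox 0 1) (scheme_step F h dt v)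
      \<ge> integral (cbox 0 1) v - dt * (integral (cbox 0 1) (\<lambda>x. H (p x)) + M * real CARD('n) * (4 * (L * r) / h + 2 * K * h))"
  proof -
    have contF: "continuous_on UNIV F"
      by (rule has_derivative_continuous_on[OF has_derivative_at_withinI[OF F']])
    have contF\<xi>: "continuous_on UNIV (\<lambda>x. F (- fwd_diff h v x, bwd_diff h v x))"
      by (rule continuous_on_compose2[OF contF continuous_slopes[OF v(1)]]) auto
    have "integral (cbox 0 1) (scheme_step F h dt v)
        = integral (cbox 0 1) (\<lambda>x. v x + - dt * F (- fwd_diff h v x, bwd_diff h v x))"
      by (simp add: scheme_step_def[abs_def])
    also have "\<dots> = integral (cbox 0 1) v + integral (cbox 0 1) (\<lambda>x. - dt * F (- fwd_diff h v x, bwd_diff h v x))"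
      by (rule integral_cube_add[OF v(1)]) (intro continuous_on_mult continuous_on_const contF\<xi>)
    also have "integral (cbox 0 1) (\<lambda>x. - dt * F (- fwd_diff h v x, bwd_diff h v x))
        = - dt * integral (cbox 0 1) (\<lambda>x. F (- fwd_diff h v x, bwd_diff h v x))"
      by (rule integral_mult_right)
    finally have "integral (cbox 0 1) (scheme_step F h dt v)
        = integral (cbox 0 1) v - dt * integral (cbox 0 1) (\<lambda>x. F (- fwd_diff h v x, bwd_diff h v x))" by simp
    moreover have "dt * integral (cbox 0 1) (\<lambda>x. F (- fwd_diff h v x, bwd_diff h v x))
        \<le> dt * (integral (cbox 0 1) (\<lambda>x. H (p x)) + M * real CARD('n) * (4 * (L * r) / h + 2 * K * h))"
      using numerical_flux_consistency[OF conv F' pos M r v L lip(3) box h] dt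
      unfolding p_def FH by (intro mult_left_mono) auto
    ultimately show ?thesis by linarith
  qed
  define X where "X = integral (cbox 0 1) u0 - integral (cbox 0 1) v"
  define Y where "Y = integral (cbox 0 1) U0 - integral (cbox 0 1) V"
  define Hp where "Hp = integral (cbox 0 1) (\<lambda>x. H (p x))"
  have cl: "integral (cbox 0 1) u1 \<le> integral (cbox 0 1) (mollify r u1) + L * r"
    "integral (cbox 0 1) U0 \<le> integral (cbox 0 1) u0 + L * r" "integral (cbox 0 1) v \<le> integral (cbox 0 1) V + L * r"
    using close[OF u1 lip(2)] close[OF u0(1) lip(1)] close[OF v(1) lip(3)] unfolding U0_def V_def by (auto simp: abs_le_iff)
  have YX: "Y \<le> X + 2 * (L * r)" using cl unfolding X_def Y_def by linarith
  have r_h: "r \<le> h * h" "r \<le> h * dt" using h by (auto simp: r_def intro!: mult_left_mono)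
  then have Lr: "L * r \<le> L * (h * dt)" "L * r \<le> L * (h * h)" using L by (auto intro: mult_left_mono)
  have hh: "h * h \<le> h" using h by (simp add: mult_left_le)
  have Lr_h: "L * r \<le> L * h" using Lr(2) mult_left_mono[OF hh L] by linarith
  have Lrh: "(L * r) / h \<le> L * h" using Lr(2) h by (simp add: divide_le_eq mult.assoc)
  have "M * real CARD('n) * (4 * (L * r) / h + 2 * K * h) \<le> M * real CARD('n) * (4 * (L * h) + 2 * K * h)"
    using Lrh M0 by (intro mult_left_mono add_right_mono) auto
  then have cons: "dt * (M * real CARD('n) * (4 * (L * r) / h + 2 * K * h)) \<le> dt * (M * real CARD('n) * (4 * (L * h) + 2 * K * h))"
    by (rule mult_left_mono) (use dt in simp)
  have "C * (Y + c) \<le> C * (X + 2 * (L * h) + c)" using YX Lr_h C0 by (intro mult_left_mono) auto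
  then have tr: "dt * (C * (Y + c)) \<le> dt * (C * (X + 2 * (L * h) + c))"
    by (rule mult_left_mono) (use dt in simp)
  have "integral (cbox 0 1) u1 - integral (cbox 0 1) (scheme_step F h dt v)
      \<le> X + 2 * (L * r) + dt * (C * (Y + c)) + K * a\<^sup>2 * dt\<^sup>2 + dt * (M * real CARD('n) * (4 * (L * r) / h + 2 * K * h))"
    using U1 drift scheme cl unfolding int_f Y_def[symmetric] X_def Hp_def[symmetric] by (simp add: algebra_simps)
  also have "\<dots> \<le> X + 2 * (L * (h * dt)) + dt * (C * (X + 2 * (L * h) + c)) + K * a\<^sup>2 * dt\<^sup>2
      + dt * (M * real CARD('n) * (4 * (L * h) + 2 * K * h))"
    using Lr(1) tr cons by linarith
  also have "\<dots> = (1 + dt * C) * X + dt * (C * c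
      + ((2 * L + 2 * L * C + M * real CARD('n) * (4 * L + 2 * K)) * h + K * a\<^sup>2 * dt))"
    by (simp add: algebra_simps power2_eq_square)
  also have "\<dots> \<le> (1 + dt * C) * X + dt * (C * c
      + (2 * L + 2 * L * C + K * a\<^sup>2 + M * real CARD('n) * (4 * L + 2 * K)) * (h + dt))"
  proof -
    define E1 where "E1 = 2 * L + 2 * L * C + M * real CARD('n) * (4 * L + 2 * K)"
    define E2 where "E2 = K * a\<^sup>2"
    have "E1 \<ge> 0" "E2 \<ge> 0" using L C0 M0 K0 by (simp_all add: E1_def E2_def)
    then have "0 \<le> E1 * dt" "0 \<le> E2 * h" using h dt by simp_all
    then have "E1 * h + E2 * dt \<le> (E1 + E2) * (h + dt)" by (simp add: algebra_simps)
    then have "dt * (C * c + (E1 * h + E2 * dt)) \<le> dt * (C * c + (E1 + E2) * (h + dt))"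
      using dt by (intro mult_left_mono add_left_mono) auto
    moreover have "E1 + E2 = 2 * L + 2 * L * C + K * a\<^sup>2 + M * real CARD('n) * (4 * L + 2 * K)"
      by (simp add: E1_def E2_def)
    ultimately show ?thesis unfolding E1_def E2_def by simp
  qed
  finally show ?thesis unfolding X_def .
qed

lemma discrete_gronwall:
  fixes X :: "nat \<Rightarrow> real"
  assumes X0: "X 0 = 0" and step: "\<And>n. n < N \<Longrightarrow> X (Suc n) \<le> (1 + d * C) * X n + d * W"
    and nonneg: "d \<ge> 0" "C \<ge> 0" "W \<ge> 0" and n: "n \<le> N"
  shows "X n \<le> real n * d * W * exp (C * (real n * d))"
  using n
proof (induction n)
  case 0 then show ?case by (simp add: X0)
next
  case (Suc n)
  let ?E = "exp (C * (real n * d))"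
  have dC: "0 \<le> d * C" using nonneg by simp
  have "X (Suc n) \<le> (1 + d * C) * X n + d * W" using Suc.prems by (intro step) simp
  also have "(1 + d * C) * X n \<le> (1 + d * C) * (real n * d * W * ?E)"
    using Suc dC by (intro mult_left_mono) auto
  also have "\<dots> \<le> exp (d * C) * (real n * d * W * ?E)"
    using nonneg by (intro mult_right_mono exp_ge_add_one_self) auto
  also have "\<dots> = real n * d * W * exp (C * (real (Suc n) * d))"
    by (simp add: exp_add[symmetric] algebra_simps)
  also have "d * W \<le> d * W * exp (C * (real (Suc n) * d))"
    using mult_left_mono[of 1 "exp (C * (real (Suc n) * d))" "d * W"] nonneg by simp
  finally show ?case by (simp add: algebra_simps)
qed

section \<open>The error estimate\<close>

lemma bounded_on_compact:
  fixes f :: "'a::topological_space \<Rightarrow> 'b::real_normed_vector"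
  assumes "compact S" "continuous_on S f"
  obtains M where "M \<ge> 0" "\<And>x. x \<in> S \<Longrightarrow> norm (f x) \<le> M"
proof -
  have "bounded (f ` S)" using assms by (intro compact_imp_bounded compact_continuous_image)
  then obtain M where "\<forall>y\<in>f ` S. norm y \<le> M" unfolding bounded_iff by blast
  then show ?thesis by (intro that[of "max 0 M"]) force+
qed

lemma torus_L1_norm_eq_integral:
  assumes "continuous_on UNIV w"
  shows "torus_L1_norm w = integral (cbox 0 1) (\<lambda>x. \<bar>w x\<bar>)"
proof -
  have "continuous_on (cbox 0 1) (\<lambda>x. \<bar>w x\<bar>)" by (intro continuous_intros continuous_on_subset[OF assms]) auto
  then have "set_integrable lborel (cbox 0 1) (\<lambda>x. \<bar>w x\<bar>)"
    unfolding set_integrable_def by (intro borel_integrable_compact) auto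
  then show ?thesis unfolding torus_L1_norm_def by (rule set_borel_integral_eq_integral(2))
qed

lemma torus_L1_norm_le:
  assumes "continuous_on UNIV w" "continuous_on UNIV b" "\<And>x. \<bar>w x\<bar> \<le> b x"
  shows "torus_L1_norm w \<le> integral (cbox 0 1) b"
  unfolding torus_L1_norm_eq_integral[OF assms(1)]
  by (rule integral_cube_mono) (auto intro!: continuous_intros assms)

lemma continuous_scheme:
  assumes "continuous_on UNIV F" "continuous_on UNIV g"
  shows "continuous_on UNIV (scheme F g h dt n)"
proof (induction n)
  case 0 then show ?case using assms by simp
next
  case (Suc n)
  then show ?case unfolding scheme.simps
    by (intro continuous_intros continuous_on_compose2[OF assms(1) continuous_slopes[OF Suc]]) auto
qed

lemma viscosity_solution_bounded:
  fixes u :: "(real ^ 'n) \<times> real \<Rightarrow> real"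
  assumes u: "viscosity_solution H g T u"
  obtains M where "M \<ge> 0" "\<And>x t. t \<in> {0..T} \<Longrightarrow> \<bar>u (x, t)\<bar> \<le> M"
proof -
  have cont: "continuous_on (UNIV \<times> {0..T}) u" and per: "\<And>s. s \<in> {0..T} \<Longrightarrow> torus_periodic (\<lambda>x. u (x, s))"
    using u unfolding viscosity_solution_def by auto
  have "compact ((cbox 0 1 :: (real ^ 'n) set) \<times> {0..T})" by (intro compact_Times) auto
  moreover have "continuous_on (cbox 0 1 \<times> {0..T}) u" by (rule continuous_on_subset[OF cont]) auto
  ultimately obtain M where M: "M \<ge> 0" "\<And>z. z \<in> cbox 0 1 \<times> {0..T} \<Longrightarrow> norm (u z) \<le> M"
    by (rule bounded_on_compact) blast
  have "\<bar>u (x, t)\<bar> \<le> M" if t: "t \<in> {0..T}" for x t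
    using torus_periodic_wrap[OF per[OF t], of x] M(2)[of "(wrap x, t)"] wrap_in_cube[of x] t by simp
  then show ?thesis using that M(1) by blast
qed

text \<open>
  Bounded slopes at scale \<open>h\<close> add up along a segment of length \<open>s\<close>, except for a remainder shorter
  than \<open>h\<close>, over which \<open>g\<close> varies by at most \<open>L h\<close>.  So an increment that exceeds \<open>R s\<close> by \<open>\<eta>\<close> forces
  \<open>\<eta> \<le> L h\<close>.
\<close>

lemma slopes_bounded_only_for_coarse_mesh:
  fixes g :: "real ^ 'n \<Rightarrow> real"
  assumes L: "L \<ge> 0" and lip: "\<And>x y. \<bar>g x - g y\<bar> \<le> L * norm (x - y)" and R: "R > 0"
    and not: "\<not> (\<forall>x i s. \<bar>g (x + s *\<^sub>R axis i 1) - g x\<bar> \<le> R * \<bar>s\<bar>)"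
  obtains h0 where "h0 > 0" "\<And>h. 0 < h \<Longrightarrow> discrete_slopes_bounded R h g \<Longrightarrow> h0 \<le> h"
proof -
  obtain x i s0 where s0: "\<bar>g (x + s0 *\<^sub>R axis i 1) - g x\<bar> > R * \<bar>s0\<bar>"
    using not unfolding not_all not_le by blast
  define y where "y = (if s0 \<ge> 0 then x else x + s0 *\<^sub>R axis i 1)"
  define s where "s = \<bar>s0\<bar>"
  define \<eta> where "\<eta> = \<bar>g (y + s *\<^sub>R axis i 1) - g y\<bar> - R * s"
  have s: "s \<ge> 0" by (simp add: s_def)
  have \<eta>: "\<eta> > 0" using s0 by (cases "s0 \<ge> 0") (auto simp: \<eta>_def y_def s_def abs_minus_commute)
  have "\<eta> / (L + 1) \<le> h" if h: "h > 0" and b: "discrete_slopes_bounded R h g" for h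
  proof -
    have b: "\<bar>g (z + h *\<^sub>R axis i 1) - g z\<bar> \<le> R * h" for z
      using b h unfolding discrete_slopes_bounded_def fwd_diff_def fwd_slope_def
      by (simp add: abs_divide divide_le_eq)
    have steps: "\<bar>g (z + (real k * h) *\<^sub>R axis i 1) - g z\<bar> \<le> R * (real k * h)" for z k
    proof (induction k)
      case (Suc k)
      have "z + (real (Suc k) * h) *\<^sub>R axis i 1 = (z + (real k * h) *\<^sub>R axis i 1) + h *\<^sub>R axis i 1"
        by (simp add: algebra_simps)
      then show ?case using Suc b[of "z + (real k * h) *\<^sub>R axis i 1"] by (simp add: algebra_simps)
    qed simp
    define k where "k = nat \<lfloor>s / h\<rfloor>"
    have k: "real k * h \<le> s" "s - real k * h \<le> h"
    proof -
      have "real k = of_int \<lfloor>s / h\<rfloor>" using s h by (simp add: k_def)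
      then have "real k \<le> s / h" "s / h \<le> real k + 1" by linarith+
      then show "real k * h \<le> s" "s - real k * h \<le> h" using h by (simp_all add: field_simps)
    qed
    have "\<bar>g (y + s *\<^sub>R axis i 1) - g (y + (real k * h) *\<^sub>R axis i 1)\<bar> \<le> L * (s - real k * h)"
    proof -
      have "y + s *\<^sub>R axis i 1 - (y + (real k * h) *\<^sub>R axis i 1) = (s - real k * h) *\<^sub>R axis i 1"
        by (simp add: algebra_simps)
      then show ?thesis using lip[of "y + s *\<^sub>R axis i 1" "y + (real k * h) *\<^sub>R axis i 1"] k(1) by simp
    qed
    also have "\<dots> \<le> L * h" using k(2) L by (rule mult_left_mono)
    finally have "\<bar>g (y + s *\<^sub>R axis i 1) - g y\<bar> \<le> L * h + R * (real k * h)"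
      using steps[of y k] by linarith
    also have "R * (real k * h) \<le> R * s" using k(1) R by (intro mult_left_mono) auto
    finally have "\<eta> \<le> L * h" by (simp add: \<eta>_def)
    also have "\<dots> \<le> (L + 1) * h" using h by simp
    finally show ?thesis using L by (simp add: divide_le_eq mult.commute)
  qed
  then show ?thesis using that[of "\<eta> / (L + 1)"] \<eta> L by simp
qed

lemma scheme_stays_near_data:
  fixes F :: "(real ^ 'n) \<times> (real ^ 'n) \<Rightarrow> real"
  assumes F': "\<And>\<zeta>. (F has_derivative blinfun_apply (F' \<zeta>)) (at \<zeta>)" and contF': "continuous_on UNIV F'"
    and h: "h > 0" and dt: "dt > 0" and mono: "monotonicity_condition F R h dt"
    and conv: "convex_on UNIV F" and R: "R > 0" and slopes: "discrete_slopes_bounded R h g"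
    and M: "\<And>\<zeta>. \<zeta> \<in> slope_box R \<Longrightarrow> \<bar>F \<zeta>\<bar> \<le> M"
  shows "\<bar>scheme F g h dt n x - g x\<bar> \<le> real n * dt * M"
proof (induction n)
  case (Suc n)
  let ?v = "scheme F g h dt n"
  have "discrete_slopes_bounded R h ?v"
    by (rule scheme_slopes[OF F' contF' h dt mono conv R slopes])
  then have "(- fwd_diff h ?v x, bwd_diff h ?v x) \<in> slope_box R"
    unfolding discrete_slopes_bounded_def slope_box_def by simp
  then have "dt * \<bar>F (- fwd_diff h ?v x, bwd_diff h ?v x)\<bar> \<le> dt * M"
    using M dt by (intro mult_left_mono) auto
  then have "\<bar>dt * F (- fwd_diff h ?v x, bwd_diff h ?v x)\<bar> \<le> dt * M" using dt by (simp add: abs_mult)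
  then show ?case using Suc by (simp add: algebra_simps)
qed simp

text \<open>
  The same control is used in every step.  That suffices for comparison with the infimum in the
  Hopf-Lax formula.
\<close>

lemma scheme_le_control:
  fixes F :: "(real ^ 'n) \<times> (real ^ 'n) \<Rightarrow> real"
  assumes F': "\<And>\<zeta>. (F has_derivative blinfun_apply (F' \<zeta>)) (at \<zeta>)" and contF': "continuous_on UNIV F'"
    and h: "h > 0" and dt: "dt > 0" and mono: "monotonicity_condition F R h dt"
    and conv: "convex_on UNIV F" and R: "R > 0" and slopes: "discrete_slopes_bounded R h g"
    and K: "semiconcave K g" and c: "c \<in> controls F a" and a: "a \<le> h / dt"
  shows "scheme F g h dt n x \<le> g (x - (real n * dt) *\<^sub>R fst c) + real n * dt * snd c + real n * (K * h * dt * a)"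
proof (induction n arbitrary: x)
  case (Suc n)
  let ?v = "scheme F g h dt n"
  have "scheme F g h dt (Suc n) x \<le> ?v (x - dt *\<^sub>R fst c) + dt * snd c + K * h * dt * a"
    unfolding scheme_Suc
    by (rule scheme_step_le_control[OF scheme_semiconcave[OF F' contF' h dt mono conv R slopes K] c h dt a])
  also have "?v (x - dt *\<^sub>R fst c) \<le> g (x - dt *\<^sub>R fst c - (real n * dt) *\<^sub>R fst c) + real n * dt * snd c + real n * (K * h * dt * a)"
    by (rule Suc.IH)
  also have "x - dt *\<^sub>R fst c - (real n * dt) *\<^sub>R fst c = x - (real (Suc n) * dt) *\<^sub>R fst c"
    by (simp add: algebra_simps)
  finally show ?case by (simp add: algebra_simps)
qed simp

text \<open>
  The estimate when \<open>R\<close> bounds the slopes of \<open>g\<close> along the axes at every scale.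
\<close>

lemma fine_mesh_estimate:
  fixes H :: "real ^ 'n \<Rightarrow> real" and g :: "real ^ 'n \<Rightarrow> real"
    and F :: "(real ^ 'n) \<times> (real ^ 'n) \<Rightarrow> real" and u :: "(real ^ 'n) \<times> real \<Rightarrow> real"
  assumes T: "T > 0" and C2H: "C2 H" and convH: "convex_on UNIV H"
    and L: "L \<ge> 0" and lip: "\<And>x y. \<bar>g x - g y\<bar> \<le> L * norm (x - y)" and K: "semiconcave K g"
    and C2F: "C2 F" and conv: "convex_on UNIV F" and FH: "\<And>p. F (- p, p) = H p" and R: "R > 0"
    and u: "viscosity_solution H g T u"
    and lipR: "\<And>x i s. \<bar>g (x + s *\<^sub>R axis i 1) - g x\<bar> \<le> R * \<bar>s\<bar>"
  obtains C where "C \<ge> 0"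
    "\<And>h dt N n. 0 < h \<Longrightarrow> h \<le> 1 \<Longrightarrow> 0 < dt \<Longrightarrow> real N * dt = T \<Longrightarrow> monotonicity_condition F R h dt \<Longrightarrow> n \<le> N \<Longrightarrow>
      torus_L1_norm (\<lambda>x. scheme F g h dt n x - u (x, real n * dt)) \<le> C * (h + dt)"
proof -
  obtain F' F'' where F': "\<And>\<zeta>. (F has_derivative blinfun_apply (F' \<zeta>)) (at \<zeta>)"
    and F'': "\<And>\<zeta>. (F' has_derivative blinfun_apply (F'' \<zeta>)) (at \<zeta>)"
    using C2F unfolding C2_def by blast
  obtain H' H'' where H': "\<And>p. (H has_derivative blinfun_apply (H' p)) (at p)"
    and H'': "\<And>p. (H' has_derivative blinfun_apply (H'' p)) (at p)" and contH'': "continuous_on UNIV H''"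
    using C2H unfolding C2_def by blast
  have contF': "continuous_on UNIV F'"
    by (rule has_derivative_continuous_on[OF has_derivative_at_withinI[OF F'']])
  have contF: "continuous_on UNIV F"
    by (rule has_derivative_continuous_on[OF has_derivative_at_withinI[OF F']])
  have contg: "continuous_on UNIV g"
    by (rule lipschitz_on_continuous_on[of L], rule lipschitz_onI) (use lip L in \<open>auto simp: dist_norm\<close>)
  have cont_u: "continuous_on (UNIV \<times> {0..T}) u" and per: "\<And>s. s \<in> {0..T} \<Longrightarrow> torus_periodic (\<lambda>x. u (x, s))"
    and init: "\<And>x. u (x, 0) = g x"
    using u unfolding viscosity_solution_def by auto
  have perg: "torus_periodic g" using per[of 0] T init by auto
  obtain M where M0: "M \<ge> 0" and M: "\<And>\<zeta>. \<zeta> \<in> slope_box R \<Longrightarrow> norm (F' \<zeta>) \<le> M"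
    using bounded_on_compact[OF compact_slope_box continuous_on_subset[OF contF' subset_UNIV]] by metis
  have "compact (cbox (\<chi> i. - R) (\<chi> i. R) :: (real ^ 'n) set)" by simp
  then obtain B where B0: "B \<ge> 0" and B': "\<And>p. p \<in> cbox (\<chi> i. - R) (\<chi> i. R) \<Longrightarrow> norm (H'' p) \<le> B"
    using bounded_on_compact[OF _ continuous_on_subset[OF contH'' subset_UNIV]] by metis
  have B: "norm (H'' p) \<le> B" if "\<And>i. \<bar>p $ i\<bar> \<le> R" for p
    using that by (intro B') (auto simp: mem_box_cart abs_le_iff minus_le_iff)
  have K0: "K > 0" using K unfolding semiconcave_def by blast
  have M_axis: "blinfun_apply (F' \<zeta>) (axis i 1, 0) \<le> M \<and> blinfun_apply (F' \<zeta>) (0, axis i 1) \<le> M"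
    if "\<zeta> \<in> slope_box R" for \<zeta> i
    using norm_blinfun[of "F' \<zeta>" "(axis i 1, 0)"] norm_blinfun[of "F' \<zeta>" "(0, axis i 1)"] M[OF that]
    by (simp add: norm_Pair abs_le_iff)
  define a0 where "a0 = 2 * real CARD('n) * M"
  define CD where "CD = 2 * K * real CARD('n) * B"
  define cU where "cU = T * K * a0"
  define E where "E = 2 * L + 2 * L * CD + K * a0\<^sup>2 + M * real CARD('n) * (4 * L + 2 * K)"
  define W where "W = CD * cU + E"
  define C where "C = T * W * exp (CD * T) + 2 * cU"
  have nonneg: "a0 \<ge> 0" "CD \<ge> 0" "cU \<ge> 0" "E \<ge> 0" "W \<ge> 0" "C \<ge> 0"
    using M0 B0 K0 T L by (simp_all add: a0_def CD_def cU_def E_def W_def C_def)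
  have "torus_L1_norm (\<lambda>x. scheme F g h dt n x - u (x, real n * dt)) \<le> C * (h + dt)"
    if h: "0 < h" "h \<le> 1" and dt: "0 < dt" and N: "real N * dt = T" and mono: "monotonicity_condition F R h dt" and n: "n \<le> N"
    for h dt N n
  proof -
    have slopes: "discrete_slopes_bounded R h g"
      unfolding discrete_slopes_bounded_iff[OF F' contF' h(1) dt mono] using lipR[of _ h] h by simp
    note ctx = F' contF' h(1) dt mono
    note sch = ctx conv R slopes
    define S where "S m = scheme F g h dt m" for m
    define U where "U m x = u (x, real m * dt)" for m x
    have time: "real m * dt \<in> {0..T}" if "m \<le> N" for m
    proof -
      have "real m * dt \<le> real N * dt" using that dt by (intro mult_right_mono) auto
      then show ?thesis using dt N by simp
    qed
    have time0: "0 \<le> real m * dt" for m using dt by (intro mult_nonneg_nonneg) auto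
    \<comment> \<open>The set of controls depends on the mesh, but its bound \<open>a0\<close> on the weights does not.\<close>
    define a where "a = min a0 (h / dt)"
    have a: "a \<le> a0" "a \<le> h / dt" "a \<ge> 0" using nonneg h dt by (auto simp: a_def)
    define \<Gamma> where "\<Gamma> = controls F a"
    have boxp: "(- p, p) \<in> slope_box R" if "\<And>i. \<bar>p $ i\<bar> \<le> R" for p :: "real ^ 'n"
      using that by (simp add: slope_box_def)
    have signs: "0 \<le> blinfun_apply (F' \<zeta>) (axis i 1, 0) \<and> 0 \<le> blinfun_apply (F' \<zeta>) (0, axis i 1)"
      if "\<zeta> \<in> slope_box R" for \<zeta> i
      using derivative_signs[OF ctx R that] by blast
    have oc: "optimal_control F F' p \<in> \<Gamma>" if p: "\<And>i. \<bar>p $ i\<bar> \<le> R" for p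
      unfolding \<Gamma>_def
    proof (rule optimal_control_in_controls[OF conv F'])
      have "(\<Sum>i\<in>UNIV. blinfun_apply (F' (- p, p)) (axis i 1, 0)) + (\<Sum>i\<in>UNIV. blinfun_apply (F' (- p, p)) (0, axis i 1))
          \<le> (\<Sum>i\<in>(UNIV :: 'n set). M) + (\<Sum>i\<in>(UNIV :: 'n set). M)"
        using M_axis[OF boxp[OF p]] by (intro add_mono sum_mono) auto
      then show "(\<Sum>i\<in>UNIV. blinfun_apply (F' (- p, p)) (axis i 1, 0)) + (\<Sum>i\<in>UNIV. blinfun_apply (F' (- p, p)) (0, axis i 1)) \<le> a"
        using derivative_sum_le[OF ctx R boxp[OF p]] by (simp add: a_def a0_def mult_ac)
    qed (use signs[OF boxp[OF p]] in auto)
    have hl_ne: "\<Gamma> \<noteq> {}" using oc[of 0] R by auto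
    have hl_cvx: "convex \<Gamma>" unfolding \<Gamma>_def by (rule convex_controls)
    have hl_speed: "norm (fst c) \<le> a" if "c \<in> \<Gamma>" for c using that unfolding \<Gamma>_def by (rule controls_speed)
    have hl_cost: "snd c \<ge> - F (0, 0)" if "c \<in> \<Gamma>" for c using that unfolding \<Gamma>_def by (rule controls_cost)
    note hl = hl_ne hl_cvx hl_speed hl_cost lip
    have u_hl: "u (x, t) = hopf_lax \<Gamma> g x t" if t: "t \<in> {0..T}" for x t
    proof (rule viscosity_eq_hopf_lax[OF T u hl_ne hl_cvx hl_speed hl_cost _ _ lip _ t])
      show "p \<bullet> fst c \<le> H p + snd c" if "c \<in> \<Gamma>" for c p
        using controls_fenchel[of c F a p] that unfolding \<Gamma>_def FH by simp
      show "\<exists>c\<in>\<Gamma>. H p + snd c \<le> p \<bullet> fst c" if p: "\<And>i. \<bar>p $ i\<bar> \<le> R" for p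
        by (rule bexI[OF _ oc[OF p]]) (unfold inner_optimal_control, simp add: optimal_control_def FH)
      show "g (x + s *\<^sub>R axis i 1) \<le> g x + R * \<bar>s\<bar>" for x i s using lipR[of x s i] by (simp add: abs_le_iff)
    qed
    have U_hl: "U m x = hopf_lax \<Gamma> g x (real m * dt)" if "m \<le> N" for m x
      unfolding U_def by (rule u_hl[OF time[OF that]])
    have contU: "continuous_on UNIV (U m)" if "m \<le> N" for m
      unfolding U_def[abs_def] by (intro continuous_on_compose2[OF cont_u] continuous_intros) (use time[OF that] in auto)
    have contS: "continuous_on UNIV (S m)" for m unfolding S_def by (rule continuous_scheme[OF contF contg])
    have U_lip: "\<bar>U m x - U m y\<bar> \<le> L * norm (x - y)" if "m \<le> N" for m x y
      unfolding U_hl[OF that] by (rule hopf_lax_lipschitz[OF hl time0])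
    have U_semi: "semiconcave K (U m)" if "m \<le> N" for m
    proof -
      have "U m = (\<lambda>x. hopf_lax \<Gamma> g x (real m * dt))" using U_hl[OF that] by auto
      then show ?thesis using hopf_lax_semiconcave[OF hl K time0] by simp
    qed
    have U_per: "torus_periodic (U m)" if "m \<le> N" for m unfolding U_def[abs_def] by (rule per[OF time[OF that]])
    have S_lip: "\<bar>S m x - S m y\<bar> \<le> L * norm (x - y)" for m x y
    proof -
      have "S m (y + z) \<le> S m y + L * norm z" for y z
        unfolding S_def
      proof (rule scheme_le_shift[OF sch])
        show "g (x + z) \<le> g x + L * norm z" for x using lip[of "x + z" x] by (simp add: abs_le_iff)
      qed
      from this[of y "x - y"] this[of x "y - x"] show ?thesis by (simp add: norm_minus_commute abs_le_iff)
    qed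
    have S_lipR: "S m (x + s *\<^sub>R axis i 1) \<le> S m x + R * \<bar>s\<bar>" for m x s i
      unfolding S_def
    proof (rule scheme_le_shift[OF sch])
      show "g (x + s *\<^sub>R axis i 1) \<le> g x + R * \<bar>s\<bar>" for x using lipR[of x s i] by (simp add: abs_le_iff)
    qed
    have S_per: "torus_periodic (S m)" for m
      unfolding torus_periodic_def
    proof (intro allI)
      fix x :: "real ^ 'n" and i
      have g_per: "g (y + axis i 1) = g y" for y using perg unfolding torus_periodic_def by blast
      have "S m (x + axis i 1) \<le> S m x + 0" unfolding S_def by (rule scheme_le_shift[OF sch]) (simp add: g_per)
      moreover have "S m ((x + axis i 1) + - axis i 1) \<le> S m (x + axis i 1) + 0"
        unfolding S_def by (rule scheme_le_shift[OF sch]) (use g_per[of "z - axis i 1" for z] in simp)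
      ultimately show "S m (x + axis i 1) = S m x" by simp
    qed
    have S_box: "(- fwd_diff h (S m) x, bwd_diff h (S m) x) \<in> slope_box R" for m x
      using scheme_slopes[OF sch, of m] unfolding discrete_slopes_bounded_def slope_box_def S_def by simp
    have S_le_U: "S m x \<le> U m x + cU * h" if m: "m \<le> N" for m x
    proof -
      have "S m x - real m * (K * h * dt * a) \<le> U m x"
        unfolding U_hl[OF m]
      proof (rule hopf_lax_greatest[OF hl])
        fix c assume "c \<in> \<Gamma>"
        then show "S m x - real m * (K * h * dt * a) \<le> g (x - (real m * dt) *\<^sub>R fst c) + real m * dt * snd c"
          using scheme_le_control[OF sch K, of c a m x] a(2) unfolding \<Gamma>_def S_def by simp
      qed
      moreover have "real m * (K * h * dt * a) \<le> cU * h"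
      proof -
        have "(real m * dt) * (K * h * a) \<le> T * (K * h * a0)"
          using time[OF m] a K0 h T by (intro mult_mono) auto
        then show ?thesis by (simp add: cU_def mult_ac)
      qed
      ultimately show ?thesis by simp
    qed
    define X where "X m = integral (cbox 0 1) (U m) - integral (cbox 0 1) (S m)" for m
    have X_step: "X (Suc m) \<le> (1 + dt * CD) * X m + dt * (W * (h + dt))" if m: "m < N" for m
    proof -
      have m': "m \<le> N" "Suc m \<le> N" using m by auto
      have S_Suc: "S (Suc m) = scheme_step F h dt (S m)" by (simp only: S_def scheme_Suc)
      have "X (Suc m) \<le> (1 + dt * CD) * X m + dt * (CD * (cU * h) + E * (h + dt))"
        unfolding X_def CD_def E_def S_Suc
      proof (rule mass_increment[where a = a0 and H' = H' and H'' = H'', OF conv F' signs M_axis M0 FH convH H' H'' contH'' B B0])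
        show "norm (fst (optimal_control F F' p)) \<le> a0" if "\<And>i. \<bar>p $ i\<bar> \<le> R" for p
          using hl_speed[OF oc[OF that]] a(1) by simp
        show "semiconcave K (S m)" unfolding S_def by (rule scheme_semiconcave[OF sch K])
        show "U (Suc m) x \<le> U m (x - dt *\<^sub>R fst (optimal_control F F' p)) + dt * snd (optimal_control F F' p)"
          if p: "\<And>i. \<bar>p $ i\<bar> \<le> R" for p x
          using hopf_lax_step[OF hl oc[OF p], of dt "real m * dt" x] dt
          unfolding U_hl[OF m'(1)] U_hl[OF m'(2)] by (simp add: algebra_simps)
      qed (use m' contU U_per U_semi contS S_per U_lip S_lip S_lipR S_box S_le_U L h dt in auto)
      also have "CD * (cU * h) + E * (h + dt) \<le> W * (h + dt)"
      proof -
        have "CD * cU * h \<le> CD * cU * (h + dt)" using nonneg dt by (intro mult_left_mono) auto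
        then show ?thesis by (simp add: W_def algebra_simps)
      qed
      finally show ?thesis using dt by (simp add: mult_left_mono)
    qed
    have X0: "X 0 = 0"
    proof -
      have "U 0 = S 0" using init by (simp add: U_def[abs_def] S_def)
      then show ?thesis by (simp add: X_def)
    qed
    have "X n \<le> real n * dt * (W * (h + dt)) * exp (CD * (real n * dt))"
      by (rule discrete_gronwall[OF X0 X_step]) (use nonneg h dt n in auto)
    also have "\<dots> \<le> T * (W * (h + dt)) * exp (CD * T)"
      using time[OF n] nonneg h dt T by (intro mult_mono) (auto intro!: mult_left_mono)
    finally have Xn: "X n \<le> T * W * exp (CD * T) * (h + dt)" by (simp add: mult_ac)
    have "torus_L1_norm (\<lambda>x. S n x - U n x) \<le> integral (cbox 0 1) (\<lambda>x. (U n x - S n x) + 2 * (cU * h))"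
    proof (rule torus_L1_norm_le)
      show "\<bar>S n x - U n x\<bar> \<le> (U n x - S n x) + 2 * (cU * h)" for x
        using S_le_U[OF n, of x] nonneg(3) h(1) by (auto simp: abs_if)
    qed (intro continuous_intros contU[OF n] contS)+
    also have "\<dots> = X n + 2 * (cU * h)"
    proof -
      have "integral (cbox 0 1) (\<lambda>x. (U n x - S n x) + 2 * (cU * h)) = integral (cbox 0 1) (\<lambda>x. U n x - S n x) + 2 * (cU * h)"
        by (subst integral_cube_add[OF continuous_on_diff[OF contU[OF n] contS] continuous_on_const]) (simp only: integral_cube_const)
      also have "integral (cbox 0 1) (\<lambda>x. U n x - S n x) = X n" unfolding X_def
        by (intro integral_diff integrable_continuous) (auto intro: continuous_on_subset contU[OF n] contS)
      finally show ?thesis .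
    qed
    also have "\<dots> \<le> T * W * exp (CD * T) * (h + dt) + 2 * cU * (h + dt)"
    proof -
      have "cU * h \<le> cU * (h + dt)" using nonneg dt by (intro mult_left_mono) auto
      then show ?thesis using Xn by linarith
    qed
    also have "\<dots> = C * (h + dt)" by (simp add: C_def algebra_simps)
    finally show ?thesis unfolding S_def U_def .
  qed
  then show ?thesis using that[OF nonneg(6)] by blast
qed

theorem theorem2p6:
  fixes H :: "real ^ 'n \<Rightarrow> real" and g :: "real ^ 'n \<Rightarrow> real"
    and F :: "(real ^ 'n) \<times> (real ^ 'n) \<Rightarrow> real"
    and u :: "(real ^ 'n) \<times> real \<Rightarrow> real"
    and T R :: real
  assumes "T > 0"
    and "C2 H" and "convex_on UNIV H" and "filterlim H at_top at_infinity"
    and "torus_periodic g" and "\<exists>L. L-lipschitz_on UNIV g" and "\<exists>K. semiconcave K g"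
    and "C2 F" and "convex_on UNIV F" and "\<And>p. F (- p, p) = H p"
    and "R > 0"
    and "viscosity_solution H g T u"
  shows "\<exists>C>0. \<forall>h dt. \<forall>N::nat.
           h > 0 \<and> dt > 0 \<and> N > 0 \<and> real N * dt = T \<and>
           monotonicity_condition F R h dt \<and> discrete_slopes_bounded R h g \<longrightarrow>
           (SUP n\<in>{0..N}. torus_L1_norm (\<lambda>x. scheme F g h dt n x - u (x, real n * dt)))
             \<le> C * (h + dt)"
proof -
  obtain L where L: "L-lipschitz_on UNIV g" using assms(6) by blast
  have L0: "L \<ge> 0" using L by (rule lipschitz_on_nonneg)
  have lip: "\<bar>g x - g y\<bar> \<le> L * norm (x - y)" for x y
    using lipschitz_onD[OF L, of x y] by (simp add: dist_norm)
  obtain K where K: "semiconcave K g" using assms(7) by blast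
  obtain F' F'' where F': "\<And>\<zeta>. (F has_derivative blinfun_apply (F' \<zeta>)) (at \<zeta>)"
    and F'': "\<And>\<zeta>. (F' has_derivative blinfun_apply (F'' \<zeta>)) (at \<zeta>)"
    using assms(8) unfolding C2_def by blast
  have contF': "continuous_on UNIV F'"
    by (rule has_derivative_continuous_on[OF has_derivative_at_withinI[OF F'']])
  have contF: "continuous_on UNIV F"
    by (rule has_derivative_continuous_on[OF has_derivative_at_withinI[OF F']])
  have cont_u: "continuous_on (UNIV \<times> {0..T}) u" and init: "\<And>x. u (x, 0) = g x"
    using assms(12) unfolding viscosity_solution_def by auto
  obtain Mu where Mu: "Mu \<ge> 0" "\<And>x t. t \<in> {0..T} \<Longrightarrow> \<bar>u (x, t)\<bar> \<le> Mu"
    using viscosity_solution_bounded[OF assms(12)] by blast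
  obtain MF where MF: "MF \<ge> 0" "\<And>\<zeta>. \<zeta> \<in> slope_box R \<Longrightarrow> norm (F \<zeta>) \<le> MF"
    using bounded_on_compact[OF compact_slope_box continuous_on_subset[OF contF subset_UNIV]] by metis
  define E0 where "E0 = T * MF + 2 * Mu"
  have E0: "E0 \<ge> 0" using assms(1) MF(1) Mu(1) by (simp add: E0_def)
  have coarse: "torus_L1_norm (\<lambda>x. scheme F g h dt n x - u (x, real n * dt)) \<le> E0"
    if h: "h > 0" and dt: "dt > 0" and N: "real N * dt = T" "n \<le> N" and mono: "monotonicity_condition F R h dt"
      and slopes: "discrete_slopes_bounded R h g" for h dt N n
  proof -
    have "real n * dt \<le> real N * dt" using N dt by (intro mult_right_mono) auto
    then have t: "real n * dt \<in> {0..T}" using dt N by simp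
    have le: "\<bar>scheme F g h dt n x - u (x, real n * dt)\<bar> \<le> E0" for x
    proof -
      have "\<bar>scheme F g h dt n x - g x\<bar> \<le> real n * dt * MF"
        using MF(2) by (intro scheme_stays_near_data[OF F' contF' h dt mono assms(9) assms(11) slopes]) simp
      also have "\<dots> \<le> T * MF" using t MF(1) by (intro mult_right_mono) auto
      finally show ?thesis
        using Mu(2)[OF t, of x] Mu(2)[of 0 x] assms(1) init[of x] unfolding E0_def by simp
    qed
    have "torus_L1_norm (\<lambda>x. scheme F g h dt n x - u (x, real n * dt)) \<le> integral (cbox (0 :: real ^ 'n) 1) (\<lambda>x. E0)"
    proof (rule torus_L1_norm_le[OF _ continuous_on_const le])
      have "continuous_on UNIV (\<lambda>x. u (x, real n * dt))"
        by (intro continuous_on_compose2[OF cont_u] continuous_intros) (use t in auto)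
      then show "continuous_on UNIV (\<lambda>x. scheme F g h dt n x - u (x, real n * dt))"
        by (intro continuous_on_diff continuous_scheme[OF contF lipschitz_on_continuous_on[OF L]])
    qed
    then show ?thesis by (simp only: integral_cube_const)
  qed
  obtain h0 C1 where h0: "h0 > 0" and C1: "C1 \<ge> 0"
    and fine: "\<And>h dt N n. 0 < h \<Longrightarrow> h < h0 \<Longrightarrow> 0 < dt \<Longrightarrow> real N * dt = T \<Longrightarrow> monotonicity_condition F R h dt \<Longrightarrow>
      discrete_slopes_bounded R h g \<Longrightarrow> n \<le> N \<Longrightarrow>
      torus_L1_norm (\<lambda>x. scheme F g h dt n x - u (x, real n * dt)) \<le> C1 * (h + dt)"
  proof (cases "\<forall>x i s. \<bar>g (x + s *\<^sub>R axis i 1) - g x\<bar> \<le> R * \<bar>s\<bar>")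
    case True
    then have lipR: "\<bar>g (x + s *\<^sub>R axis i 1) - g x\<bar> \<le> R * \<bar>s\<bar>" for x i s by blast
    obtain C where "C \<ge> 0"
      "\<And>h dt N n. 0 < h \<Longrightarrow> h \<le> 1 \<Longrightarrow> 0 < dt \<Longrightarrow> real N * dt = T \<Longrightarrow> monotonicity_condition F R h dt \<Longrightarrow> n \<le> N \<Longrightarrow>
        torus_L1_norm (\<lambda>x. scheme F g h dt n x - u (x, real n * dt)) \<le> C * (h + dt)"
      using fine_mesh_estimate[OF assms(1-3) L0 lip K assms(8-12) lipR] by blast
    then show ?thesis by (intro that[of 1 C]) auto
  next
    case False
    obtain h0 where "h0 > 0" "\<And>h. 0 < h \<Longrightarrow> discrete_slopes_bounded R h g \<Longrightarrow> h0 \<le> h"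
      using slopes_bounded_only_for_coarse_mesh[OF L0 lip assms(11) False] by blast
    then show ?thesis by (intro that[of h0 0]) force+
  qed
  define C where "C = C1 + E0 / h0 + 1"
  have C: "C > 0" using C1 E0 h0 by (simp add: C_def add_nonneg_pos)
  have "(SUP n\<in>{0..N}. torus_L1_norm (\<lambda>x. scheme F g h dt n x - u (x, real n * dt))) \<le> C * (h + dt)"
    if "h > 0 \<and> dt > 0 \<and> N > 0 \<and> real N * dt = T \<and> monotonicity_condition F R h dt \<and> discrete_slopes_bounded R h g"
    for h dt and N :: nat
  proof (rule cSUP_least)
    fix n assume "n \<in> {0..N}"
    then have n: "n \<le> N" by simp
    show "torus_L1_norm (\<lambda>x. scheme F g h dt n x - u (x, real n * dt)) \<le> C * (h + dt)"
    proof (cases "h < h0")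
      case True
      then have "torus_L1_norm (\<lambda>x. scheme F g h dt n x - u (x, real n * dt)) \<le> C1 * (h + dt)"
        using fine[of h dt N n] that n by blast
      also have "\<dots> \<le> C * (h + dt)" using that E0 h0 by (intro mult_right_mono) (auto simp: C_def)
      finally show ?thesis .
    next
      case False
      have "torus_L1_norm (\<lambda>x. scheme F g h dt n x - u (x, real n * dt)) \<le> E0"
        using coarse[of h dt N n] that n by blast
      also have "E0 = E0 / h0 * h0" using h0 by simp
      also have "\<dots> \<le> C * (h + dt)"
        using that False E0 h0 C1 by (intro mult_mono) (auto simp: C_def)
      finally show ?thesis .
    qed
  qed auto
  then show ?thesis using C by blast
qed

end
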